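(* Let $a,b,c,e$ be positive integers and $\mu:=((a+b+c+e)^a,(a+b+c)^b,(a+b)^c,a^e)$, a partition of $n-1:=a(a+b+c+e)+b(a+b+c)+c(a+b)+ea$. Then $\mu$ is an isoclinic partition if and only if $e=\frac{b^2}{c}+b$.
   Context: Notation $(l_1^{a_1},\dots)$ means $l_1$ repeated $a_1$ times, etc. For $\lambda\vdash n$, $\operatorname{Tab}(\lambda)$ is the set of standard Young tableaux, $d_\lambda=|\operatorname{Tab}(\lambda)|$, $V_\lambda$ the real Hilbert space with orthonormal basis $\{v_T\}$, and $\pi_\lambda\colon S_n\to\operatorname{U}(V_\lambda)$ Young's orthogonal form, $\pi_\lambda(s_k)v_T=\frac1{D_T(k+1,k)}v_T+\sqrt{1-\frac1{D_T(k+1,k)^2}}v_{s_kT}$, where $s_k=(k\ k{+}1)$ acts on entries, and $D_T(a,b)=(j-i)-(j'-i')$ for $a$ in box $(i,j)$, $b$ in box $(i',j')$ (second term absent if $s_kT$ not standard). For $\mu\vdash n-1$, $\mu^\uparrow$ is the set of $\lambda\vdash n$ obtained by adding one box to $\mu$'s Young diagram; for $R\in\operatorname{Tab}(\mu)$, $R^\lambda$ places $n$ in the added box; $\Psi_{\lambda,\mu}v_R=v_{R^\lambda}$. For $L\subseteq\mu^\uparrow$: $V_L=\bigoplus_{\lambda\in L}V_\lambda$, $\pi_L=\bigoplus\pi_\lambda$, $d_L=\sum d_\lambda$, $W_L=\operatorname{im}\Psi_L$ where $\Psi_L(v)=\{\sqrt{d_\lambda/d_L}\Psi_{\lambda,\mu}v\}_{\lambda\in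 L}$, and $\mathcal{W}_L=\{\pi_L(t_k)W_L\}_{k\in[n]}$ for $t_k\in S_n$ with $t_k(n)=k$. $\mu$ is isoclinic if there is a nonempty proper $L\subset\mu^\uparrow$ such that $\mathcal{W}_L$ is equi-isoclinic: for isometries $\Phi_k$ onto its members there is $\alpha$ with $(\Phi_k^*\Phi_\ell)^*(\Phi_k^*\Phi_\ell)=\alpha I$ for all $k\ne\ell$. *)

theory Defs
  imports Complex_Main "HOL-Combinatorics.Permutations"
begin

section \<open>Real Hilbert spaces with an orthonormal basis indexed by a finite set\<close>

text \<open>The Hilbert space with orthonormal basis indexed by a finite set \<open>I\<close> is the space of
  coordinate functions vanishing off \<open>I\<close>. Operators are total functions of which only the
  restriction to the relevant space is meaningful.\<close>

definition hspace :: "'i set \<Rightarrow> ('i \<Rightarrow> real) set" where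
  "hspace I = {x. \<forall>i. i \<notin> I \<longrightarrow> x i = 0}"

definition basis_vec :: "'i \<Rightarrow> 'i \<Rightarrow> real" where
  "basis_vec i = (\<lambda>j. if j = i then 1 else 0)"

definition iprod :: "'i set \<Rightarrow> ('i \<Rightarrow> real) \<Rightarrow> ('i \<Rightarrow> real) \<Rightarrow> real" where
  "iprod I x y = (\<Sum>i\<in>I. x i * y i)"

definition lin_op :: "'i set \<Rightarrow> 'j set \<Rightarrow> (('i \<Rightarrow> real) \<Rightarrow> ('j \<Rightarrow> real)) \<Rightarrow> bool" where
  "lin_op I J f \<longleftrightarrow>
     (\<forall>x \<in> hspace I. f x \<in> hspace J) \<and>
     (\<forall>x \<in> hspace I. \<forall>y \<in> hspace I. f (\<lambda>i. x i + y i) = (\<lambda>j. f x j + f y j)) \<and>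
     (\<forall>r. \<forall>x \<in> hspace I. f (\<lambda>i. r * x i) = (\<lambda>j. r * f x j))"

definition isometry_op :: "'i set \<Rightarrow> 'j set \<Rightarrow> (('i \<Rightarrow> real) \<Rightarrow> ('j \<Rightarrow> real)) \<Rightarrow> bool" where
  "isometry_op I J f \<longleftrightarrow>
     lin_op I J f \<and> (\<forall>x \<in> hspace I. \<forall>y \<in> hspace I. iprod J (f x) (f y) = iprod I x y)"

definition unitary_op :: "'i set \<Rightarrow> (('i \<Rightarrow> real) \<Rightarrow> ('i \<Rightarrow> real)) \<Rightarrow> bool" where
  "unitary_op I f \<longleftrightarrow> isometry_op I I f \<and> f ` hspace I = hspace I"

definition adj_op ::
    "'i set \<Rightarrow> 'j set \<Rightarrow> (('i \<Rightarrow> real) \<Rightarrow> ('j \<Rightarrow> real)) \<Rightarrow> ('j \<Rightarrow> real) \<Rightarrow> ('i \<Rightarrow> real)" where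
  "adj_op I J f y = (\<lambda>i. if i \<in> I then iprod J (f (basis_vec i)) y else 0)"

lemma iprod_adj_op:
  assumes "finite I" "lin_op I J f" "x \<in> hspace I"
  shows "iprod J (f x) y = iprod I x (adj_op I J f y)"
proof -
  have add: "f (\<lambda>i. u i + v i) = (\<lambda>j. f u j + f v j)" if "u \<in> hspace I" "v \<in> hspace I" for u v
    using assms(2) that unfolding lin_op_def by simp
  have scale: "f (\<lambda>i. r * u i) = (\<lambda>j. r * f u j)" if "u \<in> hspace I" for r u
    using assms(2) that unfolding lin_op_def by simp
  have *: "f (\<lambda>i. if i \<in> A then x i else 0) = (\<lambda>j. \<Sum>i\<in>A. x i * f (basis_vec i) j)"
    if "finite A" "A \<subseteq> I" for A
    using that
  proof (induction A rule: finite_induct)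
    case empty
    have "f (\<lambda>i. 0 * (\<lambda>_. 0) i) = (\<lambda>j. 0 * f (\<lambda>_. 0) j)"
      by (rule scale) (simp add: hspace_def)
    then show ?case by simp
  next
    case (insert a A)
    have b: "basis_vec a \<in> hspace I"
      using insert.prems by (auto simp: hspace_def basis_vec_def)
    then have c: "f (\<lambda>i. x a * basis_vec a i) = (\<lambda>j. x a * f (basis_vec a) j)"
      by (rule scale)
    have "(\<lambda>i. x a * basis_vec a i) \<in> hspace I" "(\<lambda>i. if i \<in> A then x i else 0) \<in> hspace I"
      using insert.prems b by (auto simp: hspace_def)
    then have "f (\<lambda>i. x a * basis_vec a i + (if i \<in> A then x i else 0)) =
        (\<lambda>j. f (\<lambda>i. x a * basis_vec a i) j + f (\<lambda>i. if i \<in> A then x i else 0) j)"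
      by (rule add)
    moreover have "(\<lambda>i. x a * basis_vec a i + (if i \<in> A then x i else 0)) =
        (\<lambda>i. if i \<in> insert a A then x i else 0)"
      using insert.hyps by (auto simp: basis_vec_def fun_eq_iff)
    ultimately show ?case
      using insert c by simp
  qed
  have "(\<lambda>i. if i \<in> I then x i else 0) = x"
    using assms(3) by (auto simp: hspace_def fun_eq_iff)
  then have "f x = (\<lambda>j. \<Sum>i\<in>I. x i * f (basis_vec i) j)"
    using *[OF assms(1) subset_refl] by simp
  then have "iprod J (f x) y = (\<Sum>j\<in>J. \<Sum>i\<in>I. x i * (f (basis_vec i) j * y j))"
    by (simp add: iprod_def sum_distrib_right mult.assoc)
  also have "\<dots> = (\<Sum>i\<in>I. \<Sum>j\<in>J. x i * (f (basis_vec i) j * y j))"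
    by (rule sum.swap)
  also have "\<dots> = iprod I x (adj_op I J f y)"
    by (simp add: iprod_def adj_op_def sum_distrib_left)
  finally show ?thesis .
qed

text \<open>The isometries onto the members \<open>W k\<close> have a common domain \<open>\<real>\<^sup>d\<close>. Another choice of
  isometries replaces \<open>\<Phi> k\<close> by \<open>\<Phi> k \<circ> U k\<close> with \<open>U k\<close> unitary, which does not affect the
  condition.\<close>

definition equi_isoclinic :: "'k set \<Rightarrow> 'j set \<Rightarrow> ('k \<Rightarrow> ('j \<Rightarrow> real) set) \<Rightarrow> bool" where
  "equi_isoclinic K J W \<longleftrightarrow>
     (\<exists>(d::nat) \<Phi> \<alpha>.
        (\<forall>k\<in>K. isometry_op {..<d} J (\<Phi> k) \<and> \<Phi> k ` hspace {..<d} = W k) \<and>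
        (\<forall>k\<in>K. \<forall>l\<in>K. k \<noteq> l \<longrightarrow>
           (let A = adj_op {..<d} J (\<Phi> k) \<circ> \<Phi> l in
              \<forall>x \<in> hspace {..<d}. adj_op {..<d} {..<d} A (A x) = (\<lambda>i. \<alpha> * x i))))"


section \<open>Partitions and standard Young tableaux\<close>

definition partition_of :: "nat list \<Rightarrow> nat \<Rightarrow> bool" where
  "partition_of lam n \<longleftrightarrow> sorted_wrt (\<ge>) lam \<and> 0 \<notin> set lam \<and> sum_list lam = n"

text \<open>Boxes are (row, column), counted from 0; only differences of \<open>column - row\<close> are used.\<close>

definition boxes :: "nat list \<Rightarrow> (nat \<times> nat) set" where
  "boxes lam = {(i, j). i < length lam \<and> j < lam ! i}"

text \<open>A tableau is its filling of the boxes, extended by 0 outside the diagram; hence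
  permutations of \<open>{1..n}\<close> act on tableaux by composition.\<close>

type_synonym tableau = "nat \<times> nat \<Rightarrow> nat"

definition Tab :: "nat list \<Rightarrow> tableau set" where
  "Tab lam = {T.
     bij_betw T (boxes lam) {1..sum_list lam} \<and>
     (\<forall>p. p \<notin> boxes lam \<longrightarrow> T p = 0) \<and>
     (\<forall>i j j'. j < j' \<and> (i, j') \<in> boxes lam \<longrightarrow> T (i, j) < T (i, j')) \<and>
     (\<forall>i i' j. i < i' \<and> (i', j) \<in> boxes lam \<longrightarrow> T (i, j) < T (i', j))}"

definition dim :: "nat list \<Rightarrow> nat" where
  "dim lam = card (Tab lam)"

definition content_at :: "nat list \<Rightarrow> tableau \<Rightarrow> nat \<Rightarrow> int" where
  "content_at lam T a = (let (i, j) = inv_into (boxes lam) T a in int j - int i)"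

definition axial_dist :: "nat list \<Rightarrow> tableau \<Rightarrow> nat \<Rightarrow> nat \<Rightarrow> int" where
  "axial_dist lam T a b = content_at lam T a - content_at lam T b"


section \<open>Young's orthogonal form\<close>

abbreviation adj_transp :: "nat \<Rightarrow> nat \<Rightarrow> nat" where
  "adj_transp k \<equiv> Transposition.transpose k (k + 1)"

definition is_young_orthogonal_form ::
    "nat list \<Rightarrow> ((nat \<Rightarrow> nat) \<Rightarrow> (tableau \<Rightarrow> real) \<Rightarrow> (tableau \<Rightarrow> real)) \<Rightarrow> bool" where
  "is_young_orthogonal_form lam \<pi> \<longleftrightarrow>
     (\<forall>\<sigma>. \<sigma> permutes {1..sum_list lam} \<longrightarrow> unitary_op (Tab lam) (\<pi> \<sigma>)) \<and>
     (\<forall>\<sigma> \<tau>. \<sigma> permutes {1..sum_list lam} \<and> \<tau> permutes {1..sum_list lam} \<longrightarrow>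
        (\<forall>x \<in> hspace (Tab lam). \<pi> (\<sigma> \<circ> \<tau>) x = \<pi> \<sigma> (\<pi> \<tau> x))) \<and>
     (\<forall>k \<in> {1..<sum_list lam}. \<forall>T \<in> Tab lam.
        \<pi> (adj_transp k) (basis_vec T) =
          (let D = real_of_int (axial_dist lam T (k + 1) k); T' = adj_transp k \<circ> T in
             (\<lambda>S. 1 / D * basis_vec T S +
                (if T' \<in> Tab lam then sqrt (1 - 1 / D\<^sup>2) * basis_vec T' S else 0))))"

text \<open>Since the adjacent transpositions generate the symmetric group, the operators
  \<open>\<pi> \<sigma>\<close> are determined on \<open>hspace (Tab lam)\<close> for every permutation \<open>\<sigma>\<close> of \<open>{1..n}\<close>; the choice
  only concerns irrelevant values.\<close>

definition young_rep :: "nat list \<Rightarrow> (nat \<Rightarrow> nat) \<Rightarrow> (tableau \<Rightarrow> real) \<Rightarrow> (tableau \<Rightarrow> real)" where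
  "young_rep lam = (SOME \<pi>. is_young_orthogonal_form lam \<pi>)"


section \<open>Isoclinic partitions\<close>

definition up :: "nat list \<Rightarrow> nat list set" where
  "up mu = {lam. partition_of lam (sum_list mu + 1) \<and>
                 (\<exists>p. p \<notin> boxes mu \<and> boxes lam = insert p (boxes mu))}"

definition extend_tab :: "nat list \<Rightarrow> nat list \<Rightarrow> tableau \<Rightarrow> tableau" where
  "extend_tab lam mu R = (\<lambda>p. if p \<in> boxes lam - boxes mu then sum_list lam else R p)"

definition Psi :: "nat list \<Rightarrow> nat list \<Rightarrow> (tableau \<Rightarrow> real) \<Rightarrow> (tableau \<Rightarrow> real)" where
  "Psi lam mu v = (\<lambda>T. \<Sum>R\<in>Tab mu. v R * basis_vec (extend_tab lam mu R) T)"

text \<open>The direct sum over \<open>L\<close> has its orthonormal basis indexed by \<open>Sigma L Tab\<close>; the component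
  of \<open>x\<close> at \<open>lam\<close> is \<open>\<lambda>T. x (lam, T)\<close>.\<close>

definition dim_sum :: "nat list set \<Rightarrow> nat" where
  "dim_sum L = (\<Sum>lam\<in>L. dim lam)"

definition young_rep_sum ::
    "nat list set \<Rightarrow> (nat \<Rightarrow> nat) \<Rightarrow> (nat list \<times> tableau \<Rightarrow> real) \<Rightarrow> (nat list \<times> tableau \<Rightarrow> real)"
where
  "young_rep_sum L \<sigma> x =
     (\<lambda>(lam, T). if lam \<in> L then young_rep lam \<sigma> (\<lambda>S. x (lam, S)) T else 0)"

definition Psi_sum ::
    "nat list set \<Rightarrow> nat list \<Rightarrow> (tableau \<Rightarrow> real) \<Rightarrow> (nat list \<times> tableau \<Rightarrow> real)" where
  "Psi_sum L mu v =
     (\<lambda>(lam, T). if lam \<in> L then sqrt (real (dim lam) / real (dim_sum L)) * Psi lam mu v T else 0)"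

definition W_space :: "nat list set \<Rightarrow> nat list \<Rightarrow> (nat list \<times> tableau \<Rightarrow> real) set" where
  "W_space L mu = Psi_sum L mu ` hspace (Tab mu)"

text \<open>The member with index \<open>k\<close> does not depend on the choice of \<open>t k\<close>, because \<open>W_space L mu\<close> is
  invariant under the stabiliser of \<open>n\<close>.\<close>

definition isoclinic_partition :: "nat list \<Rightarrow> bool" where
  "isoclinic_partition mu \<longleftrightarrow>
     partition_of mu (sum_list mu) \<and>
     (let n = sum_list mu + 1 in
       \<exists>L. L \<noteq> {} \<and> L \<subset> up mu \<and>
         (\<forall>t. (\<forall>k\<in>{1..n}. t k permutes {1..n} \<and> t k n = k) \<longrightarrow>
            equi_isoclinic {1..n} (Sigma L Tab) (\<lambda>k. young_rep_sum L (t k) ` W_space L mu)))"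

lemma partition_of_block_partition:
  assumes "a > 0" "b > 0" "c > 0" "e > 0"
  shows "partition_of (replicate a (a + b + c + e) @ replicate b (a + b + c) @ replicate c (a + b) @ replicate e a)
           (a * (a + b + c + e) + b * (a + b + c) + c * (a + b) + e * a)"
proof -
  have rep: "sorted_wrt (\<ge>) (replicate m (x::nat))" for m x
    by (induction m) auto
  have sum: "sum_list (replicate m (x::nat)) = m * x" for m x
    by (simp add: sum_list_replicate)
  show ?thesis
    using assms unfolding partition_of_def sorted_wrt_append
    by (auto simp: rep sum)
qed

end

theory Submission
  imports Defs "HOL-Library.Product_Order"
begin

text \<open>Let \<open>\<mu>\<close> be a partition of \<open>n - 1\<close>. Since \<open>\<Psi>\<^sub>L\<close> intertwines the representations of \<open>S\<^sub>n\<^sub>-\<^sub>1\<close>, and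
  every permutation moving \<open>n\<close> lies in the double coset of \<open>s\<^sub>n\<^sub>-\<^sub>1\<close>, equi-isoclinicity only depends
  on the compression of \<open>\<pi>\<^sub>L(s\<^sub>n\<^sub>-\<^sub>1)\<close> to \<open>W\<^sub>L\<close>. By Young's orthogonal form this operator is diagonal:
  its eigenvalue at a tableau with \<open>n - 1\<close> in a corner of content \<open>z\<close> is
  \<open>f\<^sub>L(z) = \<Sum> d\<^sub>\<lambda> / (d\<^sub>L (c\<^sub>\<lambda> - z))\<close>, summed over \<open>\<lambda> \<in> L\<close>, where \<open>c\<^sub>\<lambda>\<close> is the content of the added
  box. So \<open>L\<close> works iff \<open>|f\<^sub>L|\<close> is constant on the corner contents.

  The Frobenius formula for \<open>d\<^sub>\<lambda>\<close> and partial fractions give Kerov's equations: for the full set of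
  \<open>\<lambda>\<close> the function vanishes at every corner content. Hence \<open>L\<close> may be replaced by its complement.
  For the four-block partition the added contents are \<open>\<plusminus>X, \<plusminus>x, 0\<close> and the corner contents \<open>\<plusminus>Y, \<plusminus>y\<close>,
  where \<open>X > Y > x > y > 0\<close>. Monotonicity of \<open>f\<^sub>L\<close> between its poles and Kerov's equations exclude
  every \<open>L\<close> not containing 0 except \<open>{x, -x}\<close>, for which the condition reads \<open>x\<^sup>2 = y Y\<close>, that is
  \<open>(b + c)\<^sup>2 = c (b + c + e)\<close>.\<close>

section \<open>Coordinate Hilbert spaces\<close>

lemma hspaceD: "x \<in> hspace I \<Longrightarrow> i \<notin> I \<Longrightarrow> x i = 0"
  by (simp add: hspace_def)

lemma hspace_add: "x \<in> hspace I \<Longrightarrow> y \<in> hspace I \<Longrightarrow> (\<lambda>i. x i + y i) \<in> hspace I"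
  and hspace_mult: "x \<in> hspace I \<Longrightarrow> (\<lambda>i. f i * x i) \<in> hspace I"
  by (simp_all add: hspace_def)

lemma hspace_eqI: "x \<in> hspace I \<Longrightarrow> y \<in> hspace I \<Longrightarrow> (\<And>i. i \<in> I \<Longrightarrow> x i = y i) \<Longrightarrow> x = y"
  by (metis ext hspaceD)

lemma basis_vec_in_hspace: "i \<in> I \<Longrightarrow> basis_vec i \<in> hspace I"
  by (auto simp: hspace_def basis_vec_def)

lemma iprod_commute: "iprod I x y = iprod I y x"
  by (simp add: iprod_def mult.commute)

lemma iprod_add_left: "iprod I (\<lambda>i. x i + y i) z = iprod I x z + iprod I y z"
  and iprod_scale_left: "iprod I (\<lambda>i. r * x i) z = r * iprod I x z"
  by (simp_all add: iprod_def distrib_right sum.distrib sum_distrib_left mult.assoc)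

lemma iprod_add_right: "iprod I z (\<lambda>i. x i + y i) = iprod I z x + iprod I z y"
  and iprod_scale_right: "iprod I z (\<lambda>i. r * x i) = r * iprod I z x"
  by (simp_all add: iprod_commute[of I z] iprod_add_left iprod_scale_left)

lemma iprod_self_nonneg: "iprod I x x \<ge> 0"
  unfolding iprod_def by (rule sum_nonneg) simp

lemma iprod_basis_vec_left: "finite I \<Longrightarrow> i \<in> I \<Longrightarrow> iprod I (basis_vec i) x = x i"
  by (simp add: iprod_def basis_vec_def if_distrib[of "\<lambda>t. t * _"] cong: if_cong)

lemma iprod_basis_vec_right: "finite I \<Longrightarrow> i \<in> I \<Longrightarrow> iprod I x (basis_vec i) = x i"
  by (subst iprod_commute) (rule iprod_basis_vec_left)

lemma
  assumes "lin_op I J f"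
  shows lin_op_in_hspace: "\<And>x. x \<in> hspace I \<Longrightarrow> f x \<in> hspace J"
    and lin_op_add: "\<And>x y. x \<in> hspace I \<Longrightarrow> y \<in> hspace I \<Longrightarrow> f (\<lambda>i. x i + y i) = (\<lambda>j. f x j + f y j)"
    and lin_op_scale: "\<And>r x. x \<in> hspace I \<Longrightarrow> f (\<lambda>i. r * x i) = (\<lambda>j. r * f x j)"
  using assms unfolding lin_op_def by blast+

lemma lin_op_comp: "lin_op J K g \<Longrightarrow> lin_op I J f \<Longrightarrow> lin_op I K (g \<circ> f)"
  unfolding lin_op_def by simp

lemma lin_op_eq_sum_basis:
  assumes "finite I" "finite J" "lin_op I J f" "x \<in> hspace I"
  shows "f x j = (\<Sum>i\<in>I. x i * f (basis_vec i) j)"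
proof (cases "j \<in> J")
  case True
  have "f x j = iprod J (f x) (basis_vec j)"
    using assms(2) True by (simp add: iprod_basis_vec_right)
  also have "\<dots> = iprod I x (adj_op I J f (basis_vec j))" by (rule iprod_adj_op[OF assms(1,3,4)])
  also have "\<dots> = (\<Sum>i\<in>I. x i * f (basis_vec i) j)"
    unfolding iprod_def[of I] adj_op_def using assms(2) True by (simp add: iprod_basis_vec_right)
  finally show ?thesis .
next
  case False
  then have "f y j = 0" if "y \<in> hspace I" for y
    using hspaceD[OF lin_op_in_hspace[OF assms(3) that]] by blast
  then show ?thesis using assms(4) basis_vec_in_hspace[of _ I] by simp
qed

lemma lin_op_eqI_basis:
  assumes "finite I" "finite J" "lin_op I J f" "lin_op I J g" "x \<in> hspace I"
    and "\<And>i. i \<in> I \<Longrightarrow> f (basis_vec i) = g (basis_vec i)"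
  shows "f x = g x"
  using lin_op_eq_sum_basis[OF assms(1-3,5)] lin_op_eq_sum_basis[OF assms(1,2,4,5)] assms(6)
  by (simp add: fun_eq_iff)

lemma adj_op_in_hspace: "adj_op I J f y \<in> hspace I"
  by (simp add: adj_op_def hspace_def)

lemma lin_op_adj_op: "lin_op J I (adj_op I J f)"
  unfolding lin_op_def
  by (auto simp: adj_op_in_hspace) (auto simp: adj_op_def iprod_add_right iprod_scale_right)

lemma
  assumes "isometry_op I J f"
  shows isometry_op_lin_op: "lin_op I J f"
    and isometry_op_in_hspace: "\<And>x. x \<in> hspace I \<Longrightarrow> f x \<in> hspace J"
    and isometry_op_iprod: "\<And>x y. x \<in> hspace I \<Longrightarrow> y \<in> hspace I \<Longrightarrow> iprod J (f x) (f y) = iprod I x y"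
  using assms unfolding isometry_op_def lin_op_def by auto

lemma isometry_op_comp: "isometry_op J K g \<Longrightarrow> isometry_op I J f \<Longrightarrow> isometry_op I K (g \<circ> f)"
  unfolding isometry_op_def by (auto simp: lin_op_comp lin_op_in_hspace)

lemma unitary_op_id: "unitary_op I id"
  unfolding unitary_op_def isometry_op_def lin_op_def by auto

lemma unitary_op_comp: "unitary_op I g \<Longrightarrow> unitary_op I f \<Longrightarrow> unitary_op I (g \<circ> f)"
  unfolding unitary_op_def by (metis image_comp isometry_op_comp)

lemma isometry_op_reindex:
  assumes "bij_betw \<beta> I J"
  defines "f \<equiv> \<lambda>x j. if j \<in> J then x (inv_into I \<beta> j) else 0"
  shows "isometry_op I J f" and "f ` hspace I = hspace J"
proof -
  have lin: "lin_op I J f"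
    by (auto simp: lin_op_def f_def hspace_def)
  have "iprod J (f x) (f y) = iprod I x y" for x y
    using sum.reindex_bij_betw[OF bij_betw_inv_into[OF assms(1)], of "\<lambda>i. x i * y i"]
    by (simp add: iprod_def f_def)
  then show iso: "isometry_op I J f" using lin by (simp add: isometry_op_def)
  have "y \<in> f ` hspace I" if "y \<in> hspace J" for y
  proof
    show "y = f (\<lambda>i. if i \<in> I then y (\<beta> i) else 0)"
      using hspaceD[OF that] bij_betw_inv_into[OF assms(1)] bij_betw_inv_into_right[OF assms(1)]
      by (auto simp: f_def fun_eq_iff dest: bij_betwE)
  qed (simp add: hspace_def)
  then show "f ` hspace I = hspace J" using isometry_op_in_hspace[OF iso] by blast
qed

text \<open>Both sides are the squared norm of the orthogonal projection of \<open>w\<close> to the common image.\<close>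

lemma adj_op_norm_le:
  assumes "finite I" "finite I'" and f: "isometry_op I J f" and g: "isometry_op I' J g"
    and image: "f ` hspace I = g ` hspace I'"
  shows "iprod I (adj_op I J f w) (adj_op I J f w) \<le> iprod I' (adj_op I' J g w) (adj_op I' J g w)"
proof -
  define x y where "x = adj_op I J f w" and "y = adj_op I' J g w"
  have x: "x \<in> hspace I" and y: "y \<in> hspace I'" unfolding x_def y_def by (rule adj_op_in_hspace)+
  obtain z where z: "z \<in> hspace I'" "f x = g z" using image x by (metis image_iff)
  have norm_x: "iprod I x x = iprod I' z z"
    using isometry_op_iprod[OF f x x] isometry_op_iprod[OF g z(1) z(1)] z(2) by simp
  have "iprod I x x = iprod J (f x) w"
    using iprod_adj_op[OF assms(1) isometry_op_lin_op[OF f] x, of w] by (simp add: x_def)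
  also have "\<dots> = iprod I' z y"
    using iprod_adj_op[OF assms(2) isometry_op_lin_op[OF g] z(1), of w] by (simp add: y_def z(2))
  finally have "iprod I x x = iprod I' z y" .
  moreover have "0 \<le> iprod I' (\<lambda>i. z i + -1 * y i) (\<lambda>i. z i + -1 * y i)" by (rule iprod_self_nonneg)
  then have "2 * iprod I' z y \<le> iprod I' z z + iprod I' y y"
    unfolding iprod_add_left iprod_add_right iprod_scale_left iprod_scale_right
      iprod_commute[of I' y z]
    by simp
  ultimately show ?thesis using norm_x unfolding x_def y_def by simp
qed

lemma adj_op_norm_eq:
  assumes "finite I" "finite I'" "isometry_op I J f" "isometry_op I' J g"
    and "f ` hspace I = g ` hspace I'"
  shows "iprod I (adj_op I J f w) (adj_op I J f w) = iprod I' (adj_op I' J g w) (adj_op I' J g w)"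
  using adj_op_norm_le[OF assms] adj_op_norm_le[OF assms(2,1,4,3) assms(5)[symmetric]]
  by (rule antisym)

lemma adj_op_comp_scalar_iff_norm:
  assumes "finite I" and A: "lin_op I J A"
  shows "(\<forall>x\<in>hspace I. adj_op I J A (A x) = (\<lambda>i. \<alpha> * x i)) \<longleftrightarrow>
    (\<forall>x\<in>hspace I. iprod J (A x) (A x) = \<alpha> * iprod I x x)"
proof (intro iffI ballI)
  fix x assume "\<forall>x\<in>hspace I. adj_op I J A (A x) = (\<lambda>i. \<alpha> * x i)" and x: "x \<in> hspace I"
  then show "iprod J (A x) (A x) = \<alpha> * iprod I x x"
    using iprod_adj_op[OF assms x, of "A x"] by (simp add: iprod_scale_right)
next
  fix x assume norm: "\<forall>x\<in>hspace I. iprod J (A x) (A x) = \<alpha> * iprod I x x" and x: "x \<in> hspace I"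
  have polarized: "iprod J (A u) (A x) = \<alpha> * iprod I u x" if u: "u \<in> hspace I" for u
  proof -
    have "iprod J (A (\<lambda>i. u i + x i)) (A (\<lambda>i. u i + x i)) =
        \<alpha> * iprod I (\<lambda>i. u i + x i) (\<lambda>i. u i + x i)"
      using norm hspace_add[OF u x] by blast
    then show ?thesis
      using norm u x unfolding lin_op_add[OF A u x] iprod_add_left iprod_add_right
        iprod_commute[of J "A x" "A u"] iprod_commute[of I x u]
      by (simp add: algebra_simps)
  qed
  show "adj_op I J A (A x) = (\<lambda>i. \<alpha> * x i)"
  proof (rule hspace_eqI[OF adj_op_in_hspace hspace_mult[OF x]])
    fix i assume "i \<in> I"
    then show "adj_op I J A (A x) i = \<alpha> * x i"
      using polarized[OF basis_vec_in_hspace] assms(1)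
      by (simp add: adj_op_def iprod_basis_vec_left)
  qed
qed

lemma isoclinic_pair_iff_norm:
  assumes "finite I" and \<Psi>: "isometry_op I J \<Psi>"
  shows "(let A = adj_op I J \<Phi> \<circ> \<Psi> in \<forall>x\<in>hspace I. adj_op I I A (A x) = (\<lambda>i. \<alpha> * x i)) \<longleftrightarrow>
    (\<forall>w\<in>\<Psi> ` hspace I. iprod I (adj_op I J \<Phi> w) (adj_op I J \<Phi> w) = \<alpha> * iprod J w w)"
  unfolding Let_def
    adj_op_comp_scalar_iff_norm[OF assms(1) lin_op_comp[OF lin_op_adj_op isometry_op_lin_op[OF \<Psi>]]]
  by (simp add: isometry_op_iprod[OF \<Psi>])

lemma equi_isoclinic_iff_norm:
  assumes "finite I"
    and \<Theta>: "\<And>k. k \<in> K \<Longrightarrow> isometry_op I J (\<Theta> k)" "\<And>k. k \<in> K \<Longrightarrow> \<Theta> k ` hspace I = W k"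
  shows "equi_isoclinic K J W \<longleftrightarrow>
    (\<exists>\<alpha>. \<forall>k\<in>K. \<forall>l\<in>K. k \<noteq> l \<longrightarrow>
      (\<forall>w\<in>W l. iprod I (adj_op I J (\<Theta> k) w) (adj_op I J (\<Theta> k) w) = \<alpha> * iprod J w w))"
    (is "_ \<longleftrightarrow> (\<exists>\<alpha>. ?norm \<alpha>)")
proof -
  have transfer: "?norm \<alpha> \<longleftrightarrow> (\<forall>k\<in>K. \<forall>l\<in>K. k \<noteq> l \<longrightarrow> (let A = adj_op {..<d} J (\<Phi> k) \<circ> \<Phi> l in
      \<forall>x\<in>hspace {..<d}. adj_op {..<d} {..<d} A (A x) = (\<lambda>i. \<alpha> * x i)))"
    if \<Phi>: "\<forall>k\<in>K. isometry_op {..<d} J (\<Phi> k) \<and> \<Phi> k ` hspace {..<d} = W k" for \<Phi> and d :: nat and \<alpha>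
  proof -
    have "iprod I (adj_op I J (\<Theta> k) w) (adj_op I J (\<Theta> k) w) =
        iprod {..<d} (adj_op {..<d} J (\<Phi> k) w) (adj_op {..<d} J (\<Phi> k) w)" if "k \<in> K" for k w
      using adj_op_norm_eq[of I "{..<d}" J "\<Theta> k" "\<Phi> k" w] assms that \<Phi> by simp
    then show ?thesis using \<Phi> by (simp add: isoclinic_pair_iff_norm)
  qed
  obtain \<beta> where "bij_betw \<beta> {..<card I} I"
    using ex_bij_betw_nat_finite[OF assms(1)] by (auto simp: atLeast0LessThan)
  from isometry_op_reindex[OF this] obtain \<iota> where
    \<iota>: "isometry_op {..<card I} I \<iota>" "\<iota> ` hspace {..<card I} = hspace I" by blast
  have "\<forall>k\<in>K. isometry_op {..<card I} J (\<Theta> k \<circ> \<iota>) \<and> (\<Theta> k \<circ> \<iota>) ` hspace {..<card I} = W k"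
    unfolding image_comp[symmetric] \<iota>(2) using isometry_op_comp[OF \<Theta>(1) \<iota>(1)] \<Theta>(2) by simp
  then have isometries: "\<exists>(d::nat) \<Phi>. \<forall>k\<in>K. isometry_op {..<d} J (\<Phi> k) \<and> \<Phi> k ` hspace {..<d} = W k"
    by (intro exI)
  have "equi_isoclinic K J W \<longleftrightarrow>
      (\<exists>(d::nat) \<Phi> \<alpha>. (\<forall>k\<in>K. isometry_op {..<d} J (\<Phi> k) \<and> \<Phi> k ` hspace {..<d} = W k) \<and> ?norm \<alpha>)"
    unfolding equi_isoclinic_def by (intro ex_cong1 conj_cong[OF refl] transfer[symmetric])
  then show ?thesis using isometries by simp
qed

section \<open>The symmetric group and its Coxeter relations\<close>

definition adj_word :: "nat list \<Rightarrow> nat \<Rightarrow> nat" where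
  "adj_word = foldr adj_transp"

lemma adj_word_Nil: "adj_word [] = id"
  and adj_word_Cons: "adj_word (k # w) = adj_transp k \<circ> adj_word w"
  and adj_word_append: "adj_word (u @ w) = adj_word u \<circ> adj_word w"
  by (simp_all add: adj_word_def fun_eq_iff)

lemmas adj_word_simps = adj_word_Nil adj_word_Cons adj_word_append

lemma adj_transp_permutes: "k \<in> {1..<n} \<Longrightarrow> adj_transp k permutes {1..n}"
  by (intro permutes_swap_id) auto

lemma permutes_upto_Suc_fixing_last:
  assumes "\<sigma> permutes {1..Suc n}" "\<sigma> (Suc n) = Suc n"
  shows "\<sigma> permutes {1..n}"
  using assms unfolding permutes_def by (metis atLeastAtMost_iff le_SucE)

lemma adj_word_permutes: "set w \<subseteq> {1..<n} \<Longrightarrow> adj_word w permutes {1..n}"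
proof (induction w)
  case (Cons k w)
  then show ?case
    unfolding adj_word_Cons by (intro permutes_compose adj_transp_permutes) auto
qed (simp only: adj_word_Nil permutes_id)

lemma adj_word_upt_last: "j \<le> n \<Longrightarrow> adj_word [j..<n] n = j"
  by (induction j rule: inc_induct) (simp_all add: adj_word_simps upt_conv_Cons)

lemma adj_word_fixes_last: "set w \<subseteq> {1..<n - 1} \<Longrightarrow> adj_word w n = n"
  by (induction w) (auto simp: adj_word_simps transpose_def)

lemma adj_word_rev: "adj_word (rev w) (adj_word w x) = x"
  by (induction w arbitrary: x) (auto simp: adj_word_simps)

lemma permutes_imp_adj_word:
  assumes "\<sigma> permutes {1..n}"
  shows "\<exists>w. set w \<subseteq> {1..<n} \<and> adj_word w = \<sigma>"
  using assms
proof (induction n arbitrary: \<sigma>)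
  case 0
  then have "adj_word [] = \<sigma>" by (simp add: adj_word_Nil)
  then show ?case by (intro exI[of _ "[]"]) simp
next
  case (Suc n)
  define u where "u = [\<sigma> (Suc n)..<Suc n]"
  define \<tau> where "\<tau> = adj_word (rev u) \<circ> \<sigma>"
  have image: "\<sigma> (Suc n) \<in> {1..Suc n}"
    using permutes_in_image[OF Suc.prems, of "Suc n"] by simp
  then have u: "set u \<subseteq> {1..<Suc n}" by (auto simp: u_def)
  have "\<tau> permutes {1..Suc n}"
    unfolding \<tau>_def using u by (intro permutes_compose Suc.prems adj_word_permutes) simp
  moreover have "\<tau> (Suc n) = Suc n"
    using adj_word_rev[of u "Suc n"] adj_word_upt_last[of "\<sigma> (Suc n)" "Suc n"] image
    by (simp add: \<tau>_def u_def del: upt_Suc)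
  ultimately obtain w where w: "set w \<subseteq> {1..<n}" "adj_word w = \<tau>"
    using Suc.IH permutes_upto_Suc_fixing_last by blast
  have "adj_word (u @ w) = \<sigma>"
    using adj_word_rev[of "rev u"] w(2) by (simp add: adj_word_append \<tau>_def fun_eq_iff)
  moreover have "set (u @ w) \<subseteq> {1..<Suc n}" using u w(1) by auto
  ultimately show ?case by blast
qed

text \<open>Every word in the generators of \<open>S\<^sub>n\<close> equals \<open>s\<^sub>j \<dots> s\<^sub>n\<^sub>-\<^sub>1\<close> times a word in the generators of
  \<open>S\<^sub>n\<^sub>-\<^sub>1\<close>, where \<open>j\<close> is the image of \<open>n\<close>. The Coxeter relations suffice for this rewriting, so two
  words for the same permutation act equally in every system satisfying these relations.\<close>

primrec coset_split :: "nat \<Rightarrow> nat list \<Rightarrow> nat \<times> nat list" where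
  "coset_split n [] = (n, [])"
| "coset_split n (k # w) = (let (j, v) = coset_split n w in
     if k + 1 < j then (j, k # v)
     else if k + 1 = j then (k, v)
     else if k = j then (k + 1, v)
     else (j, (k - 1) # v))"

lemma coset_split_bounds:
  assumes "set w \<subseteq> {1..<n}" "n \<ge> 1" "coset_split n w = (j, v)"
  shows "j \<in> {1..n}" "set v \<subseteq> {1..<n - 1}"
proof -
  have "j \<in> {1..n} \<and> set v \<subseteq> {1..<n - 1}"
    using assms(1,3)
  proof (induction w arbitrary: j v)
    case (Cons k w)
    obtain i u where iu: "coset_split n w = (i, u)" by (cases "coset_split n w")
    with Cons have i: "i \<in> {1..n}" and u: "set u \<subseteq> {1..<n - 1}" and k: "k \<in> {1..<n}" by auto
    have "k \<in> {1..n}" "k + 1 \<in> {1..n}" using k by auto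
    moreover have "k \<in> {1..<n - 1}" if "k + 1 < i" using that i k by auto
    moreover have "k - 1 \<in> {1..<n - 1}" if "i < k" using that i k by auto
    ultimately show ?case
      using iu i k u Cons.prems(2)
      by (auto simp del: atLeastLessThan_iff atLeastAtMost_iff split: if_splits)
  qed (use assms(2) in auto)
  then show "j \<in> {1..n}" "set v \<subseteq> {1..<n - 1}" by auto
qed

locale coxeter_ops =
  fixes n :: nat and A :: "nat \<Rightarrow> 'a \<Rightarrow> 'a" and X :: "'a set"
  assumes closed: "\<And>k x. k \<in> {1..<n} \<Longrightarrow> x \<in> X \<Longrightarrow> A k x \<in> X"
    and invol: "\<And>k x. k \<in> {1..<n} \<Longrightarrow> x \<in> X \<Longrightarrow> A k (A k x) = x"
    and commute: "\<And>k l x. k \<in> {1..<n} \<Longrightarrow> l \<in> {1..<n} \<Longrightarrow> k + 1 < l \<Longrightarrow> x \<in> X \<Longrightarrow>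
      A k (A l x) = A l (A k x)"
    and braid: "\<And>k x. k \<in> {1..<n} \<Longrightarrow> k + 1 < n \<Longrightarrow> x \<in> X \<Longrightarrow>
      A k (A (k + 1) (A k x)) = A (k + 1) (A k (A (k + 1) x))"
begin

lemma word_closed: "set w \<subseteq> {1..<n} \<Longrightarrow> x \<in> X \<Longrightarrow> foldr A w x \<in> X"
  by (induction w) (auto simp: closed)

lemma commute_word:
  assumes "k \<in> {1..<n}" "set w \<subseteq> {1..<n}" "\<And>l. l \<in> set w \<Longrightarrow> l + 1 < k \<or> k + 1 < l" "x \<in> X"
  shows "A k (foldr A w x) = foldr A w (A k x)"
  using assms(2,3)
proof (induction w)
  case (Cons l w)
  then have l: "l \<in> {1..<n}" "l + 1 < k \<or> k + 1 < l" and "foldr A w x \<in> X"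
    using word_closed[OF _ assms(4), of w] by auto
  then have "A k (A l (foldr A w x)) = A l (A k (foldr A w x))"
    using commute[OF assms(1) l(1)] commute[OF l(1) assms(1)] by metis
  then show ?case using Cons by simp
qed simp

lemma push_through_upt:
  assumes "1 \<le> j" "j < k" "k < m" "m \<le> n" and x: "x \<in> X"
  shows "A k (foldr A [j..<m] x) = foldr A [j..<m] (A (k - 1) x)"
proof -
  define z where "z = foldr A [k + 1..<m] x"
  have z: "z \<in> X" unfolding z_def by (rule word_closed) (use assms in auto)
  have "[j..<m] = [j..<k - 1] @ [k - 1..<m]"
    using upt_add_eq_append[of j "k - 1" "m - (k - 1)"] assms by simp
  also have "[k - 1..<m] = [k - 1, k] @ [k + 1..<m]"
    using upt_conv_Cons[of "k - 1" m] upt_conv_Cons[of k m] assms by simp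
  finally have split: "foldr A [j..<m] y =
      foldr A [j..<k - 1] (A (k - 1) (A k (foldr A [k + 1..<m] y)))" for y
    by simp
  have "A k (foldr A [j..<m] x) = foldr A [j..<k - 1] (A k (A (k - 1) (A k z)))"
    unfolding split z_def[symmetric]
    by (rule commute_word) (use assms z in \<open>auto intro!: closed\<close>)
  also have "A k (A (k - 1) (A k z)) = A (k - 1) (A k (A (k - 1) z))"
    using braid[of "k - 1" z] assms(1-4) z by fastforce
  also have "A (k - 1) z = foldr A [k + 1..<m] (A (k - 1) x)"
    unfolding z_def by (rule commute_word) (use assms in auto)
  finally show ?thesis unfolding split .
qed

lemma foldr_coset_split:
  assumes "set w \<subseteq> {1..<m}" "1 \<le> m" "m \<le> n" "x \<in> X" "coset_split m w = (j, v)"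
  shows "foldr A w x = foldr A [j..<m] (foldr A v x)"
  using assms(1,5)
proof (induction w arbitrary: j v)
  case (Cons k w)
  obtain i u where iu: "coset_split m w = (i, u)" by (cases "coset_split m w")
  have k: "k \<in> {1..<n}" "k < m" using Cons.prems(1) assms(3) by auto
  have i: "i \<in> {1..m}" and u: "set u \<subseteq> {1..<m - 1}"
    using coset_split_bounds[OF _ assms(2) iu] Cons.prems(1) by auto
  have ux: "foldr A u x \<in> X" by (rule word_closed) (use u assms(3,4) in fastforce)+
  have IH: "foldr A (k # w) x = A k (foldr A [i..<m] (foldr A u x))"
    using Cons.IH[OF _ iu] Cons.prems(1) by simp
  consider (less) "k + 1 < i" | (pred) "k + 1 = i" | (same) "k = i" | (greater) "i < k" by linarith
  then show ?case
  proof cases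
    case less
    then have "A k (foldr A [i..<m] (foldr A u x)) = foldr A [i..<m] (A k (foldr A u x))"
      using i assms(3) by (intro commute_word k ux) auto
    then show ?thesis using less Cons.prems(2) unfolding IH by (auto simp: iu)
  next
    case pred
    then show ?thesis using Cons.prems(2) k unfolding IH by (auto simp: iu upt_conv_Cons)
  next
    case same
    have "foldr A [k + 1..<m] (foldr A u x) \<in> X"
      by (rule word_closed) (use assms(3) ux in auto)
    then show ?thesis using same Cons.prems(2) k invol unfolding IH by (auto simp: iu upt_conv_Cons)
  next
    case greater
    then show ?thesis
      using push_through_upt[of i k m "foldr A u x"] Cons.prems(2) k i ux assms(3) unfolding IH
      by (auto simp: iu)
  qed
qed simp

end

interpretation adj_transp: coxeter_ops n adj_transp UNIV for n
  by unfold_locales (auto simp: transpose_def)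

context coxeter_ops
begin

lemma words_eq:
  assumes "m \<le> n" "set w \<subseteq> {1..<m}" "set v \<subseteq> {1..<m}" "adj_word w = adj_word v" "x \<in> X"
  shows "foldr A w x = foldr A v x"
  using assms(1-4)
proof (induction m arbitrary: w v)
  case (Suc m)
  let ?m = "Suc m"
  obtain i w' where w: "coset_split ?m w = (i, w')" by (cases "coset_split ?m w")
  obtain j v' where v: "coset_split ?m v = (j, v')" by (cases "coset_split ?m v")
  have i: "i \<in> {1..?m}" "set w' \<subseteq> {1..<m}" and j: "j \<in> {1..?m}" "set v' \<subseteq> {1..<m}"
    using coset_split_bounds[OF Suc.prems(2) _ w] coset_split_bounds[OF Suc.prems(3) _ v]
    by simp_all
  have split: "adj_word w y = adj_word [i..<?m] (adj_word w' y)"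
    "adj_word v y = adj_word [j..<?m] (adj_word v' y)" for y
    using adj_transp.foldr_coset_split[OF Suc.prems(2) _ order_refl UNIV_I w]
      adj_transp.foldr_coset_split[OF Suc.prems(3) _ order_refl UNIV_I v]
    by (simp_all add: adj_word_def)
  have "i = j"
    using split[of ?m] adj_word_fixes_last[of w' ?m] adj_word_fixes_last[of v' ?m] i j Suc.prems(4)
    by (simp add: adj_word_upt_last del: upt_Suc)
  moreover have "inj (adj_word [i..<?m])"
    by (rule permutes_inj[OF adj_word_permutes[of _ ?m]]) (use i in auto)
  ultimately have "adj_word w' = adj_word v'"
    using split Suc.prems(4) by (metis (no_types, lifting) ext injD)
  then have "foldr A w' x = foldr A v' x" using Suc.IH[of w' v'] Suc.prems(1) i j by simp
  then show ?case
    using foldr_coset_split[OF Suc.prems(2) _ Suc.prems(1) assms(5) w]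
      foldr_coset_split[OF Suc.prems(3) _ Suc.prems(1) assms(5) v] \<open>i = j\<close> by simp
qed simp

definition extend :: "(nat \<Rightarrow> nat) \<Rightarrow> 'a \<Rightarrow> 'a" where
  "extend \<sigma> = foldr A (SOME w. set w \<subseteq> {1..<n} \<and> adj_word w = \<sigma>)"

lemma extend_eq_word:
  assumes "\<sigma> permutes {1..n}"
  obtains w where "set w \<subseteq> {1..<n}" "adj_word w = \<sigma>" "extend \<sigma> = foldr A w"
  using someI_ex[OF permutes_imp_adj_word[OF assms]] unfolding extend_def by blast

lemma extend_adj_word:
  assumes "set w \<subseteq> {1..<n}" "x \<in> X"
  shows "extend (adj_word w) x = foldr A w x"
  by (rule extend_eq_word[OF adj_word_permutes[OF assms(1)]])
    (use words_eq[OF order_refl _ assms(1) _ assms(2)] in auto)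

lemma extend_adj_transp: "k \<in> {1..<n} \<Longrightarrow> x \<in> X \<Longrightarrow> extend (adj_transp k) x = A k x"
  using extend_adj_word[of "[k]" x] by (simp add: adj_word_simps)

lemma extend_comp:
  assumes "\<sigma> permutes {1..n}" "\<tau> permutes {1..n}" "x \<in> X"
  shows "extend (\<sigma> \<circ> \<tau>) x = extend \<sigma> (extend \<tau> x)"
proof -
  obtain w where w: "set w \<subseteq> {1..<n}" "adj_word w = \<sigma>" "extend \<sigma> = foldr A w"
    by (rule extend_eq_word[OF assms(1)])
  obtain v where v: "set v \<subseteq> {1..<n}" "adj_word v = \<tau>" "extend \<tau> = foldr A v"
    by (rule extend_eq_word[OF assms(2)])
  have "adj_word (w @ v) = \<sigma> \<circ> \<tau>" by (simp only: adj_word_append w(2) v(2))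
  then show ?thesis using extend_adj_word[of "w @ v" x] w v assms(3) by simp
qed

end

section \<open>Isometric representations of symmetric groups\<close>

locale isometric_rep =
  fixes n :: nat and I :: "'i set" and \<pi> :: "(nat \<Rightarrow> nat) \<Rightarrow> ('i \<Rightarrow> real) \<Rightarrow> 'i \<Rightarrow> real"
  assumes isometry: "\<And>\<sigma>. \<sigma> permutes {1..n} \<Longrightarrow> isometry_op I I (\<pi> \<sigma>)"
    and comp: "\<And>\<sigma> \<tau> x. \<sigma> permutes {1..n} \<Longrightarrow> \<tau> permutes {1..n} \<Longrightarrow> x \<in> hspace I \<Longrightarrow>
      \<pi> (\<sigma> \<circ> \<tau>) x = \<pi> \<sigma> (\<pi> \<tau> x)"
    and id: "\<And>x. x \<in> hspace I \<Longrightarrow> \<pi> id x = x"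
begin

lemmas linear = isometry[THEN isometry_op_lin_op]
  and in_hspace = isometry[THEN isometry_op_in_hspace]
  and iprod_eq = isometry[THEN isometry_op_iprod]

lemma apply_inv: "\<sigma> permutes {1..n} \<Longrightarrow> x \<in> hspace I \<Longrightarrow> \<pi> \<sigma> (\<pi> (inv \<sigma>) x) = x"
  using comp[of \<sigma> "inv \<sigma>" x] id by (simp add: permutes_inv permutes_inv_o)

lemma iprod_move:
  assumes "\<sigma> permutes {1..n}" "x \<in> hspace I" "y \<in> hspace I"
  shows "iprod I x (\<pi> \<sigma> y) = iprod I (\<pi> (inv \<sigma>) x) y"
  using iprod_eq[OF assms(1) in_hspace[OF permutes_inv[OF assms(1)] assms(2)] assms(3)]
    apply_inv[OF assms(1,2)] by simp

end

lemma intertwine_from_generators: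
  assumes "isometric_rep m I \<pi>" "isometric_rep n J \<rho>" "m \<le> n"
    and \<Psi>: "\<And>v. v \<in> hspace I \<Longrightarrow> \<Psi> v \<in> hspace J"
    and generators: "\<And>k v. k \<in> {1..<m} \<Longrightarrow> v \<in> hspace I \<Longrightarrow>
      \<rho> (adj_transp k) (\<Psi> v) = \<Psi> (\<pi> (adj_transp k) v)"
    and "\<sigma> permutes {1..m}" and v: "v \<in> hspace I"
  shows "\<rho> \<sigma> (\<Psi> v) = \<Psi> (\<pi> \<sigma> v)"
proof -
  interpret \<pi>: isometric_rep m I \<pi> by fact
  interpret \<rho>: isometric_rep n J \<rho> by fact
  obtain w where "set w \<subseteq> {1..<m}" and w: "adj_word w = \<sigma>"
    using permutes_imp_adj_word[OF assms(6)] by blast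
  then have "\<rho> (adj_word w) (\<Psi> v) = \<Psi> (\<pi> (adj_word w) v)"
  proof (induction w arbitrary: \<sigma>)
    case Nil
    show ?case unfolding adj_word_Nil \<pi>.id[OF v] \<rho>.id[OF \<Psi>[OF v]] ..
  next
    case (Cons k w)
    then have k: "k \<in> {1..<m}" "k \<in> {1..<n}" and w: "set w \<subseteq> {1..<m}" "set w \<subseteq> {1..<n}"
      using assms(3) by auto
    show ?case
      by (simp only: adj_word_Cons
        \<pi>.comp[OF adj_transp_permutes[OF k(1)] adj_word_permutes[OF w(1)] v]
        \<rho>.comp[OF adj_transp_permutes[OF k(2)] adj_word_permutes[OF w(2)] \<Psi>[OF v]]
        Cons.IH[OF w(1) refl] generators[OF k(1) \<pi>.in_hspace[OF adj_word_permutes[OF w(1)] v]])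
  qed
  then show ?thesis unfolding w .
qed

lemma double_coset_decomposition:
  assumes \<sigma>: "\<sigma> permutes {1..m + 1}" and moves: "\<sigma> (m + 1) \<noteq> m + 1" and "m \<ge> 1"
  obtains g h where "g permutes {1..m}" "h permutes {1..m}" "\<sigma> = g \<circ> (adj_transp m \<circ> h)"
proof
  define g where "g = Transposition.transpose (\<sigma> (m + 1)) m"
  define h where "h = adj_transp m \<circ> (g \<circ> \<sigma>)"
  have "\<sigma> (m + 1) \<in> {1..m + 1}" using permutes_in_image[OF \<sigma>, of "m + 1"] by simp
  then have image: "\<sigma> (m + 1) \<in> {1..m}" using moves by auto
  show "g permutes {1..m}" unfolding g_def using image by (intro permutes_swap_id) auto
  have "h permutes {1..Suc m}"
    unfolding h_def g_def using image \<sigma> by (intro permutes_compose permutes_swap_id) auto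
  moreover have "h (Suc m) = Suc m" by (simp add: h_def g_def)
  ultimately show "h permutes {1..m}" by (rule permutes_upto_Suc_fixing_last)
  show "\<sigma> = g \<circ> (adj_transp m \<circ> h)" by (simp add: h_def g_def fun_eq_iff)
qed

locale diagonal_compression =
  sub: isometric_rep m I \<pi> + full: isometric_rep "m + 1" J \<rho>
  for m :: nat and I :: "'i set" and \<pi> and J :: "'j set" and \<rho> +
  fixes \<Psi> :: "('i \<Rightarrow> real) \<Rightarrow> 'j \<Rightarrow> real" and f :: "'i \<Rightarrow> real"
  assumes m_pos: "m \<ge> 1" and finite_index: "finite I" and isometry: "isometry_op I J \<Psi>"
    and intertwine: "\<And>\<sigma> v. \<sigma> permutes {1..m} \<Longrightarrow> v \<in> hspace I \<Longrightarrow> \<rho> \<sigma> (\<Psi> v) = \<Psi> (\<pi> \<sigma> v)"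
    and compression: "\<And>u v. u \<in> hspace I \<Longrightarrow> v \<in> hspace I \<Longrightarrow>
      iprod J (\<Psi> u) (\<rho> (adj_transp m) (\<Psi> v)) = iprod I u (\<lambda>i. f i * v i)"
begin

lemmas embed_in_hspace = isometry_op_in_hspace[OF isometry]

lemma permutes_Suc: "\<sigma> permutes {1..m} \<Longrightarrow> \<sigma> permutes {1..m + 1}"
  by (rule permutes_subset) auto

lemma translate_isometry:
  "\<sigma> permutes {1..m + 1} \<Longrightarrow> isometry_op I J (\<rho> \<sigma> \<circ> \<Psi>)"
  by (rule isometry_op_comp[OF full.isometry isometry])

lemma iprod_double_coset:
  assumes g: "g permutes {1..m}" and h: "h permutes {1..m}"
    and u: "u \<in> hspace I" and v: "v \<in> hspace I"
  shows "iprod J (\<Psi> u) (\<rho> (g \<circ> (adj_transp m \<circ> h)) (\<Psi> v)) = iprod I u (\<pi> g (\<lambda>i. f i * \<pi> h v i))"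
proof -
  let ?s = "adj_transp m"
  have s: "?s permutes {1..m + 1}" using m_pos by (intro adj_transp_permutes) auto
  have hv: "\<pi> h v \<in> hspace I" by (rule sub.in_hspace[OF h v])
  have gu: "\<pi> (inv g) u \<in> hspace I" by (rule sub.in_hspace[OF permutes_inv[OF g] u])
  have "\<rho> (g \<circ> (?s \<circ> h)) (\<Psi> v) = \<rho> g (\<rho> ?s (\<Psi> (\<pi> h v)))"
    using full.comp[OF permutes_Suc[OF g] permutes_compose[OF permutes_Suc[OF h] s]
        embed_in_hspace[OF v]]
      full.comp[OF s permutes_Suc[OF h] embed_in_hspace[OF v]] intertwine[OF h v] by simp
  then have "iprod J (\<Psi> u) (\<rho> (g \<circ> (?s \<circ> h)) (\<Psi> v)) =
      iprod J (\<rho> (inv g) (\<Psi> u)) (\<rho> ?s (\<Psi> (\<pi> h v)))"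
    using full.iprod_move[OF permutes_Suc[OF g] embed_in_hspace[OF u]
        full.in_hspace[OF s embed_in_hspace[OF hv]]] by simp
  also have "\<dots> = iprod I (\<pi> (inv g) u) (\<lambda>i. f i * \<pi> h v i)"
    unfolding intertwine[OF permutes_inv[OF g] u] by (rule compression[OF gu hv])
  also have "\<dots> = iprod I u (\<pi> g (\<lambda>i. f i * \<pi> h v i))"
    by (rule sub.iprod_move[OF g u hspace_mult[OF hv], symmetric])
  finally show ?thesis .
qed

lemma projection_norm:
  assumes \<sigma>: "\<sigma> permutes {1..m + 1}" and \<tau>: "\<tau> permutes {1..m + 1}" and "\<sigma> (m + 1) \<noteq> \<tau> (m + 1)"
  obtains h where "h permutes {1..m}"
    and "\<And>v. v \<in> hspace I \<Longrightarrow>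
      iprod I (adj_op I J (\<rho> \<sigma> \<circ> \<Psi>) (\<rho> \<tau> (\<Psi> v))) (adj_op I J (\<rho> \<sigma> \<circ> \<Psi>) (\<rho> \<tau> (\<Psi> v))) =
      iprod I (\<lambda>i. f i * \<pi> h v i) (\<lambda>i. f i * \<pi> h v i)"
proof -
  have "inv \<sigma> \<circ> \<tau> permutes {1..m + 1}" by (intro permutes_compose \<tau> permutes_inv \<sigma>)
  moreover have "(inv \<sigma> \<circ> \<tau>) (m + 1) \<noteq> m + 1" using assms(3) permutes_inv_eq[OF \<sigma>] by auto
  ultimately obtain g h where gh: "g permutes {1..m}" "h permutes {1..m}"
    and coset: "inv \<sigma> \<circ> \<tau> = g \<circ> (adj_transp m \<circ> h)"
    using double_coset_decomposition[OF _ _ m_pos] by metis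
  have projection: "adj_op I J (\<rho> \<sigma> \<circ> \<Psi>) (\<rho> \<tau> (\<Psi> v)) = \<pi> g (\<lambda>i. f i * \<pi> h v i)"
    if v: "v \<in> hspace I" for v
  proof (rule hspace_eqI[OF adj_op_in_hspace
        sub.in_hspace[OF gh(1) hspace_mult[OF sub.in_hspace[OF gh(2) v]]]])
    fix i assume i: "i \<in> I"
    note e = basis_vec_in_hspace[OF i]
    have "adj_op I J (\<rho> \<sigma> \<circ> \<Psi>) (\<rho> \<tau> (\<Psi> v)) i = iprod J (\<rho> \<tau> (\<Psi> v)) (\<rho> \<sigma> (\<Psi> (basis_vec i)))"
      using i by (simp add: adj_op_def iprod_commute)
    also have "\<dots> = iprod J (\<Psi> (basis_vec i)) (\<rho> (inv \<sigma>) (\<rho> \<tau> (\<Psi> v)))"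
      unfolding full.iprod_move[OF \<sigma> full.in_hspace[OF \<tau> embed_in_hspace[OF v]]
          embed_in_hspace[OF e]]
      by (rule iprod_commute)
    also have "\<dots> = iprod I (basis_vec i) (\<pi> g (\<lambda>i. f i * \<pi> h v i))"
      using full.comp[OF permutes_inv[OF \<sigma>] \<tau> embed_in_hspace[OF v]]
        iprod_double_coset[OF gh e v] coset
      by simp
    finally show "adj_op I J (\<rho> \<sigma> \<circ> \<Psi>) (\<rho> \<tau> (\<Psi> v)) i = \<pi> g (\<lambda>i. f i * \<pi> h v i) i"
      by (simp add: iprod_basis_vec_left finite_index i)
  qed
  show ?thesis
    by (rule that[OF gh(2)])
      (simp add: projection sub.iprod_eq[OF gh(1)] hspace_mult sub.in_hspace[OF gh(2)]
        del: comp_apply)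
qed

lemma norm_scaled_iff:
  assumes h: "h permutes {1..m}"
  shows "(\<forall>v\<in>hspace I. iprod I (\<lambda>i. f i * \<pi> h v i) (\<lambda>i. f i * \<pi> h v i) = \<alpha> * iprod I v v) \<longleftrightarrow>
    (\<forall>i\<in>I. (f i)\<^sup>2 = \<alpha>)"
proof (intro iffI ballI)
  fix i assume norm: "\<forall>v\<in>hspace I. iprod I (\<lambda>i. f i * \<pi> h v i) (\<lambda>i. f i * \<pi> h v i) =
      \<alpha> * iprod I v v"
    and i: "i \<in> I"
  define v where "v = \<pi> (inv h) (basis_vec i)"
  note e = basis_vec_in_hspace[OF i]
  have v: "v \<in> hspace I" "\<pi> h v = basis_vec i"
    unfolding v_def by (rule sub.in_hspace[OF permutes_inv[OF h] e], rule sub.apply_inv[OF h e])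
  have "iprod I v v = 1"
    using sub.iprod_eq[OF h v(1) v(1)] unfolding v(2) iprod_basis_vec_left[OF finite_index i]
    by (simp add: basis_vec_def)
  then have "\<alpha> = iprod I (\<lambda>j. f j * basis_vec i j) (\<lambda>j. f j * basis_vec i j)"
    using bspec[OF norm v(1)] v(2) by simp
  also have "\<dots> = iprod I (basis_vec i) (\<lambda>j. f j * (f j * basis_vec i j))"
    by (simp add: iprod_def mult_ac)
  also have "\<dots> = (f i)\<^sup>2"
    unfolding iprod_basis_vec_left[OF finite_index i] by (simp add: basis_vec_def power2_eq_square)
  finally show "(f i)\<^sup>2 = \<alpha>" by simp
next
  fix v assume \<alpha>: "\<forall>i\<in>I. (f i)\<^sup>2 = \<alpha>" and v: "v \<in> hspace I"
  have "iprod I (\<lambda>i. f i * \<pi> h v i) (\<lambda>i. f i * \<pi> h v i) = \<alpha> * iprod I (\<pi> h v) (\<pi> h v)"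
    unfolding iprod_def sum_distrib_left using \<alpha>
    by (intro sum.cong) (auto simp: power2_eq_square)
  then show "iprod I (\<lambda>i. f i * \<pi> h v i) (\<lambda>i. f i * \<pi> h v i) = \<alpha> * iprod I v v"
    by (simp only: sub.iprod_eq[OF h v v])
qed

theorem equi_isoclinic_translates_iff:
  assumes t: "\<forall>k\<in>{1..m + 1}. t k permutes {1..m + 1} \<and> t k (m + 1) = k"
  shows "equi_isoclinic {1..m + 1} J (\<lambda>k. \<rho> (t k) ` \<Psi> ` hspace I) \<longleftrightarrow> (\<exists>\<alpha>. \<forall>i\<in>I. (f i)\<^sup>2 = \<alpha>)"
proof -
  let ?K = "{1..m + 1}"
  let ?norm = "\<lambda>k w. iprod I (adj_op I J (\<rho> (t k) \<circ> \<Psi>) w) (adj_op I J (\<rho> (t k) \<circ> \<Psi>) w)"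
  have isometry_t: "isometry_op I J (\<rho> (t k) \<circ> \<Psi>)" if "k \<in> ?K" for k
    using t that by (intro translate_isometry) blast
  have norm_iff: "(\<forall>w\<in>\<rho> (t l) ` \<Psi> ` hspace I. ?norm k w = \<alpha> * iprod J w w) \<longleftrightarrow> (\<forall>i\<in>I. (f i)\<^sup>2 = \<alpha>)"
    if kl: "k \<in> ?K" "l \<in> ?K" "k \<noteq> l" for k l \<alpha>
  proof -
    obtain h where h: "h permutes {1..m}" and norm_h: "\<And>v. v \<in> hspace I \<Longrightarrow>
        ?norm k (\<rho> (t l) (\<Psi> v)) = iprod I (\<lambda>i. f i * \<pi> h v i) (\<lambda>i. f i * \<pi> h v i)"
      by (rule projection_norm[of "t k" "t l"]) (use t kl in auto)
    have "iprod J (\<rho> (t l) (\<Psi> v)) (\<rho> (t l) (\<Psi> v)) = iprod I v v" if "v \<in> hspace I" for v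
      using isometry_op_iprod[OF isometry_t[OF kl(2)] that that] by simp
    then show ?thesis
      unfolding norm_scaled_iff[OF h, symmetric] by (simp add: norm_h)
  qed
  have "equi_isoclinic ?K J (\<lambda>k. \<rho> (t k) ` \<Psi> ` hspace I) \<longleftrightarrow> (\<exists>\<alpha>. \<forall>k\<in>?K. \<forall>l\<in>?K. k \<noteq> l \<longrightarrow>
      (\<forall>w\<in>\<rho> (t l) ` \<Psi> ` hspace I. ?norm k w = \<alpha> * iprod J w w))"
    by (rule equi_isoclinic_iff_norm[OF finite_index isometry_t]) (simp_all add: image_comp)
  also have "\<dots> \<longleftrightarrow> (\<exists>\<alpha>. \<forall>k\<in>?K. \<forall>l\<in>?K. k \<noteq> l \<longrightarrow> (\<forall>i\<in>I. (f i)\<^sup>2 = \<alpha>))"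
    by (intro ex_cong1 ball_cong imp_cong refl norm_iff)
  also have "\<dots> \<longleftrightarrow> (\<exists>\<alpha>. \<forall>i\<in>I. (f i)\<^sup>2 = \<alpha>)"
  proof -
    have "1 \<in> ?K" "m + 1 \<in> ?K" "1 \<noteq> m + 1" using m_pos by auto
    then show ?thesis by blast
  qed
  finally show ?thesis .
qed

end

section \<open>Young diagrams and standard tableaux\<close>

definition young_shape :: "(nat \<times> nat) set \<Rightarrow> bool" where
  "young_shape S \<longleftrightarrow> finite S \<and> (\<forall>q\<in>S. \<forall>p\<le>q. p \<in> S)"

definition Syt :: "(nat \<times> nat) set \<Rightarrow> tableau set" where
  "Syt S = {T. bij_betw T S {1..card S} \<and> strict_mono_on S T \<and> (\<forall>p. p \<notin> S \<longrightarrow> T p = 0)}"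

definition corners :: "(nat \<times> nat) set \<Rightarrow> (nat \<times> nat) set" where
  "corners S = {p \<in> S. young_shape (S - {p})}"

lemma
  assumes "young_shape S"
  shows young_shape_finite: "finite S"
    and young_shape_down_closed: "\<And>p q. q \<in> S \<Longrightarrow> p \<le> q \<Longrightarrow> p \<in> S"
  using assms unfolding young_shape_def by blast+

lemma
  assumes "T \<in> Syt S"
  shows Syt_bij: "bij_betw T S {1..card S}"
    and Syt_mono: "\<And>p q. p \<in> S \<Longrightarrow> q \<in> S \<Longrightarrow> p < q \<Longrightarrow> T p < T q"
    and Syt_outside: "\<And>p. p \<notin> S \<Longrightarrow> T p = 0"
  using assms unfolding Syt_def monotone_on_def by blast+

lemma Syt_le_card:
  assumes "T \<in> Syt S"
  shows "T p \<le> card S"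
  using bij_betwE[OF Syt_bij[OF assms]] Syt_outside[OF assms, of p] by (cases "p \<in> S") auto

lemma finite_tableaux: "finite S \<Longrightarrow>
  finite {T :: tableau. bij_betw T S {1..n} \<and> (\<forall>p. p \<notin> S \<longrightarrow> T p = 0)}"
  by (rule finite_subset[OF _ finite_set_of_finite_funs[of S "{1..n}" 0]]) (auto dest: bij_betwE)

lemma finite_Syt: "finite S \<Longrightarrow> finite (Syt S)"
  by (rule finite_subset[OF _ finite_tableaux[of S "card S"]]) (auto simp: Syt_def)

lemma Syt_insertI:
  assumes R: "R \<in> Syt S" and p: "p \<notin> S" and S: "young_shape S"
  shows "R(p := Suc (card S)) \<in> Syt (insert p S)"
proof -
  let ?T = "R(p := Suc (card S))"
  have "bij_betw ?T S {1..card S}"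
    using Syt_bij[OF R] p by (subst bij_betw_cong[of S _ R]) auto
  then have "bij_betw ?T (S \<union> {p}) ({1..card S} \<union> {Suc (card S)})"
    by (rule bij_betw_combine) (auto simp: bij_betw_def)
  then have "bij_betw ?T (insert p S) {1..card (insert p S)}"
    using p young_shape_finite[OF S] by (simp add: atLeastAtMostSuc_conv)
  moreover have "strict_mono_on (insert p S) ?T"
  proof (rule monotone_onI)
    fix q q' assume q: "q \<in> insert p S" "q' \<in> insert p S" "q < q'"
    show "?T q < ?T q'"
    proof (cases "q' = p")
      case True
      then show ?thesis using q(3) Syt_le_card[OF R, of q] by (auto simp: less_Suc_eq_le)
    next
      case False
      then have "q' \<in> S" using q(2) by simp
      moreover from this have "q \<in> S"
        using young_shape_down_closed[OF S] q(3) by (meson less_imp_le)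
      ultimately show ?thesis using False p Syt_mono[OF R _ _ q(3)] by auto
    qed
  qed
  ultimately show ?thesis using Syt_outside[OF R] by (auto simp: Syt_def)
qed

lemma Syt_removeI:
  assumes T: "T \<in> Syt (insert p S)" "T p = Suc (card S)" and p: "p \<notin> S" and "finite S"
  shows "T(p := 0) \<in> Syt S"
proof -
  have "bij_betw T (insert p S) {1..Suc (card S)}" using Syt_bij[OF T(1)] p assms(4) by simp
  then have "bij_betw T (insert p S - {p}) ({1..Suc (card S)} - {T p})"
    by (rule bij_betw_DiffI) (auto simp: T(2))
  moreover have "insert p S - {p} = S" "{1..Suc (card S)} - {T p} = {1..card S}"
    using p T(2) by auto
  ultimately have "bij_betw (T(p := 0)) S {1..card S}"
    using p by (subst bij_betw_cong[of S _ T]) auto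
  moreover have "strict_mono_on S (T(p := 0))"
    using Syt_mono[OF T(1)] p by (auto intro!: monotone_onI)
  ultimately show ?thesis using Syt_outside[OF T(1)] by (auto simp: Syt_def)
qed

lemma bij_betw_Syt_insert:
  assumes p: "p \<notin> S" and S: "young_shape S"
  shows "bij_betw (\<lambda>R. R(p := Suc (card S))) (Syt S) {T \<in> Syt (insert p S). T p = Suc (card S)}"
proof (rule bij_betw_byWitness[of _ "\<lambda>T. T(p := 0)"])
  show "\<forall>R\<in>Syt S. (R(p := Suc (card S)))(p := 0) = R"
    using Syt_outside[OF _ p] by (auto intro: fun_upd_idem)
qed (use Syt_insertI[OF _ p S] Syt_removeI[OF _ _ p young_shape_finite[OF S]] in auto)

lemma max_entry_at_corner:
  assumes T: "T \<in> Syt S" and S: "young_shape S" and p: "p \<in> S" "T p = card S"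
  shows "p \<in> corners S"
proof -
  have "r \<in> S - {p}" if q: "q \<in> S - {p}" "r \<le> q" for q r
  proof -
    have "r \<noteq> p" using Syt_mono[OF T p(1), of q] Syt_le_card[OF T, of q] q p(2) by force
    then show ?thesis using young_shape_down_closed[OF S] q by blast
  qed
  then show ?thesis
    using p(1) young_shape_finite[OF S] unfolding corners_def young_shape_def by blast
qed

lemma card_Syt_branch:
  assumes S: "young_shape S" and "S \<noteq> {}"
  shows "card (Syt S) = (\<Sum>p\<in>corners S. card (Syt (S - {p})))"
proof -
  note finite = young_shape_finite[OF S]
  define Max_at where "Max_at p = {T \<in> Syt S. T p = card S}" for p
  have "card S \<in> {1..card S}" using assms(2) finite by (simp add: Suc_le_eq card_gt_0_iff)
  then have "\<exists>p\<in>S. T p = card S" if "T \<in> Syt S" for T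
    using Syt_bij[OF that] unfolding bij_betw_def by (metis imageE)
  then have cover: "Syt S = (\<Union>p\<in>corners S. Max_at p)"
    using max_entry_at_corner[OF _ S] unfolding Max_at_def by blast
  have disjoint: "Max_at p \<inter> Max_at q = {}" if "p \<in> corners S" "q \<in> corners S" "p \<noteq> q" for p q
    using that Syt_bij unfolding Max_at_def corners_def bij_betw_def inj_on_def by fastforce
  have "card (Max_at p) = card (Syt (S - {p}))" if p: "p \<in> corners S" for p
  proof -
    have "p \<in> S" and shape: "young_shape (S - {p})" using p by (auto simp: corners_def)
    then have "insert p (S - {p}) = S" "Suc (card (S - {p})) = card S"
      using card_Suc_Diff1[OF finite] by auto
    then show ?thesis
      using bij_betw_same_card[OF bij_betw_Syt_insert[OF _ shape, of p]] by (simp add: Max_at_def)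
  qed
  moreover have "card (\<Union>p\<in>corners S. Max_at p) = (\<Sum>p\<in>corners S. card (Max_at p))"
    by (rule card_UN_disjoint)
      (use finite finite_Syt[OF finite] disjoint in \<open>auto simp: corners_def Max_at_def\<close>)
  ultimately show ?thesis using cover by simp
qed

lemma corners_nonempty:
  assumes S: "young_shape S" and "S \<noteq> {}"
  shows "corners S \<noteq> {}"
proof -
  obtain p where p: "p \<in> S" and maximal: "\<And>q. q \<in> S \<Longrightarrow> p \<le> q \<Longrightarrow> p = q"
    using finite_has_maximal[OF young_shape_finite[OF S] assms(2)] by blast
  have "r \<in> S - {p}" if "q \<in> S - {p}" "r \<le> q" for q r
    using young_shape_down_closed[OF S, of q r] maximal[of q] that by auto
  then show ?thesis
    using p young_shape_finite[OF S] unfolding corners_def young_shape_def by blast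
qed

lemma card_Syt_pos: "young_shape S \<Longrightarrow> card (Syt S) > 0"
proof (induction "card S" arbitrary: S)
  case 0
  then have "S = {}" using young_shape_finite by simp
  then have "(\<lambda>_. 0) \<in> Syt S" by (auto simp: Syt_def bij_betw_def monotone_on_def)
  then show ?case using finite_Syt[OF young_shape_finite[OF 0(2)]] by (auto simp: card_gt_0_iff)
next
  case (Suc n)
  note finite = young_shape_finite[OF Suc.prems]
  have "S \<noteq> {}" using Suc.hyps(2) by auto
  moreover have "card (Syt (S - {p})) > 0" if "p \<in> corners S" for p
    using that Suc.hyps finite by (auto simp: corners_def)
  moreover have "finite (corners S)" using finite by (simp add: corners_def)
  ultimately show ?case
    unfolding card_Syt_branch[OF Suc.prems \<open>S \<noteq> {}\<close>]
    by (intro sum_pos corners_nonempty Suc.prems) auto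
qed

lemma max_entry_boxes_eq_corners:
  assumes S: "young_shape S"
  shows "{p \<in> S. \<exists>T\<in>Syt S. T p = card S} = corners S"
proof (intro subset_antisym subsetI)
  fix p assume p: "p \<in> corners S"
  then have shape: "young_shape (S - {p})" and "insert p S = S" by (auto simp: corners_def)
  have "Suc (card (S - {p})) = card S"
    using p by (intro card_Suc_Diff1 young_shape_finite[OF S]) (simp add: corners_def)
  moreover obtain R where "R \<in> Syt (S - {p})"
    using card_Syt_pos[OF shape] by (metis card.empty ex_in_conv less_irrefl)
  ultimately have "R(p := card S) \<in> Syt S"
    using Syt_insertI[OF _ _ shape, of R p] \<open>insert p S = S\<close> by simp
  moreover have "(R(p := card S)) p = card S" "p \<in> S" using p by (simp_all add: corners_def)
  ultimately show "p \<in> {p \<in> S. \<exists>T\<in>Syt S. T p = card S}" by blast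
qed (use max_entry_at_corner[OF _ S] in blast)

lemma Syt_diagonal_gap:
  assumes T: "T \<in> Syt S" and S: "young_shape S" and "(i', j') \<in> S" "i < i'" "j < j'"
  shows "T (i, j) + 3 \<le> T (i', j')"
proof -
  have boxes: "(i, j) \<in> S" "(i, j') \<in> S" "(i', j) \<in> S"
    by (rule young_shape_down_closed[OF S assms(3)]; use assms in simp)+
  have "T (i, j) < T (i, j')" "T (i, j) < T (i', j)"
    "T (i, j') < T (i', j')" "T (i', j) < T (i', j')"
    by (rule Syt_mono[OF T]; use boxes assms in \<open>simp add: less_prod_def\<close>)+
  moreover have "T (i, j') \<noteq> T (i', j)"
    using Syt_bij[OF T] boxes assms(4) unfolding bij_betw_def inj_on_def by blast
  ultimately show ?thesis by linarith
qed

lemma nat_pair_cover: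
  fixes i j i' j' :: nat
  assumes "(i, j) < (i', j')" and no_between: "\<And>r. (i, j) < r \<Longrightarrow> \<not> r < (i', j')"
  shows "i' = i \<and> j' = j + 1 \<or> i' = i + 1 \<and> j' = j"
proof (cases "i < i'")
  case True
  then show ?thesis using no_between[of "(i + 1, j)"] assms(1) by (auto simp: less_prod_def)
next
  case False
  then show ?thesis using no_between[of "(i, j + 1)"] assms(1) by (auto simp: less_prod_def)
qed

lemma adj_transp_less: "x < y \<Longrightarrow> \<not> adj_transp k x < adj_transp k y \<Longrightarrow> x = k \<and> y = k + 1"
  by (auto simp: transpose_def split: if_splits)

lemma adj_transp_bij_betw: "bij_betw T S {1..n} \<Longrightarrow> k \<in> {1..<n} \<Longrightarrow>
  bij_betw (adj_transp k \<circ> T) S {1..n}"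
  by (rule bij_betw_trans) (auto intro: permutes_imp_bij adj_transp_permutes)

lemma swap_not_standard_cover:
  assumes T: "T \<in> Syt S" and S: "young_shape S" and k: "k \<in> {1..<card S}"
    and "adj_transp k \<circ> T \<notin> Syt S"
  obtains i j i' j' where "(i, j) \<in> S" "(i', j') \<in> S" "T (i, j) = k" "T (i', j') = k + 1"
    "i' = i \<and> j' = j + 1 \<or> i' = i + 1 \<and> j' = j"
proof -
  have "bij_betw (adj_transp k \<circ> T) S {1..card S}"
    by (rule adj_transp_bij_betw[OF Syt_bij[OF T] k])
  moreover have "(adj_transp k \<circ> T) p = 0" if "p \<notin> S" for p
    using Syt_outside[OF T that] k by (simp add: transpose_def)
  ultimately have "\<not> strict_mono_on S (adj_transp k \<circ> T)"
    using assms(4) by (simp add: Syt_def)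
  then obtain p q where pq: "p \<in> S" "q \<in> S" "p < q"
    and swapped: "\<not> adj_transp k (T p) < adj_transp k (T q)"
    unfolding monotone_on_def comp_apply by blast
  have entries: "T p = k" "T q = k + 1"
    using adj_transp_less[OF Syt_mono[OF T pq] swapped] by simp_all
  have no_between: "\<not> r < q" if "p < r" for r
  proof
    assume "r < q"
    then have "r \<in> S" using young_shape_down_closed[OF S pq(2)] by (meson less_imp_le)
    then show False using Syt_mono[OF T pq(1) _ that] Syt_mono[OF T _ pq(2) \<open>r < q\<close>] entries by simp
  qed
  obtain i j i' j' where "p = (i, j)" "q = (i', j')" by (metis surj_pair)
  then show ?thesis
    using that[of i j i' j'] nat_pair_cover[of i j i' j'] pq entries no_between by blast
qed

lemma boxes_Sigma: "boxes lam = Sigma {..<length lam} (\<lambda>i. {..<lam ! i})"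
  by (auto simp: boxes_def)

lemma finite_boxes: "finite (boxes lam)"
  by (simp add: boxes_Sigma)

lemma card_boxes: "card (boxes lam) = sum_list lam"
  unfolding boxes_Sigma by (subst card_SigmaI) (auto simp: sum_list_sum_nth atLeast0LessThan)

lemma finite_Tab: "finite (Tab lam)"
  by (rule finite_subset[OF _ finite_tableaux[OF finite_boxes[of lam], of "sum_list lam"]])
    (auto simp: Tab_def)

lemma Tab_bij: "T \<in> Tab lam \<Longrightarrow> bij_betw T (boxes lam) {1..sum_list lam}"
  by (simp add: Tab_def)

lemma content_at_box:
  assumes "bij_betw T (boxes lam) {1..sum_list lam}" "(i, j) \<in> boxes lam"
  shows "content_at lam T (T (i, j)) = int j - int i"
  using assms unfolding content_at_def bij_betw_def by (simp add: inv_into_f_f)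

lemma tableau_obtain_box:
  assumes "bij_betw T (boxes lam) {1..sum_list lam}" "m \<in> {1..sum_list lam}"
  obtains i j where "(i, j) \<in> boxes lam" "T (i, j) = m"
  using assms unfolding bij_betw_def by (metis imageE surj_pair)

lemma content_at_swap:
  assumes T: "bij_betw T (boxes lam) {1..sum_list lam}"
    and k: "k \<in> {1..<sum_list lam}" and m: "m \<in> {1..sum_list lam}"
  shows "content_at lam (adj_transp k \<circ> T) m = content_at lam T (adj_transp k m)"
proof -
  have "adj_transp k m \<in> {1..sum_list lam}"
    using permutes_in_image[OF adj_transp_permutes[OF k]] m by blast
  then obtain i j where "(i, j) \<in> boxes lam" "T (i, j) = adj_transp k m"
    by (rule tableau_obtain_box[OF T])
  moreover from this have "(adj_transp k \<circ> T) (i, j) = m" by simp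
  ultimately show ?thesis
    using content_at_box[OF T] content_at_box[OF adj_transp_bij_betw[OF T k]] by metis
qed

locale integer_partition =
  fixes lam :: "nat list"
  assumes partition: "partition_of lam (sum_list lam)"
begin

lemma shape: "young_shape (boxes lam)"
  unfolding young_shape_def
proof (intro conjI ballI allI impI finite_boxes)
  fix p q assume "q \<in> boxes lam" "p \<le> q"
  moreover obtain i j i' j' where "p = (i, j)" "q = (i', j')" by (metis surj_pair)
  ultimately have box: "(i', j') \<in> boxes lam" "i \<le> i'" "j \<le> j'" and p: "p = (i, j)" by auto
  then have "lam ! i' \<le> lam ! i"
    using partition sorted_wrt_nth_less[of "(\<ge>)" lam i i']
    by (cases "i = i'") (auto simp: partition_of_def boxes_def)
  then show "p \<in> boxes lam" using box p by (auto simp: boxes_def)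
qed

lemma Tab_eq_Syt: "Tab lam = Syt (boxes lam)"
proof (intro set_eqI iffI)
  fix T assume T: "T \<in> Tab lam"
  have rows: "T (i, j) < T (i, j')" if "j < j'" "(i, j') \<in> boxes lam" for i j j'
    using T that by (auto simp: Tab_def)
  have columns: "T (i, j) < T (i', j)" if "i < i'" "(i', j) \<in> boxes lam" for i i' j
    using T that by (auto simp: Tab_def)
  have "T (i, j) < T (i', j')" if less: "(i, j) < (i', j')" and box: "(i', j') \<in> boxes lam"
    for i j i' j'
  proof (cases "i < i'")
    case True
    then have "T (i, j') < T (i', j')" using columns box by blast
    moreover have "(i, j') \<in> boxes lam" using young_shape_down_closed[OF shape box] True by simp
    then have "T (i, j) \<le> T (i, j')"
      using rows[of j j' i] less by (cases "j = j'") (auto simp: less_prod_def)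
    ultimately show ?thesis by simp
  next
    case False
    then have "i = i'" "j < j'" using less by (auto simp: less_prod_def)
    then show ?thesis using rows box by simp
  qed
  then show "T \<in> Syt (boxes lam)"
    using T by (auto simp: Tab_def Syt_def card_boxes intro!: monotone_onI)
next
  fix T assume T: "T \<in> Syt (boxes lam)"
  have "T (i, j) < T (i, j')" if "j < j'" "(i, j') \<in> boxes lam" for i j j'
    using Syt_mono[OF T young_shape_down_closed[OF shape that(2)] that(2)] that(1)
    by (simp add: less_prod_def)
  moreover have "T (i, j) < T (i', j)" if "i < i'" "(i', j) \<in> boxes lam" for i i' j
    using Syt_mono[OF T young_shape_down_closed[OF shape that(2)] that(2)] that(1)
    by (simp add: less_prod_def)
  ultimately show "T \<in> Tab lam"
    using T by (auto simp: Tab_def Syt_def card_boxes)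
qed

lemma content_at_eq_gap:
  assumes T: "T \<in> Tab lam" and kl: "1 \<le> k" "k < l" "l \<le> sum_list lam"
    and eq: "content_at lam T k = content_at lam T l"
  shows "k + 3 \<le> l"
proof -
  note bij = Tab_bij[OF T]
  obtain i j where ij: "(i, j) \<in> boxes lam" "T (i, j) = k"
    by (rule tableau_obtain_box[OF bij, of k]) (use kl in auto)
  obtain i' j' where ij': "(i', j') \<in> boxes lam" "T (i', j') = l"
    by (rule tableau_obtain_box[OF bij, of l]) (use kl in auto)
  have contents: "int j - int i = int j' - int i'"
    using eq content_at_box[OF bij] ij ij' by metis
  note gap = Syt_diagonal_gap[OF T[unfolded Tab_eq_Syt] shape]
  have "i \<noteq> i'" using contents ij ij' kl by auto
  then consider (below) "i < i'" | (above) "i' < i" by linarith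
  then show ?thesis
  proof cases
    case below
    then show ?thesis using gap[OF ij'(1), of i j] contents ij ij' by simp
  next
    case above
    then show ?thesis using gap[OF ij(1), of i' j'] contents ij ij' kl by simp
  qed
qed

lemma axial_dist_swap_not_standard:
  assumes T: "T \<in> Tab lam" and "k \<in> {1..<sum_list lam}" and "adj_transp k \<circ> T \<notin> Tab lam"
  shows "\<bar>axial_dist lam T (k + 1) k\<bar> = 1"
proof -
  obtain i j i' j' where "(i, j) \<in> boxes lam" "(i', j') \<in> boxes lam"
    "T (i, j) = k" "T (i', j') = k + 1"
    and "i' = i \<and> j' = j + 1 \<or> i' = i + 1 \<and> j' = j"
    using swap_not_standard_cover[OF T[unfolded Tab_eq_Syt] shape] assms(2,3)
    unfolding Tab_eq_Syt card_boxes by blast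
  then show ?thesis
    using content_at_box[OF Tab_bij[OF T], of i j] content_at_box[OF Tab_bij[OF T], of i' j']
    by (auto simp: axial_dist_def)
qed

end

section \<open>Young's orthogonal form\<close>

lemma transpose_comp_invol [simp]:
  "Transposition.transpose k l \<circ> (Transposition.transpose k l \<circ> T) = T"
  by (simp add: fun_eq_iff)

context integer_partition
begin

definition young_coeff :: "tableau \<Rightarrow> nat \<Rightarrow> real" where
  "young_coeff T k = 1 / real_of_int (axial_dist lam T (k + 1) k)"

definition young_op :: "nat \<Rightarrow> (tableau \<Rightarrow> real) \<Rightarrow> tableau \<Rightarrow> real" where
  "young_op k x T = young_coeff T k * x T + sqrt (1 - (young_coeff T k)\<^sup>2) * x (adj_transp k \<circ> T)"

lemma young_coeff_swap:
  assumes "T \<in> Tab lam" "k \<in> {1..<sum_list lam}"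
  shows "young_coeff (adj_transp k \<circ> T) k = - young_coeff T k"
  using content_at_swap[OF Tab_bij[OF assms(1)] assms(2), of k]
    content_at_swap[OF Tab_bij[OF assms(1)] assms(2), of "k + 1"] assms(2)
  by (simp add: young_coeff_def axial_dist_def minus_divide_right)

lemma young_coeff_swap_far:
  assumes "T \<in> Tab lam" "k \<in> {1..<sum_list lam}" "l \<in> {1..<sum_list lam}" "k + 1 < l \<or> l + 1 < k"
  shows "young_coeff (adj_transp k \<circ> T) l = young_coeff T l"
  using content_at_swap[OF Tab_bij[OF assms(1)] assms(2), of l]
    content_at_swap[OF Tab_bij[OF assms(1)] assms(2), of "l + 1"] assms(2-)
  by (auto simp: young_coeff_def axial_dist_def transpose_def)

lemma young_coeff_square_le_1:
  assumes "T \<in> Tab lam" "k \<in> {1..<sum_list lam}"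
  shows "(young_coeff T k)\<^sup>2 \<le> 1"
proof -
  have "axial_dist lam T (k + 1) k \<noteq> 0"
    using content_at_eq_gap[OF assms(1), of k "k + 1"] assms(2) by (auto simp: axial_dist_def)
  then have "1 \<le> \<bar>real_of_int (axial_dist lam T (k + 1) k)\<bar>" by linarith
  then have "\<bar>young_coeff T k\<bar> \<le> 1" by (simp add: young_coeff_def)
  then show ?thesis by (simp add: abs_square_le_1)
qed

lemma young_coeff_square_eq_1:
  assumes "T \<in> Tab lam" "k \<in> {1..<sum_list lam}" "adj_transp k \<circ> T \<notin> Tab lam"
  shows "(young_coeff T k)\<^sup>2 = 1"
  using axial_dist_swap_not_standard[OF assms]
  by (auto simp: young_coeff_def abs_if split: if_splits)

lemma young_coeff_braid:
  assumes T: "T \<in> Tab lam" and k: "1 \<le> k" "k + 1 < sum_list lam"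
  shows "young_coeff (adj_transp k \<circ> T) (k + 1) = young_coeff (adj_transp (k + 1) \<circ> T) k"
    and "young_coeff (adj_transp (k + 1) \<circ> (adj_transp k \<circ> T)) k = young_coeff T (k + 1)"
    and "young_coeff (adj_transp k \<circ> (adj_transp (k + 1) \<circ> T)) (k + 1) = young_coeff T k"
    and "young_coeff T k * young_coeff T (k + 1) =
      young_coeff (adj_transp (k + 1) \<circ> T) k * (young_coeff T k + young_coeff T (k + 1))"
proof -
  have in_range: "k \<in> {1..<sum_list lam}" "k + 1 \<in> {1..<sum_list lam}" using k by auto
  have swap: "content_at lam (adj_transp l \<circ> U) m = content_at lam U (adj_transp l m)"
    if "bij_betw U (boxes lam) {1..sum_list lam}" "l \<in> {k, k + 1}" "m \<in> {k..k + 2}" for U l m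
    using content_at_swap[OF that(1), of l m] that(2,3) k by auto
  have bij: "bij_betw T (boxes lam) {1..sum_list lam}"
    "bij_betw (adj_transp k \<circ> T) (boxes lam) {1..sum_list lam}"
    "bij_betw (adj_transp (k + 1) \<circ> T) (boxes lam) {1..sum_list lam}"
    using adj_transp_bij_betw[OF Tab_bij[OF T]] Tab_bij[OF T] in_range by blast+
  show "young_coeff (adj_transp k \<circ> T) (k + 1) = young_coeff (adj_transp (k + 1) \<circ> T) k"
    and "young_coeff (adj_transp (k + 1) \<circ> (adj_transp k \<circ> T)) k = young_coeff T (k + 1)"
    and "young_coeff (adj_transp k \<circ> (adj_transp (k + 1) \<circ> T)) (k + 1) = young_coeff T k"
    unfolding young_coeff_def axial_dist_def
    using swap[OF bij(1)] swap[OF bij(2)] swap[OF bij(3)] by (simp_all add: transpose_def)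
  define p q r where "p = real_of_int (content_at lam T k)"
    and "q = real_of_int (content_at lam T (k + 1))"
    and "r = real_of_int (content_at lam T (k + 2))"
  have "p \<noteq> q" "q \<noteq> r" "p \<noteq> r"
    unfolding p_def q_def r_def
    using content_at_eq_gap[OF T, of k "k + 1"] content_at_eq_gap[OF T, of "k + 1" "k + 2"]
      content_at_eq_gap[OF T, of k "k + 2"] k by auto
  then have "1 / (q - p) * (1 / (r - q)) = 1 / (r - p) * (1 / (q - p) + 1 / (r - q))"
    by (simp add: field_simps)
  moreover have "young_coeff T k = 1 / (q - p)" "young_coeff T (k + 1) = 1 / (r - q)"
    "young_coeff (adj_transp (k + 1) \<circ> T) k = 1 / (r - p)"
    unfolding young_coeff_def axial_dist_def p_def q_def r_def
    using swap[OF bij(1)] by (simp_all add: transpose_def)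
  ultimately show "young_coeff T k * young_coeff T (k + 1) =
      young_coeff (adj_transp (k + 1) \<circ> T) k * (young_coeff T k + young_coeff T (k + 1))"
    by (simp only:)
qed

lemma young_op_in_hspace:
  assumes k: "k \<in> {1..<sum_list lam}" and x: "x \<in> hspace (Tab lam)"
  shows "young_op k x \<in> hspace (Tab lam)"
  unfolding hspace_def
proof (intro CollectI allI impI)
  fix T assume T: "T \<notin> Tab lam"
  show "young_op k x T = 0"
  proof (cases "adj_transp k \<circ> T \<in> Tab lam")
    case True
    then have "(young_coeff T k)\<^sup>2 = 1"
      using young_coeff_swap[OF True k] young_coeff_square_eq_1[OF True k] T by simp
    then show ?thesis using hspaceD[OF x T] by (simp add: young_op_def)
  qed (use T hspaceD[OF x] in \<open>simp add: young_op_def\<close>)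
qed

lemma lin_op_young_op: "k \<in> {1..<sum_list lam} \<Longrightarrow> lin_op (Tab lam) (Tab lam) (young_op k)"
  unfolding lin_op_def using young_op_in_hspace
  by (auto simp: young_op_def fun_eq_iff algebra_simps)

lemma young_op_invol:
  assumes k: "k \<in> {1..<sum_list lam}" and x: "x \<in> hspace (Tab lam)"
  shows "young_op k (young_op k x) = x"
proof (rule hspace_eqI[OF young_op_in_hspace[OF k young_op_in_hspace[OF k x]] x])
  fix T assume T: "T \<in> Tab lam"
  define r P where "r = young_coeff T k" and "P = sqrt (1 - (young_coeff T k)\<^sup>2)"
  have "P * P = 1 - r\<^sup>2" unfolding P_def r_def using young_coeff_square_le_1[OF T k] by simp
  moreover have "young_op k (young_op k x) T = (r\<^sup>2 + P * P) * x T"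
    unfolding young_op_def young_coeff_swap[OF T k]
    by (simp add: r_def P_def power2_eq_square algebra_simps)
  ultimately show "young_op k (young_op k x) T = x T" by simp
qed

lemma young_op_commute:
  assumes k: "k \<in> {1..<sum_list lam}" "l \<in> {1..<sum_list lam}" and kl: "k + 1 < l"
    and x: "x \<in> hspace (Tab lam)"
  shows "young_op k (young_op l x) = young_op l (young_op k x)"
proof (rule hspace_eqI[of _ "Tab lam"])
  fix T assume T: "T \<in> Tab lam"
  have "adj_transp k \<circ> (adj_transp l \<circ> T) = adj_transp l \<circ> (adj_transp k \<circ> T)"
    using kl by (auto simp: fun_eq_iff transpose_def)
  then show "young_op k (young_op l x) T = young_op l (young_op k x) T"
    using young_coeff_swap_far[OF T k] young_coeff_swap_far[OF T k(2,1)] kl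
    by (simp add: young_op_def algebra_simps)
qed (use young_op_in_hspace k x in auto)

text \<open>The two sides of the braid relation at a tableau \<open>T\<close>; the \<open>h\<close> are the values of a vector on
  the orbit of \<open>T\<close> under \<open>s\<^sub>k\<close> and \<open>s\<^sub>k\<^sub>+\<^sub>1\<close>.\<close>

lemma braid_identity:
  fixes \<alpha> \<beta> \<gamma> P Q R h\<^sub>0 h\<^sub>1 h\<^sub>2 h\<^sub>3 h\<^sub>4 h\<^sub>5 :: "'a::idom"
  assumes "\<alpha> * \<gamma> = \<beta> * (\<alpha> + \<gamma>)" "P * P = 1 - \<alpha>\<^sup>2" "R * R = 1 - \<gamma>\<^sup>2"
  shows "\<alpha> * (\<gamma> * (\<alpha> * h\<^sub>0 + P * h\<^sub>1) + R * (\<beta> * h\<^sub>2 + Q * h\<^sub>4)) +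
      P * (\<beta> * (- \<alpha> * h\<^sub>1 + P * h\<^sub>0) + Q * (\<gamma> * h\<^sub>3 + R * h\<^sub>5)) =
    \<gamma> * (\<alpha> * (\<gamma> * h\<^sub>0 + R * h\<^sub>2) + P * (\<beta> * h\<^sub>1 + Q * h\<^sub>3)) +
      R * (\<beta> * (- \<gamma> * h\<^sub>2 + R * h\<^sub>0) + Q * (\<alpha> * h\<^sub>4 + P * h\<^sub>5))"
  using assms by algebra

lemma young_op_braid:
  assumes k: "1 \<le> k" "k + 1 < sum_list lam" and x: "x \<in> hspace (Tab lam)"
  shows "young_op k (young_op (k + 1) (young_op k x)) =
    young_op (k + 1) (young_op k (young_op (k + 1) x))"
proof (rule hspace_eqI[of _ "Tab lam"])
  have in_range: "k \<in> {1..<sum_list lam}" "k + 1 \<in> {1..<sum_list lam}" using k by auto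
  then show "young_op k (young_op (k + 1) (young_op k x)) \<in> hspace (Tab lam)"
    "young_op (k + 1) (young_op k (young_op (k + 1) x)) \<in> hspace (Tab lam)"
    using young_op_in_hspace x by blast+
  fix T assume T: "T \<in> Tab lam"
  let ?s = "adj_transp k" and ?t = "adj_transp (k + 1)"
  note coeffs = young_coeff_braid[OF T k]
    young_coeff_swap[OF T in_range(1)] young_coeff_swap[OF T in_range(2)]
  have braid_perm: "?t \<circ> (?s \<circ> (?t \<circ> T)) = ?s \<circ> (?t \<circ> (?s \<circ> T))"
    by (auto simp: fun_eq_iff transpose_def)
  have sqrt_square: "sqrt (1 - (young_coeff T l)\<^sup>2) * sqrt (1 - (young_coeff T l)\<^sup>2) =
      1 - (young_coeff T l)\<^sup>2"
    if "l \<in> {1..<sum_list lam}" for l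
    using young_coeff_square_le_1[OF T that] by simp
  show "young_op k (young_op (k + 1) (young_op k x)) T =
      young_op (k + 1) (young_op k (young_op (k + 1) x)) T"
    using braid_identity[OF coeffs(4) sqrt_square[OF in_range(1)] sqrt_square[OF in_range(2)],
        of "x T" "x (?s \<circ> T)" "x (?t \<circ> T)" "sqrt (1 - (young_coeff (?t \<circ> T) k)\<^sup>2)"
          "x (?s \<circ> (?t \<circ> T))" "x (?t \<circ> (?s \<circ> T))" "x (?s \<circ> (?t \<circ> (?s \<circ> T)))"]
    unfolding young_op_def coeffs(1-3,5,6) braid_perm transpose_comp_invol power2_minus .
qed

sublocale young: coxeter_ops "sum_list lam" young_op "hspace (Tab lam)"
  by unfold_locales
    (rule young_op_in_hspace young_op_invol young_op_commute young_op_braid; simp)+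

lemma iprod_young_op:
  assumes k: "k \<in> {1..<sum_list lam}" and x: "x \<in> hspace (Tab lam)" and y: "y \<in> hspace (Tab lam)"
  shows "iprod (Tab lam) (young_op k x) y = iprod (Tab lam) x (young_op k y)"
proof -
  let ?s = "\<lambda>T. adj_transp k \<circ> T"
  let ?c = "\<lambda>T. sqrt (1 - (young_coeff T k)\<^sup>2)"
  let ?U = "{T \<in> Tab lam. ?s T \<in> Tab lam}"
  have restrict: "(\<Sum>T\<in>Tab lam. ?c T * (u (?s T) * v T)) = (\<Sum>T\<in>?U. ?c T * (u (?s T) * v T))"
    if "u \<in> hspace (Tab lam)" for u v
    using hspaceD[OF that] finite_Tab by (intro sum.mono_neutral_right) auto
  have "(\<Sum>T\<in>?U. ?c T * (x (?s T) * y T)) = (\<Sum>T\<in>?U. ?c T * (y (?s T) * x T))"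
    by (rule sum.reindex_bij_witness[of _ ?s ?s]) (use young_coeff_swap[OF _ k] in auto)
  then have "(\<Sum>T\<in>Tab lam. ?c T * (x (?s T) * y T)) = (\<Sum>T\<in>Tab lam. ?c T * (y (?s T) * x T))"
    using restrict[OF x] restrict[OF y] by simp
  then show ?thesis
    unfolding iprod_def young_op_def by (simp add: algebra_simps sum.distrib)
qed

lemma unitary_young_op:
  assumes k: "k \<in> {1..<sum_list lam}"
  shows "unitary_op (Tab lam) (young_op k)"
proof -
  have "iprod (Tab lam) (young_op k x) (young_op k y) = iprod (Tab lam) x y"
    if "x \<in> hspace (Tab lam)" "y \<in> hspace (Tab lam)" for x y
    using iprod_young_op[OF k that(1) young_op_in_hspace[OF k that(2)]] young_op_invol[OF k that(2)]
    by simp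
  moreover have "young_op k ` hspace (Tab lam) = hspace (Tab lam)"
    using young_op_in_hspace[OF k] young_op_invol[OF k] by force
  ultimately show ?thesis
    using lin_op_young_op[OF k] by (simp add: unitary_op_def isometry_op_def)
qed

lemma young_op_basis_vec:
  assumes k: "k \<in> {1..<sum_list lam}" and T: "T \<in> Tab lam"
  shows "young_op k (basis_vec T) =
    (let D = real_of_int (axial_dist lam T (k + 1) k); T' = adj_transp k \<circ> T in
      (\<lambda>S. 1 / D * basis_vec T S + (if T' \<in> Tab lam then sqrt (1 - 1 / D\<^sup>2) * basis_vec T' S else 0)))"
proof -
  have "young_op k (basis_vec T) S = young_coeff T k * basis_vec T S +
      sqrt (1 - (young_coeff T k)\<^sup>2) * basis_vec (adj_transp k \<circ> T) S" for S
  proof -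
    have "adj_transp k \<circ> S = T \<longleftrightarrow> S = adj_transp k \<circ> T" by (metis transpose_comp_invol)
    then show ?thesis
      using young_coeff_swap[OF T k] by (auto simp: young_op_def basis_vec_def)
  qed
  then show ?thesis
    using young_coeff_square_eq_1[OF T k]
    by (auto simp: Let_def young_coeff_def power_one_over fun_eq_iff)
qed

theorem young_orthogonal_form_extend: "is_young_orthogonal_form lam young.extend"
proof -
  have "unitary_op (Tab lam) (foldr young_op w)" if "set w \<subseteq> {1..<sum_list lam}" for w
    using that
  proof (induction w)
    case Nil
    show ?case using unitary_op_id[of "Tab lam"] by (simp add: id_def)
  next
    case (Cons k w)
    then show ?case
      using unitary_op_comp[OF unitary_young_op[of k], of "foldr young_op w"]
      by (simp add: comp_def)
  qed
  then have unitary: "unitary_op (Tab lam) (young.extend \<sigma>)" if "\<sigma> permutes {1..sum_list lam}" for \<sigma>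
    using young.extend_eq_word[OF that] by metis
  show ?thesis
    unfolding is_young_orthogonal_form_def
  proof (intro conjI allI ballI impI)
    fix k T assume kT: "k \<in> {1..<sum_list lam}" "T \<in> Tab lam"
    show "young.extend (adj_transp k) (basis_vec T) =
      (let D = real_of_int (axial_dist lam T (k + 1) k); T' = adj_transp k \<circ> T in
        (\<lambda>S. 1 / D * basis_vec T S + (if T' \<in> Tab lam then sqrt (1 - 1 / D\<^sup>2) * basis_vec T' S else 0)))"
      unfolding young_op_basis_vec[OF kT, symmetric]
      by (rule young.extend_adj_transp[OF kT(1) basis_vec_in_hspace[OF kT(2)]])
  qed (use unitary young.extend_comp in auto)
qed

lemma young_rep_form: "is_young_orthogonal_form lam (young_rep lam)"
  unfolding young_rep_def by (rule someI[of _ young.extend]) (rule young_orthogonal_form_extend)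

sublocale rep: isometric_rep "sum_list lam" "Tab lam" "young_rep lam"
proof
  note form = young_rep_form[unfolded is_young_orthogonal_form_def]
  show "isometry_op (Tab lam) (Tab lam) (young_rep lam \<sigma>)" if "\<sigma> permutes {1..sum_list lam}" for \<sigma>
    using form that unfolding unitary_op_def by blast
  show comp: "young_rep lam (\<sigma> \<circ> \<tau>) x = young_rep lam \<sigma> (young_rep lam \<tau> x)"
    if "\<sigma> permutes {1..sum_list lam}" "\<tau> permutes {1..sum_list lam}" "x \<in> hspace (Tab lam)"
      for \<sigma> \<tau> x
    using form that by blast
  show "young_rep lam id x = x" if "x \<in> hspace (Tab lam)" for x
  proof -
    have "young_rep lam id ` hspace (Tab lam) = hspace (Tab lam)"
      using form permutes_id unfolding unitary_op_def by blast
    then have "x \<in> young_rep lam id ` hspace (Tab lam)" using that by simp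
    then obtain y where "y \<in> hspace (Tab lam)" "x = young_rep lam id y" by (rule imageE)
    then show ?thesis using comp[of id id y] permutes_id by simp
  qed
qed

lemma young_rep_adj_transp:
  assumes k: "k \<in> {1..<sum_list lam}" and x: "x \<in> hspace (Tab lam)"
  shows "young_rep lam (adj_transp k) x = young_op k x"
proof (rule lin_op_eqI_basis[OF finite_Tab finite_Tab rep.linear lin_op_young_op[OF k] x])
  show "adj_transp k permutes {1..sum_list lam}" by (rule adj_transp_permutes[OF k])
  show "young_rep lam (adj_transp k) (basis_vec T) = young_op k (basis_vec T)"
    if "T \<in> Tab lam" for T
    using young_rep_form k that unfolding is_young_orthogonal_form_def young_op_basis_vec[OF k that]
    by blast
qed

end

section \<open>Rows, addable boxes and corners\<close>

definition diagram :: "(nat \<Rightarrow> nat) \<Rightarrow> (nat \<times> nat) set" where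
  "diagram r = {(i, j). j < r i}"

definition young_rows :: "nat \<Rightarrow> (nat \<Rightarrow> nat) \<Rightarrow> bool" where
  "young_rows k r \<longleftrightarrow> antimono r \<and> (\<forall>i\<ge>k. r i = 0)"

definition addable :: "(nat \<Rightarrow> nat) \<Rightarrow> nat set" where
  "addable r = {i. i = 0 \<or> r i < r (i - 1)}"

definition removable :: "(nat \<Rightarrow> nat) \<Rightarrow> nat set" where
  "removable r = {i. r (Suc i) < r i}"

definition row :: "nat list \<Rightarrow> nat \<Rightarrow> nat" where
  "row lam i = (if i < length lam then lam ! i else 0)"

definition add_box :: "nat list \<Rightarrow> nat \<Rightarrow> nat list" where
  "add_box mu i = (if i < length mu then mu[i := Suc (mu ! i)] else mu @ [1])"

definition box_content :: "nat \<times> nat \<Rightarrow> int" where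
  "box_content = (\<lambda>(i, j). int j - int i)"

definition added_box :: "nat list \<Rightarrow> nat list \<Rightarrow> nat \<times> nat" where
  "added_box mu lam = the_elem (boxes lam - boxes mu)"

lemma mem_diagram [simp]: "(i, j) \<in> diagram r \<longleftrightarrow> j < r i"
  by (simp add: diagram_def)

lemma boxes_eq_diagram: "boxes lam = diagram (row lam)"
  by (auto simp: boxes_def row_def split: if_splits)

lemma diagram_add: "diagram (r(i := Suc (r i))) = insert (i, r i) (diagram r)"
  by (auto simp: diagram_def split: if_splits)

lemma diagram_remove: "diagram (r(i := r i - 1)) = diagram r - {(i, r i - 1)}"
  by (auto simp: diagram_def split: if_splits)

lemma young_rowsD:
  assumes "young_rows k r"
  shows young_rows_le: "\<And>i j. i \<le> j \<Longrightarrow> r j \<le> r i"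
    and young_rows_zero: "\<And>i. k \<le> i \<Longrightarrow> r i = 0"
  using assms by (auto simp: young_rows_def dest: antimonoD)

lemma addable_le: "young_rows k r \<Longrightarrow> i \<in> addable r \<Longrightarrow> i \<le> k"
  using young_rows_zero[of k r "i - 1"]
  by (cases i) (auto simp: addable_def simp flip: not_less_eq_eq)

lemma removable_less: "young_rows k r \<Longrightarrow> i \<in> removable r \<Longrightarrow> i < k"
  using young_rows_zero[of k r i] by (cases "i < k") (auto simp: removable_def)

lemma young_rows_add:
  assumes r: "young_rows k r" and i: "i \<in> addable r" "i < k"
  shows "young_rows k (r(i := Suc (r i)))"
proof -
  have "r j \<ge> Suc (r i)" if "j < i" for j
    using young_rows_le[OF r, of j "i - 1"] that i(1) by (cases i) (auto simp: addable_def)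
  then show ?thesis
    using young_rowsD[OF r] i(2) by (auto simp: young_rows_def monotone_on_def le_Suc_eq)
qed

lemma young_rows_remove:
  assumes r: "young_rows k r" and i: "i \<in> removable r"
  shows "young_rows k (r(i := r i - 1))"
proof -
  have "r j \<le> r i - 1" if "i < j" for j
    using young_rows_le[OF r, of "Suc i" j] that i by (auto simp: removable_def)
  then show ?thesis
    using young_rowsD[OF r]
    by (auto simp: young_rows_def monotone_on_def intro: le_trans[OF diff_le_self])
qed

lemma diagram_Sigma:
  assumes "young_rows k r"
  shows "diagram r = Sigma {..<k} (\<lambda>i. {..<r i})"
  using young_rows_zero[OF assms] by (auto simp: diagram_def) (metis not_less less_zeroE)

lemma card_diagram: "young_rows k r \<Longrightarrow> card (diagram r) = (\<Sum>i<k. r i)"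
  by (simp add: diagram_Sigma card_SigmaI)

lemma young_shape_diagram:
  assumes "young_rows k r"
  shows "young_shape (diagram r)"
proof -
  have "finite (diagram r)" by (simp add: diagram_Sigma[OF assms])
  moreover have "p \<in> diagram r" if "q \<in> diagram r" "p \<le> q" for p q
    using that young_rows_le[OF assms, of "fst p" "fst q"]
    by (auto simp: diagram_def less_eq_prod_def)
  ultimately show ?thesis by (simp add: young_shape_def)
qed

lemma corners_diagram:
  assumes r: "young_rows k r"
  shows "corners (diagram r) = (\<lambda>i. (i, r i - 1)) ` removable r"
proof (intro subset_antisym subsetI)
  fix p assume "p \<in> corners (diagram r)"
  moreover obtain i j where p: "p = (i, j)" by (cases p)
  ultimately have j: "j < r i" and shape: "young_shape (diagram r - {(i, j)})"
    by (auto simp: corners_def)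
  have "(i, Suc j) \<notin> diagram r" "(Suc i, j) \<notin> diagram r"
    using young_shape_down_closed[OF shape, of "(i, Suc j)" "(i, j)"]
      young_shape_down_closed[OF shape, of "(Suc i, j)" "(i, j)"] by auto
  then show "p \<in> (\<lambda>i. (i, r i - 1)) ` removable r"
    using j by (auto simp: p removable_def intro!: image_eqI[of _ _ i])
next
  fix p assume "p \<in> (\<lambda>i. (i, r i - 1)) ` removable r"
  then obtain i where i: "i \<in> removable r" "p = (i, r i - 1)" by blast
  have "young_shape (diagram r - {(i, r i - 1)})"
    using young_shape_diagram[OF young_rows_remove[OF r i(1)]] by (simp only: diagram_remove)
  then show "p \<in> corners (diagram r)"
    using i by (auto simp: corners_def removable_def)
qed

lemma row_add_box: "i \<le> length mu \<Longrightarrow> row (add_box mu i) = (row mu)(i := Suc (row mu i))"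
  by (auto simp: row_def add_box_def fun_eq_iff nth_append)

lemma sum_list_add_box: "i \<le> length mu \<Longrightarrow> sum_list (add_box mu i) = Suc (sum_list mu)"
  by (auto simp: add_box_def sum_list_update elem_le_sum_list)

lemma young_rows_row:
  assumes "partition_of lam n"
  shows "young_rows (length lam) (row lam)"
  using assms sorted_wrt_nth_less[of "(\<ge>)" lam]
  by (auto simp: young_rows_def partition_of_def row_def monotone_on_def le_less)

lemma partition_of_iff_rows:
  "partition_of lam n \<longleftrightarrow>
    young_rows (length lam) (row lam) \<and> 0 \<notin> set lam \<and> sum_list lam = n"
proof
  assume rows: "young_rows (length lam) (row lam) \<and> 0 \<notin> set lam \<and> sum_list lam = n"
  have "sorted_wrt (\<ge>) lam"
    unfolding sorted_wrt_iff_nth_less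
  proof (intro allI impI)
    fix i j assume "i < j" "j < length lam"
    then show "lam ! i \<ge> lam ! j"
      using young_rows_le[OF conjunct1[OF rows], of i j] by (simp add: row_def)
  qed
  then show "partition_of lam n" using rows by (simp add: partition_of_def)
qed (use young_rows_row in \<open>auto simp: partition_of_def\<close>)

lemma partition_eqI:
  assumes "partition_of lam n" "partition_of lam' n'" "boxes lam = boxes lam'"
  shows "lam = lam'"
proof -
  have eq_map: "l = map (row l) [0..<card {i. row l i > 0}]" if "partition_of l m" for l m
  proof -
    have "l ! i > 0" if "i < length l" for i
      using \<open>partition_of l m\<close> nth_mem[OF that] by (cases "l ! i") (auto simp: partition_of_def)
    then have "{i. row l i > 0} = {..<length l}" by (auto simp: row_def split: if_splits)
    then have "card {i. row l i > 0} = length l" by simp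
    then show ?thesis by (intro nth_equalityI) (simp_all add: row_def)
  qed
  have "row lam i = row lam' i" for i
  proof -
    have "{j. (i, j) \<in> diagram (row lam)} = {j. (i, j) \<in> diagram (row lam')}"
      using assms(3) by (simp only: boxes_eq_diagram)
    then have "{..<row lam i} = {..<row lam' i}" by (simp add: lessThan_def)
    then show ?thesis by simp
  qed
  then show ?thesis using eq_map[OF assms(1)] eq_map[OF assms(2)] by presburger
qed

lemma integer_partition_up: "nu \<in> up lam \<Longrightarrow> integer_partition nu"
  by unfold_locales (auto simp: up_def partition_of_def)

context integer_partition
begin

lemmas rows = young_rows_row[OF partition]

lemma addable_le_length: "i \<in> addable (row lam) \<Longrightarrow> i \<le> length lam"
  by (rule addable_le[OF rows])

lemma finite_addable: "finite (addable (row lam))"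
  by (rule finite_subset[of _ "{..length lam}"]) (auto dest: addable_le_length)

lemma boxes_add_box: "i \<in> addable (row lam) \<Longrightarrow>
  boxes (add_box lam i) = insert (i, row lam i) (boxes lam)"
  by (simp add: boxes_eq_diagram row_add_box addable_le_length diagram_add)

lemma partition_add_box:
  assumes i: "i \<in> addable (row lam)"
  shows "partition_of (add_box lam i) (sum_list lam + 1)"
proof -
  have "young_rows (length (add_box lam i)) (row lam)"
    using rows by (auto simp: young_rows_def add_box_def)
  moreover have "i < length (add_box lam i)"
    using addable_le_length[OF i] by (auto simp: add_box_def)
  moreover have "0 \<notin> set (add_box lam i)"
    using partition set_update_subset_insert[of lam i "Suc (lam ! i)"]
    by (auto simp: partition_of_def add_box_def)
  ultimately show ?thesis
    using i
    by (simp add: partition_of_iff_rows row_add_box sum_list_add_box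
        addable_le_length young_rows_add)
qed

lemma up_eq_add_box: "up lam = add_box lam ` addable (row lam)"
proof (intro subset_antisym subsetI)
  fix nu assume nu: "nu \<in> up lam"
  then obtain i j where p: "(i, j) \<notin> boxes lam" "boxes nu = insert (i, j) (boxes lam)"
    by (auto simp: up_def)
  interpret nu: integer_partition nu by (rule integer_partition_up[OF nu])
  have below: "q \<in> boxes lam" if "q \<le> (i, j)" "q \<noteq> (i, j)" for q
    using young_shape_down_closed[OF nu.shape, of "(i, j)" q] that p(2) by auto
  have j: "j = row lam i"
    using below[of "(i, row lam i)"] p(1) by (cases "row lam i < j") (auto simp: boxes_eq_diagram)
  then have i: "i \<in> addable (row lam)"
    using below[of "(i - 1, j)"] by (cases "i = 0") (auto simp: boxes_eq_diagram addable_def)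
  have "boxes nu = boxes (add_box lam i)" using p(2) by (simp add: j boxes_add_box[OF i])
  then show "nu \<in> add_box lam ` addable (row lam)"
    using partition_eqI[OF nu.partition partition_add_box[OF i]] i by blast
next
  fix nu assume "nu \<in> add_box lam ` addable (row lam)"
  then show "nu \<in> up lam"
    using partition_add_box boxes_add_box by (fastforce simp: up_def boxes_eq_diagram)
qed

lemma finite_up: "finite (up lam)"
  by (simp add: up_eq_add_box finite_addable)

lemma added_box_add_box:
  assumes i: "i \<in> addable (row lam)"
  shows "added_box lam (add_box lam i) = (i, row lam i)"
proof -
  have "boxes (add_box lam i) - boxes lam = {(i, row lam i)}"
    unfolding boxes_add_box[OF i] by (auto simp: boxes_eq_diagram)
  then show ?thesis by (simp add: added_box_def)
qed

lemma inj_on_add_box: "inj_on (add_box lam) (addable (row lam))"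
  by (rule inj_onI) (metis Pair_inject added_box_add_box)

lemma dim_pos: "dim lam > 0"
  unfolding dim_def Tab_eq_Syt by (rule card_Syt_pos[OF shape])

lemma last_contents:
  assumes "sum_list lam \<ge> 1"
  shows "(\<lambda>T. content_at lam T (sum_list lam)) ` Tab lam = box_content ` corners (boxes lam)"
proof (intro subset_antisym subsetI)
  fix y assume "y \<in> (\<lambda>T. content_at lam T (sum_list lam)) ` Tab lam"
  then obtain T where T: "T \<in> Tab lam" "y = content_at lam T (sum_list lam)" by blast
  obtain i j where box: "(i, j) \<in> boxes lam" "T (i, j) = sum_list lam"
    by (rule tableau_obtain_box[OF Tab_bij[OF T(1)], of "sum_list lam"]) (use assms in auto)
  have "(i, j) \<in> corners (boxes lam)"
    by (rule max_entry_at_corner[OF T(1)[unfolded Tab_eq_Syt] shape]) (use box card_boxes in auto)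
  then show "y \<in> box_content ` corners (boxes lam)"
    using content_at_box[OF Tab_bij[OF T(1)] box(1)] box(2) T(2)
    by (auto simp: box_content_def intro!: image_eqI[of _ _ "(i, j)"])
next
  fix y assume "y \<in> box_content ` corners (boxes lam)"
  then obtain i j where ij: "(i, j) \<in> corners (boxes lam)" "y = int j - int i"
    by (auto simp: box_content_def)
  then obtain T where T: "T \<in> Tab lam" "T (i, j) = sum_list lam" and box: "(i, j) \<in> boxes lam"
    unfolding max_entry_boxes_eq_corners[OF shape, symmetric] Tab_eq_Syt card_boxes by blast
  then have "content_at lam T (sum_list lam) = y"
    using content_at_box[OF Tab_bij[OF T(1)] box] ij(2) by simp
  then show "y \<in> (\<lambda>T. content_at lam T (sum_list lam)) ` Tab lam" using T(1) by blast
qed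

end

section \<open>Direct sums\<close>

definition direct_sum_op ::
    "'l set \<Rightarrow> ('l \<Rightarrow> ('i \<Rightarrow> real) \<Rightarrow> 'j \<Rightarrow> real) \<Rightarrow> ('l \<times> 'i \<Rightarrow> real) \<Rightarrow> 'l \<times> 'j \<Rightarrow> real" where
  "direct_sum_op L f x = (\<lambda>(l, j). if l \<in> L then f l (curry x l) j else 0)"

definition weighted_sum_op ::
    "'l set \<Rightarrow> ('l \<Rightarrow> real) \<Rightarrow> ('l \<Rightarrow> ('i \<Rightarrow> real) \<Rightarrow> 'j \<Rightarrow> real) \<Rightarrow> ('i \<Rightarrow> real) \<Rightarrow> 'l \<times> 'j \<Rightarrow> real" where
  "weighted_sum_op L c f v = (\<lambda>(l, j). if l \<in> L then c l * f l v j else 0)"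

lemma curry_in_hspace: "x \<in> hspace (Sigma L A) \<Longrightarrow> l \<in> L \<Longrightarrow> curry x l \<in> hspace (A l)"
  by (auto simp: hspace_def)

lemma in_hspace_Sigma:
  assumes "\<And>l. l \<in> L \<Longrightarrow> curry x l \<in> hspace (A l)" "\<And>l j. l \<notin> L \<Longrightarrow> x (l, j) = 0"
  shows "x \<in> hspace (Sigma L A)"
  using assms unfolding hspace_def by force

lemma iprod_Sigma:
  assumes "finite L" "\<And>l. l \<in> L \<Longrightarrow> finite (A l)"
  shows "iprod (Sigma L A) x y = (\<Sum>l\<in>L. iprod (A l) (curry x l) (curry y l))"
  unfolding iprod_def by (subst sum.Sigma) (use assms in \<open>auto simp: case_prod_beta\<close>)

lemma curry_direct_sum_op: "l \<in> L \<Longrightarrow> curry (direct_sum_op L f x) l = f l (curry x l)"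
  and curry_weighted_sum_op: "l \<in> L \<Longrightarrow> curry (weighted_sum_op L c f v) l = (\<lambda>j. c l * f l v j)"
  by (simp_all add: direct_sum_op_def weighted_sum_op_def curry_def)

lemma isometry_op_direct_sum:
  assumes fin: "finite L" "\<And>l. l \<in> L \<Longrightarrow> finite (A l)" "\<And>l. l \<in> L \<Longrightarrow> finite (B l)"
    and f: "\<And>l. l \<in> L \<Longrightarrow> isometry_op (A l) (B l) (f l)"
  shows "isometry_op (Sigma L A) (Sigma L B) (direct_sum_op L f)"
proof -
  note lin = isometry_op_lin_op[OF f]
  have "direct_sum_op L f x \<in> hspace (Sigma L B)" if x: "x \<in> hspace (Sigma L A)" for x
    using lin_op_in_hspace[OF lin curry_in_hspace[OF x]]
    by (intro in_hspace_Sigma) (simp_all add: curry_direct_sum_op, simp add: direct_sum_op_def)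
  moreover have "direct_sum_op L f (\<lambda>i. x i + y i) =
      (\<lambda>j. direct_sum_op L f x j + direct_sum_op L f y j)"
    if "x \<in> hspace (Sigma L A)" "y \<in> hspace (Sigma L A)" for x y
    using lin_op_add[OF lin curry_in_hspace[OF that(1)] curry_in_hspace[OF that(2)]]
    by (auto simp: direct_sum_op_def curry_def fun_eq_iff)
  moreover have "direct_sum_op L f (\<lambda>i. r * x i) = (\<lambda>j. r * direct_sum_op L f x j)"
    if "x \<in> hspace (Sigma L A)" for r x
    using lin_op_scale[OF lin curry_in_hspace[OF that]]
    by (auto simp: direct_sum_op_def curry_def fun_eq_iff)
  moreover have "iprod (Sigma L B) (direct_sum_op L f x) (direct_sum_op L f y) =
      iprod (Sigma L A) x y"
    if "x \<in> hspace (Sigma L A)" "y \<in> hspace (Sigma L A)" for x y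
    by (simp add: iprod_Sigma fin curry_direct_sum_op isometry_op_iprod[OF f]
        curry_in_hspace[OF that(1)]
        curry_in_hspace[OF that(2)] cong: sum.cong)
  ultimately show ?thesis by (simp add: isometry_op_def lin_op_def)
qed

lemma isometric_rep_direct_sum:
  assumes fin: "finite L" "\<And>l. l \<in> L \<Longrightarrow> finite (A l)"
    and \<pi>: "\<And>l. l \<in> L \<Longrightarrow> isometric_rep n (A l) (\<pi> l)"
  shows "isometric_rep n (Sigma L A) (\<lambda>\<sigma>. direct_sum_op L (\<lambda>l. \<pi> l \<sigma>))"
proof
  show "isometry_op (Sigma L A) (Sigma L A) (direct_sum_op L (\<lambda>l. \<pi> l \<sigma>))"
    if "\<sigma> permutes {1..n}" for \<sigma>
    using fin isometric_rep.isometry[OF \<pi> that] by (intro isometry_op_direct_sum) auto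
  show "direct_sum_op L (\<lambda>l. \<pi> l (\<sigma> \<circ> \<tau>)) x =
      direct_sum_op L (\<lambda>l. \<pi> l \<sigma>) (direct_sum_op L (\<lambda>l. \<pi> l \<tau>) x)"
    if "\<sigma> permutes {1..n}" "\<tau> permutes {1..n}" "x \<in> hspace (Sigma L A)" for \<sigma> \<tau> x
    using isometric_rep.comp[OF \<pi> that(1,2) curry_in_hspace[OF that(3)]]
    by (auto simp: direct_sum_op_def curry_def fun_eq_iff)
  show "direct_sum_op L (\<lambda>l. \<pi> l id) x = x" if "x \<in> hspace (Sigma L A)" for x
    using isometric_rep.id[OF \<pi> curry_in_hspace[OF that]] hspaceD[OF that]
    by (auto simp: direct_sum_op_def fun_eq_iff)
qed

lemma iprod_weighted_sum_op:
  assumes "finite L" "\<And>l. l \<in> L \<Longrightarrow> finite (B l)"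
  shows "iprod (Sigma L B) (weighted_sum_op L c f u) (weighted_sum_op L c g v) =
    (\<Sum>l\<in>L. (c l)\<^sup>2 * iprod (B l) (f l u) (g l v))"
  by (simp add: iprod_Sigma assms curry_weighted_sum_op iprod_scale_left iprod_scale_right
      power2_eq_square mult.assoc cong: sum.cong)

lemma direct_sum_op_weighted_sum_op:
  assumes "\<And>l. l \<in> L \<Longrightarrow> lin_op (A l) (B l) (f l)" "\<And>l. l \<in> L \<Longrightarrow> g l v \<in> hspace (A l)"
  shows "direct_sum_op L f (weighted_sum_op L c g v) = weighted_sum_op L c (\<lambda>l v. f l (g l v)) v"
  using lin_op_scale[OF assms] by (auto simp: direct_sum_op_def weighted_sum_op_def curry_def)

lemma isometry_op_weighted_sum:
  assumes fin: "finite L" "\<And>l. l \<in> L \<Longrightarrow> finite (B l)"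
    and f: "\<And>l. l \<in> L \<Longrightarrow> isometry_op I (B l) (f l)" and c: "(\<Sum>l\<in>L. (c l)\<^sup>2) = 1"
  shows "isometry_op I (Sigma L B) (weighted_sum_op L c f)"
proof -
  let ?F = "weighted_sum_op L c f"
  note lin = isometry_op_lin_op[OF f]
  have "?F v \<in> hspace (Sigma L B)" if v: "v \<in> hspace I" for v
    using hspace_mult[OF lin_op_in_hspace[OF lin v]]
    by (intro in_hspace_Sigma) (simp_all add: curry_weighted_sum_op, simp add: weighted_sum_op_def)
  moreover have "?F (\<lambda>i. u i + v i) = (\<lambda>j. ?F u j + ?F v j)"
    if "u \<in> hspace I" "v \<in> hspace I" for u v
    using lin_op_add[OF lin that] by (auto simp: weighted_sum_op_def fun_eq_iff distrib_left)
  moreover have "?F (\<lambda>i. r * v i) = (\<lambda>j. r * ?F v j)" if "v \<in> hspace I" for r v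
    using lin_op_scale[OF lin that] by (auto simp: weighted_sum_op_def fun_eq_iff)
  moreover have "iprod (Sigma L B) (?F u) (?F v) = iprod I u v"
    if "u \<in> hspace I" "v \<in> hspace I" for u v
    using isometry_op_iprod[OF f that] c
    by (simp add: iprod_weighted_sum_op[OF fin] cong: sum.cong flip: sum_distrib_right)
  ultimately show ?thesis by (simp add: isometry_op_def lin_op_def)
qed

lemma iprod_sum_mult_right:
  "(\<Sum>l\<in>L. c l * iprod I u (\<lambda>i. f l i * v i)) = iprod I u (\<lambda>i. (\<Sum>l\<in>L. c l * f l i) * v i)"
  unfolding iprod_def sum_distrib_left sum_distrib_right
  by (subst sum.swap) (simp add: mult_ac)

lemma diagonal_compression_direct_sum:
  assumes "finite L" "L \<noteq> {}" and finite_A: "\<And>l. l \<in> L \<Longrightarrow> finite (A l)"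
    and summand: "\<And>l. l \<in> L \<Longrightarrow> diagonal_compression m I \<pi> (A l) (\<rho> l) (\<Psi> l) (f l)"
    and c: "(\<Sum>l\<in>L. (c l)\<^sup>2) = 1"
  shows "diagonal_compression m I \<pi> (Sigma L A) (\<lambda>\<sigma>. direct_sum_op L (\<lambda>l. \<rho> l \<sigma>))
    (weighted_sum_op L c \<Psi>) (\<lambda>i. \<Sum>l\<in>L. (c l)\<^sup>2 * f l i)"
proof -
  obtain l\<^sub>0 where "l\<^sub>0 \<in> L" using assms(2) by blast
  then interpret l\<^sub>0: diagonal_compression m I \<pi> "A l\<^sub>0" "\<rho> l\<^sub>0" "\<Psi> l\<^sub>0" "f l\<^sub>0" by (rule summand)
  have full: "isometric_rep (m + 1) (A l) (\<rho> l)" if "l \<in> L" for l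
    using summand[OF that] by (simp add: diagonal_compression_def)
  have act: "direct_sum_op L (\<lambda>l. \<rho> l \<sigma>) (weighted_sum_op L c \<Psi> v) =
      weighted_sum_op L c (\<lambda>l v. \<rho> l \<sigma> (\<Psi> l v)) v"
    if "\<sigma> permutes {1..m + 1}" "v \<in> hspace I" for \<sigma> v
    using isometric_rep.linear[OF full that(1)]
      diagonal_compression.embed_in_hspace[OF summand that(2)]
    by (rule direct_sum_op_weighted_sum_op)
  show ?thesis
  proof (intro diagonal_compression.intro diagonal_compression_axioms.intro)
    show "isometric_rep m I \<pi>" "m \<ge> 1" "finite I"
      by (fact l\<^sub>0.sub.isometric_rep_axioms l\<^sub>0.m_pos l\<^sub>0.finite_index)+
    show "isometric_rep (m + 1) (Sigma L A) (\<lambda>\<sigma>. direct_sum_op L (\<lambda>l. \<rho> l \<sigma>))"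
      by (rule isometric_rep_direct_sum[OF assms(1) finite_A full])
    show "isometry_op I (Sigma L A) (weighted_sum_op L c \<Psi>)"
      using isometry_op_weighted_sum[OF assms(1) finite_A
          diagonal_compression.isometry[OF summand] c] .
    show "direct_sum_op L (\<lambda>l. \<rho> l \<sigma>) (weighted_sum_op L c \<Psi> v) = weighted_sum_op L c \<Psi> (\<pi> \<sigma> v)"
      if "\<sigma> permutes {1..m}" "v \<in> hspace I" for \<sigma> v
      unfolding act[OF l\<^sub>0.permutes_Suc[OF that(1)] that(2)]
      using diagonal_compression.intertwine[OF summand that] by (auto simp: weighted_sum_op_def)
    show "iprod (Sigma L A) (weighted_sum_op L c \<Psi> u)
        (direct_sum_op L (\<lambda>l. \<rho> l (adj_transp m)) (weighted_sum_op L c \<Psi> v)) =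
      iprod I u (\<lambda>i. (\<Sum>l\<in>L. (c l)\<^sup>2 * f l i) * v i)" if uv: "u \<in> hspace I" "v \<in> hspace I" for u v
    proof -
      have s: "adj_transp m permutes {1..m + 1}" using l\<^sub>0.m_pos by (intro adj_transp_permutes) auto
      show ?thesis
        unfolding act[OF s uv(2)] iprod_sum_mult_right[symmetric]
        by (subst iprod_weighted_sum_op[OF assms(1) finite_A])
          (simp_all only: diagonal_compression.compression[OF summand uv] cong: sum.cong)
    qed
  qed
qed

section \<open>Branching for one added box\<close>

definition branching_eigenvalue :: "nat list \<Rightarrow> nat list \<Rightarrow> tableau \<Rightarrow> real" where
  "branching_eigenvalue mu lam R =
    1 / real_of_int (box_content (added_box mu lam) - content_at mu R (sum_list mu))"

locale branching = sub: integer_partition mu for mu :: "nat list" +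
  fixes lam :: "nat list"
  assumes up: "lam \<in> up mu" and nonempty: "sum_list mu \<ge> 1"
begin

lemma sum_list_lam: "sum_list lam = sum_list mu + 1"
  using up by (simp add: up_def partition_of_def)

sublocale sup: integer_partition lam
  by (rule integer_partition_up[OF up])

abbreviation new_box :: "nat \<times> nat" where
  "new_box \<equiv> added_box mu lam"

lemma boxes_lam: "boxes lam = insert new_box (boxes mu)" and new_box_notin: "new_box \<notin> boxes mu"
proof -
  obtain q where q: "q \<notin> boxes mu" "boxes lam = insert q (boxes mu)" using up by (auto simp: up_def)
  then have "boxes lam - boxes mu = {q}" by auto
  then have "new_box = q" by (simp add: added_box_def)
  then show "boxes lam = insert new_box (boxes mu)" "new_box \<notin> boxes mu" using q by simp_all
qed

abbreviation ext :: "tableau \<Rightarrow> tableau" where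
  "ext \<equiv> extend_tab lam mu"

lemma ext_eq: "ext R = R(new_box := sum_list mu + 1)"
  using boxes_lam new_box_notin by (auto simp: extend_tab_def sum_list_lam fun_eq_iff)

lemma bij_betw_ext: "bij_betw ext (Tab mu) {T \<in> Tab lam. T new_box = sum_list mu + 1}"
  using bij_betw_Syt_insert[OF new_box_notin sub.shape]
  by (simp add: sub.Tab_eq_Syt sup.Tab_eq_Syt boxes_lam card_boxes ext_eq[abs_def])

lemma ext_in_Tab: "R \<in> Tab mu \<Longrightarrow> ext R \<in> Tab lam"
  using bij_betwE[OF bij_betw_ext] by blast

lemma Tab_zero_at_new_box: "R \<in> Tab mu \<Longrightarrow> R new_box = 0"
  using new_box_notin unfolding Tab_def by blast

lemma ext_swap:
  assumes "k \<in> {1..<sum_list mu}"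
  shows "adj_transp k \<circ> ext R = ext (adj_transp k \<circ> R)"
  unfolding ext_eq using assms by (auto simp: fun_eq_iff transpose_def)

lemma content_at_ext:
  assumes R: "R \<in> Tab mu"
  shows "a \<in> {1..sum_list mu} \<Longrightarrow> content_at lam (ext R) a = content_at mu R a"
    and "content_at lam (ext R) (sum_list mu + 1) = box_content new_box"
proof -
  note bij = Tab_bij[OF ext_in_Tab[OF R]]
  show "content_at lam (ext R) a = content_at mu R a" if a: "a \<in> {1..sum_list mu}"
  proof -
    obtain i j where ij: "(i, j) \<in> boxes mu" "R (i, j) = a"
      by (rule tableau_obtain_box[OF Tab_bij[OF R] a])
    then have "ext R (i, j) = a" "(i, j) \<in> boxes lam"
      using new_box_notin by (auto simp: ext_eq boxes_lam)
    then show ?thesis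
      using content_at_box[OF Tab_bij[OF R] ij(1)] content_at_box[OF bij, of i j] ij by simp
  qed
  obtain i j where ij: "new_box = (i, j)" by (cases new_box)
  then show "content_at lam (ext R) (sum_list mu + 1) = box_content new_box"
    using content_at_box[OF bij, of i j] by (simp add: boxes_lam ext_eq box_content_def)
qed

lemma young_coeff_ext:
  assumes R: "R \<in> Tab mu"
  shows "k \<in> {1..<sum_list mu} \<Longrightarrow> sup.young_coeff (ext R) k = sub.young_coeff R k"
    and "sup.young_coeff (ext R) (sum_list mu) = branching_eigenvalue mu lam R"
  using content_at_ext[OF R] nonempty
  by (simp_all add: branching_eigenvalue_def sup.young_coeff_def sub.young_coeff_def axial_dist_def)

lemma Psi_outside: "T new_box \<noteq> sum_list mu + 1 \<Longrightarrow> Psi lam mu v T = 0"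
  unfolding Psi_def by (rule sum.neutral) (auto simp: basis_vec_def ext_eq)

lemma Psi_ext:
  assumes v: "v \<in> hspace (Tab mu)" and R: "R new_box = 0"
  shows "Psi lam mu v (ext R) = v R"
proof -
  have "ext R = ext S \<longleftrightarrow> R = S" if "S \<in> Tab mu" for S
    using R Tab_zero_at_new_box[OF that] unfolding ext_eq by (metis fun_upd_triv fun_upd_upd)
  then have "Psi lam mu v (ext R) = (\<Sum>S\<in>Tab mu. if S = R then v S else 0)"
    unfolding Psi_def basis_vec_def by (intro sum.cong) auto
  then show ?thesis using hspaceD[OF v, of R] finite_Tab by auto
qed

lemma Psi_in_hspace: "Psi lam mu v \<in> hspace (Tab lam)"
  unfolding Psi_def hspace_def using ext_in_Tab by (auto simp: basis_vec_def intro!: sum.neutral)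

lemma iprod_Psi:
  assumes v: "v \<in> hspace (Tab mu)"
  shows "iprod (Tab lam) (Psi lam mu v) y = (\<Sum>R\<in>Tab mu. v R * y (ext R))"
proof -
  have "iprod (Tab lam) (Psi lam mu v) y =
      (\<Sum>T\<in>{T \<in> Tab lam. T new_box = sum_list mu + 1}. Psi lam mu v T * y T)"
    unfolding iprod_def by (rule sum.mono_neutral_right) (auto simp: finite_Tab Psi_outside)
  also have "\<dots> = (\<Sum>R\<in>Tab mu. Psi lam mu v (ext R) * y (ext R))"
    by (rule sum.reindex_bij_betw[OF bij_betw_ext, symmetric])
  finally show ?thesis by (simp add: Psi_ext[OF v] Tab_zero_at_new_box)
qed

lemma isometry_op_Psi: "isometry_op (Tab mu) (Tab lam) (Psi lam mu)"
proof -
  have "lin_op (Tab mu) (Tab lam) (Psi lam mu)"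
    unfolding lin_op_def
    by (simp add: Psi_in_hspace)
      (simp add: Psi_def distrib_right sum.distrib sum_distrib_left mult.assoc)
  moreover have "iprod (Tab lam) (Psi lam mu u) (Psi lam mu v) = iprod (Tab mu) u v"
    if "u \<in> hspace (Tab mu)" "v \<in> hspace (Tab mu)" for u v
    unfolding iprod_Psi[OF that(1)] by (simp add: iprod_def Psi_ext[OF that(2)] Tab_zero_at_new_box)
  ultimately show ?thesis by (simp add: isometry_op_def)
qed

lemma Psi_intertwines_young_op:
  assumes k: "k \<in> {1..<sum_list mu}" and v: "v \<in> hspace (Tab mu)"
  shows "sup.young_op k (Psi lam mu v) = Psi lam mu (sub.young_op k v)"
proof (rule hspace_eqI[of _ "Tab lam"])
  have k': "k \<in> {1..<sum_list lam}" using k by (simp add: sum_list_lam)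
  show "sup.young_op k (Psi lam mu v) \<in> hspace (Tab lam)"
    by (rule sup.young_op_in_hspace[OF k' Psi_in_hspace])
  fix T assume T: "T \<in> Tab lam"
  show "sup.young_op k (Psi lam mu v) T = Psi lam mu (sub.young_op k v) T"
  proof (cases "T new_box = sum_list mu + 1")
    case True
    then obtain R where R: "R \<in> Tab mu" "T = ext R"
      using bij_betw_imp_surj_on[OF bij_betw_ext] T by blast
    have zero: "R new_box = 0" "(adj_transp k \<circ> R) new_box = 0"
      using Tab_zero_at_new_box[OF R(1)] k by (simp_all add: transpose_def)
    have "sup.young_op k (Psi lam mu v) (ext R) = sub.young_op k v R"
      unfolding sup.young_op_def sub.young_op_def young_coeff_ext(1)[OF R(1) k] ext_swap[OF k]
      by (simp only: Psi_ext[OF v] zero)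
    then show ?thesis
      by (simp only: R(2) Psi_ext[OF sub.young_op_in_hspace[OF k v]] zero)
  next
    case False
    then have "(adj_transp k \<circ> T) new_box \<noteq> sum_list mu + 1" using k by (simp add: transpose_def)
    then show ?thesis using False by (simp add: sup.young_op_def Psi_outside del: comp_apply)
  qed
qed (rule Psi_in_hspace)

lemma Psi_intertwines:
  assumes "\<sigma> permutes {1..sum_list mu}" "v \<in> hspace (Tab mu)"
  shows "young_rep lam \<sigma> (Psi lam mu v) = Psi lam mu (young_rep mu \<sigma> v)"
proof (rule intertwine_from_generators[OF sub.rep.isometric_rep_axioms
      sup.rep.isometric_rep_axioms _ Psi_in_hspace _ assms])
  fix k u assume "k \<in> {1..<sum_list mu}" "u \<in> hspace (Tab mu)"
  then show "young_rep lam (adj_transp k) (Psi lam mu u) =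
      Psi lam mu (young_rep mu (adj_transp k) u)"
    using Psi_intertwines_young_op sub.young_rep_adj_transp
      sup.young_rep_adj_transp[OF _ Psi_in_hspace]
    by (simp add: sum_list_lam)
qed (simp add: sum_list_lam)

lemma compression_last_transp:
  assumes u: "u \<in> hspace (Tab mu)" and v: "v \<in> hspace (Tab mu)"
  shows "iprod (Tab lam) (Psi lam mu u) (young_rep lam (adj_transp (sum_list mu)) (Psi lam mu v)) =
    iprod (Tab mu) u (\<lambda>R. branching_eigenvalue mu lam R * v R)"
proof -
  let ?s = "adj_transp (sum_list mu)"
  have s: "sum_list mu \<in> {1..<sum_list lam}" using nonempty by (simp add: sum_list_lam)
  have "young_rep lam ?s (Psi lam mu v) (ext R) =
      branching_eigenvalue mu lam R * v R" if R: "R \<in> Tab mu" for R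
  proof -
    have "(?s \<circ> ext R) new_box \<noteq> sum_list mu + 1" by (simp add: ext_eq)
    then have "Psi lam mu v (?s \<circ> ext R) = 0" by (rule Psi_outside)
    then show ?thesis
      unfolding sup.young_rep_adj_transp[OF s Psi_in_hspace] sup.young_op_def
        young_coeff_ext(2)[OF R]
      by (simp only: Psi_ext[OF v] Tab_zero_at_new_box[OF R] mult_zero_right add_0_right)
  qed
  then show ?thesis unfolding iprod_Psi[OF u] by (simp add: iprod_def[of "Tab mu"] cong: sum.cong)
qed

lemma diagonal_compression_Psi:
  "diagonal_compression (sum_list mu) (Tab mu) (young_rep mu) (Tab lam) (young_rep lam) (Psi lam mu)
    (branching_eigenvalue mu lam)"
  using sub.rep.isometric_rep_axioms sup.rep.isometric_rep_axioms[unfolded sum_list_lam]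
    nonempty finite_Tab isometry_op_Psi Psi_intertwines compression_last_transp
  by (intro diagonal_compression.intro diagonal_compression_axioms.intro) auto

end

context integer_partition
begin

definition compression_eigenvalue :: "nat list set \<Rightarrow> tableau \<Rightarrow> real" where
  "compression_eigenvalue L R = (\<Sum>nu\<in>L. real (dim nu) / real (dim_sum L) *
     branching_eigenvalue lam nu R)"

lemma dim_sum_pos:
  assumes "L \<noteq> {}" "L \<subseteq> up lam"
  shows "dim_sum L > 0"
proof -
  have "dim nu > 0" if "nu \<in> L" for nu
    using that assms(2) by (intro integer_partition.dim_pos integer_partition_up) blast
  then show ?thesis
    unfolding dim_sum_def using assms finite_subset[OF assms(2) finite_up] by (intro sum_pos) auto
qed

lemma equi_isoclinic_iff_eigenvalues:
  assumes L: "L \<noteq> {}" "L \<subseteq> up lam" and "sum_list lam \<ge> 1"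
    and t: "\<forall>k\<in>{1..sum_list lam + 1}.
      t k permutes {1..sum_list lam + 1} \<and> t k (sum_list lam + 1) = k"
  shows "equi_isoclinic {1..sum_list lam + 1} (Sigma L Tab)
      (\<lambda>k. young_rep_sum L (t k) ` W_space L lam) \<longleftrightarrow>
    (\<exists>\<alpha>. \<forall>R\<in>Tab lam. (compression_eigenvalue L R)\<^sup>2 = \<alpha>)"
proof -
  let ?c = "\<lambda>nu. sqrt (real (dim nu) / real (dim_sum L))"
  have finite: "finite L" by (rule finite_subset[OF L(2) finite_up])
  have branching: "branching lam nu" if "nu \<in> L" for nu
    using that L(2) assms(3) by unfold_locales auto
  have weights: "(\<Sum>nu\<in>L. (?c nu)\<^sup>2) = 1"
    using dim_sum_pos[OF L] by (simp add: flip: sum_divide_distrib) (simp add: dim_sum_def)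
  interpret diagonal_compression "sum_list lam" "Tab lam" "young_rep lam" "Sigma L Tab"
    "\<lambda>\<sigma>. direct_sum_op L (\<lambda>nu. young_rep nu \<sigma>)" "weighted_sum_op L ?c (\<lambda>nu. Psi nu lam)"
    "\<lambda>R. \<Sum>nu\<in>L. (?c nu)\<^sup>2 * branching_eigenvalue lam nu R"
    using branching.diagonal_compression_Psi[OF branching] finite_Tab finite L(1) weights
    by (intro diagonal_compression_direct_sum) auto
  have "young_rep_sum L \<sigma> = direct_sum_op L (\<lambda>nu. young_rep nu \<sigma>)" for \<sigma>
    by (simp add: young_rep_sum_def direct_sum_op_def curry_def fun_eq_iff)
  moreover have "W_space L lam = weighted_sum_op L ?c (\<lambda>nu. Psi nu lam) ` hspace (Tab lam)"
    by (simp add: W_space_def Psi_sum_def[abs_def] weighted_sum_op_def[abs_def])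
  ultimately show ?thesis
    using equi_isoclinic_translates_iff[OF t] by (simp add: compression_eigenvalue_def)
qed

end

section \<open>Partial fractions\<close>

definition shift_weight :: "'a::field \<Rightarrow> ('i \<Rightarrow> 'a) \<Rightarrow> 'i set \<Rightarrow> 'i \<Rightarrow> 'a" where
  "shift_weight t l I i = (\<Prod>j\<in>I - {i}. 1 + t / (l i - l j))"

definition vandermonde :: "nat \<Rightarrow> (nat \<Rightarrow> 'a::field) \<Rightarrow> 'a" where
  "vandermonde k l = (\<Prod>j<k. \<Prod>i<j. l i - l j)"

lemma shift_weight_insert_self:
  "x \<notin> I \<Longrightarrow> shift_weight t l (insert x I) x = (\<Prod>i\<in>I. 1 + t / (l x - l i))"
  by (simp add: shift_weight_def)

lemma shift_weight_insert_other:
  assumes "finite I" "x \<notin> I" "i \<in> I"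
  shows "shift_weight t l (insert x I) i = (1 + t / (l i - l x)) * shift_weight t l I i"
proof -
  have "insert x I - {i} = insert x (I - {i})" using assms by auto
  then show ?thesis using assms by (simp add: shift_weight_def)
qed

lemma shift_weight_eq_0:
  assumes "finite I" "j \<in> I" "l j = l i + t" "t \<noteq> 0"
  shows "shift_weight t l I i = 0"
  unfolding shift_weight_def using assms by (intro prod_zero bexI[of _ j]) auto

lemma prod_eq_partial_fractions:
  fixes l :: "'i \<Rightarrow> 'a::field"
  assumes "finite I" "inj_on l I" "a \<notin> l ` I"
  shows "(\<Prod>i\<in>I. 1 + t / (a - l i)) = 1 + t * (\<Sum>i\<in>I. shift_weight t l I i / (a - l i))"
  using assms
proof (induction I arbitrary: a rule: finite_induct)
  case (insert x I)
  define S where "S b = (\<Sum>i\<in>I. shift_weight t l I i / (b - l i))" for b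
  have IH: "(\<Prod>i\<in>I. 1 + t / (b - l i)) = 1 + t * S b" if "b \<notin> l ` I" for b
    using insert.IH[OF _ that] insert.prems by (simp add: S_def)
  have x: "l x \<notin> l ` I" and a: "a \<notin> l ` I" "a \<noteq> l x" using insert by auto
  have "(\<Sum>i\<in>I. shift_weight t l (insert x I) i / (a - l i)) =
      (\<Sum>i\<in>I. shift_weight t l I i / (a - l i) +
        t / (a - l x) * (shift_weight t l I i / (a - l i) - shift_weight t l I i / (l x - l i)))"
  proof (rule sum.cong[OF refl])
    fix i assume i: "i \<in> I"
    then have "l i \<noteq> a" "l i \<noteq> l x" using a(1) x by (metis imageI)+
    then have "a - l i \<noteq> 0" "l i - l x \<noteq> 0" "l x - l i \<noteq> 0" "a - l x \<noteq> 0" using a(2) by auto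
    then have "(1 + t / (l i - l x)) * w / (a - l i) =
        w / (a - l i) + t / (a - l x) * (w / (a - l i) - w / (l x - l i))" for w
      by (simp add: divide_simps) (simp add: algebra_simps)
    then show "shift_weight t l (insert x I) i / (a - l i) = shift_weight t l I i / (a - l i) +
        t / (a - l x) * (shift_weight t l I i / (a - l i) - shift_weight t l I i / (l x - l i))"
      unfolding shift_weight_insert_other[OF insert.hyps i] .
  qed
  also have "\<dots> = S a + t / (a - l x) * (S a - S (l x))"
    by (simp only: S_def sum.distrib sum_distrib_left[symmetric] sum_subtractf)
  finally have "(\<Sum>i\<in>insert x I. shift_weight t l (insert x I) i / (a - l i)) =
      (1 + t * S (l x)) / (a - l x) + (S a + t / (a - l x) * (S a - S (l x)))"
    using insert.hyps by (simp add: shift_weight_insert_self IH[OF x])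
  moreover have "(\<Prod>i\<in>insert x I. 1 + t / (a - l i)) = (1 + t / (a - l x)) * (1 + t * S a)"
    using insert.hyps by (simp add: IH[OF a(1)])
  moreover have "(1 + t / (a - l x)) * (1 + t * S a) =
      1 + t * ((1 + t * S (l x)) / (a - l x) + (S a + t / (a - l x) * (S a - S (l x))))"
    by (simp add: algebra_simps add_divide_distrib diff_divide_distrib)
  ultimately show ?case by (simp only:)
qed simp

lemma sum_shift_weight:
  fixes l :: "'i \<Rightarrow> 'a::field"
  assumes "finite I" "inj_on l I"
  shows "(\<Sum>i\<in>I. shift_weight t l I i) = of_nat (card I)"
  using assms
proof (induction I rule: finite_induct)
  case (insert x I)
  define S where "S = (\<Sum>i\<in>I. shift_weight t l I i / (l x - l i))"
  have x: "l x \<notin> l ` I" "inj_on l I" using insert by auto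
  have "(\<Sum>i\<in>I. shift_weight t l (insert x I) i) =
      (\<Sum>i\<in>I. shift_weight t l I i - t * (shift_weight t l I i / (l x - l i)))"
  proof (rule sum.cong[OF refl])
    fix i assume i: "i \<in> I"
    then have "l i \<noteq> l x" using x(1) by (metis imageI)
    then have "l i - l x \<noteq> 0" "l x - l i \<noteq> 0" by auto
    then have "(1 + t / (l i - l x)) * w = w - t * (w / (l x - l i))" for w
      by (simp add: divide_simps) (simp add: algebra_simps)
    then show "shift_weight t l (insert x I) i =
        shift_weight t l I i - t * (shift_weight t l I i / (l x - l i))"
      unfolding shift_weight_insert_other[OF insert.hyps i] .
  qed
  also have "\<dots> = of_nat (card I) - t * S"
    using insert.IH[OF x(2)] by (simp add: S_def sum_subtractf sum_distrib_left)
  finally show ?case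
    using insert.hyps prod_eq_partial_fractions[OF insert.hyps(1) x(2,1)]
    by (simp add: shift_weight_insert_self S_def)
qed simp

lemma sum_mult_shift_weight:
  fixes l :: "'i \<Rightarrow> 'a::field_char_0"
  assumes "finite I" "inj_on l I"
  shows "(\<Sum>i\<in>I. l i * shift_weight t l I i) =
    (\<Sum>i\<in>I. l i) + t * (of_nat (card I) * (of_nat (card I) - 1) / 2)"
  using assms
proof (induction I rule: finite_induct)
  case (insert x I)
  define S where "S = (\<Sum>i\<in>I. shift_weight t l I i / (l x - l i))"
  have x: "l x \<notin> l ` I" "inj_on l I" using insert by auto
  have "(\<Sum>i\<in>I. l i * shift_weight t l (insert x I) i) = (\<Sum>i\<in>I. l i * shift_weight t l I i +
      t * shift_weight t l I i - l x * (t * (shift_weight t l I i / (l x - l i))))"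
  proof (rule sum.cong[OF refl])
    fix i assume i: "i \<in> I"
    then have "l i \<noteq> l x" using x(1) by (metis imageI)
    then have "l i - l x \<noteq> 0" "l x - l i \<noteq> 0" by auto
    then have "l i * ((1 + t / (l i - l x)) * w) =
        l i * w + t * w - l x * (t * (w / (l x - l i)))"
      for w
      by (simp add: divide_simps) (simp add: algebra_simps)
    then show "l i * shift_weight t l (insert x I) i = l i * shift_weight t l I i +
        t * shift_weight t l I i - l x * (t * (shift_weight t l I i / (l x - l i)))"
      unfolding shift_weight_insert_other[OF insert.hyps i] .
  qed
  also have "\<dots> = (\<Sum>i\<in>I. l i * shift_weight t l I i) + t * of_nat (card I) - l x * (t * S)"
    by (simp add: S_def sum_subtractf sum.distrib sum_distrib_left
        flip: sum_shift_weight[OF insert.hyps(1) x(2), of t])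
  finally show ?case
    using insert.hyps insert.IH[OF x(2)] prod_eq_partial_fractions[OF insert.hyps(1) x(2,1)]
    by (simp add: shift_weight_insert_self S_def field_simps)
qed simp

text \<open>At a point \<open>a\<close> with \<open>a + t\<close> among the \<open>l i\<close> the product in the partial fraction expansion
  vanishes.\<close>

lemma sum_shift_weight_divide:
  fixes l :: "'i \<Rightarrow> 'a::field"
  assumes "finite I" "inj_on l I" "a \<notin> l ` I" "a + t \<in> l ` I"
  shows "t * (\<Sum>i\<in>I. shift_weight t l I i / (l i - a)) = 1"
proof -
  obtain m where m: "m \<in> I" "l m = a + t" using assms(4) by auto
  then have "t \<noteq> 0" using assms(3) by auto
  then have "(\<Prod>i\<in>I. 1 + t / (a - l i)) = 0"
    using m assms(1) by (intro prod_zero bexI[of _ m]) auto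
  moreover have "(\<Sum>i\<in>I. shift_weight t l I i / (a - l i)) =
      - (\<Sum>i\<in>I. shift_weight t l I i / (l i - a))"
    unfolding sum_negf[symmetric] by (rule sum.cong) (simp_all add: minus_divide_right)
  ultimately show ?thesis
    using prod_eq_partial_fractions[OF assms(1-3), of t] by (simp add: eq_neg_iff_add_eq_0)
qed

lemma sum_shift_weight_divide_two:
  fixes l :: "'i \<Rightarrow> 'a::field"
  assumes "finite I" "inj_on l I" "t \<noteq> 0" and a: "a \<notin> l ` I" "a + t \<in> l ` I"
    and b: "b \<notin> l ` I" "b + t \<in> l ` I" and "a \<noteq> b"
  shows "(\<Sum>i\<in>I. shift_weight t l I i / ((l i - a) * (l i - b))) = 0"
proof -
  define S where "S z = (\<Sum>i\<in>I. shift_weight t l I i / (l i - z))" for z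
  have "(\<Sum>i\<in>I. shift_weight t l I i / ((l i - a) * (l i - b))) =
      (\<Sum>i\<in>I. (shift_weight t l I i / (l i - a) - shift_weight t l I i / (l i - b)) / (a - b))"
  proof (rule sum.cong[OF refl])
    fix i assume "i \<in> I"
    then have "l i - a \<noteq> 0" "l i - b \<noteq> 0" "a - b \<noteq> 0" using a(1) b(1) assms(8) by auto
    then have "w / ((l i - a) * (l i - b)) = (w / (l i - a) - w / (l i - b)) / (a - b)" for w
      by (simp add: divide_simps) (simp add: algebra_simps)
    then show "shift_weight t l I i / ((l i - a) * (l i - b)) =
        (shift_weight t l I i / (l i - a) - shift_weight t l I i / (l i - b)) / (a - b)" .
  qed
  also have "\<dots> = (S a - S b) / (a - b)"
    by (simp add: S_def sum_subtractf flip: sum_divide_distrib)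
  also have "S a = S b"
    using sum_shift_weight_divide[OF assms(1,2) a] sum_shift_weight_divide[OF assms(1,2) b] assms(3)
    by (metis S_def mult_left_cancel)
  finally show ?thesis by simp
qed

lemma vandermonde_cong: "(\<And>i. i < k \<Longrightarrow> l i = l' i) \<Longrightarrow> vandermonde k l = vandermonde k l'"
  by (simp add: vandermonde_def)

lemma vandermonde_shift:
  fixes l :: "nat \<Rightarrow> 'a::field"
  assumes "inj_on l {..<k}" "x < k"
  shows "vandermonde k (l(x := l x + t)) = vandermonde k l * shift_weight t l {..<k} x"
  using assms
proof (induction k)
  case (Suc k)
  let ?l' = "l(x := l x + t)"
  have inj: "inj_on l {..<k}" using Suc.prems(1) by (simp add: lessThan_Suc)
  have distinct: "l i \<noteq> l k" if "i < k" for i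
    using Suc.prems(1) that by (auto simp: inj_on_def)
  have split: "vandermonde (Suc k) m = vandermonde k m * (\<Prod>i<k. m i - m k)" for m :: "nat \<Rightarrow> 'a"
    by (simp add: vandermonde_def)
  show ?case
  proof (cases "x = k")
    case True
    have "(\<Prod>i<k. ?l' i - ?l' k) = (\<Prod>i<k. (l i - l k) * (1 + t / (l k - l i)))"
      using distinct True by (intro prod.cong) (auto simp: divide_simps, auto simp: algebra_simps)
    moreover have "vandermonde k ?l' = vandermonde k l" using True by (intro vandermonde_cong) simp
    ultimately show ?thesis
      by (simp add: split lessThan_Suc shift_weight_insert_self True prod.distrib
          del: fun_upd_apply)
  next
    case False
    then have x: "x < k" using Suc.prems(2) by simp
    have "(\<Prod>i<k. ?l' i - ?l' k) = (l x + t - l k) * (\<Prod>i\<in>{..<k} - {x}. l i - l k)"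
      by (subst prod.remove[of _ x]) (use x in auto)
    also have "l x + t - l k = (1 + t / (l x - l k)) * (l x - l k)"
      using distinct[OF x] by (simp add: divide_simps)
    also have "(1 + t / (l x - l k)) * (l x - l k) * (\<Prod>i\<in>{..<k} - {x}. l i - l k) =
        (1 + t / (l x - l k)) * (\<Prod>i<k. l i - l k)"
      by (subst prod.remove[of "{..<k}" x]) (use x in auto)
    finally show ?thesis
      using Suc.IH[OF inj x] x
      by (simp add: split lessThan_Suc shift_weight_insert_other)
  qed
qed simp

section \<open>The Frobenius formula and Kerov's equations\<close>

definition beta :: "nat \<Rightarrow> (nat \<Rightarrow> nat) \<Rightarrow> nat \<Rightarrow> nat" where
  "beta k r i = r i + (k - 1 - i)"

definition beta_weight :: "real \<Rightarrow> nat \<Rightarrow> (nat \<Rightarrow> nat) \<Rightarrow> nat \<Rightarrow> real" where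
  "beta_weight t k r = shift_weight t (\<lambda>i. real (beta k r i)) {..<k}"

definition frobenius_quotient :: "nat \<Rightarrow> (nat \<Rightarrow> nat) \<Rightarrow> real" where
  "frobenius_quotient k r = vandermonde k (\<lambda>i. real (beta k r i)) / (\<Prod>i<k. fact (beta k r i))"

lemma beta_less: "young_rows k r \<Longrightarrow> i < j \<Longrightarrow> j < k \<Longrightarrow> beta k r j < beta k r i"
  using young_rows_le[of k r i j] by (auto simp: beta_def)

lemma inj_on_beta: "young_rows k r \<Longrightarrow> inj_on (\<lambda>i. real (beta k r i)) {..<k}"
  by (rule linorder_inj_onI) (use beta_less[of k r] in force)+

lemma frobenius_quotient_empty: "frobenius_quotient k (\<lambda>_. 0) = 1"
proof -
  have "vandermonde k (\<lambda>i. real (beta k (\<lambda>_. 0) i)) = (\<Prod>j<k. \<Prod>i<j. real (j - i))"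
    unfolding vandermonde_def beta_def by (intro prod.cong refl) (auto simp: of_nat_diff)
  also have "\<dots> = (\<Prod>j<k. fact j)"
    by (simp add: fact_prod_rev atLeast0LessThan)
  also have "\<dots> = (\<Prod>i<k. fact (beta k (\<lambda>_. 0) i))"
    using prod.nat_diff_reindex[of "fact :: nat \<Rightarrow> real" k] by (simp add: beta_def)
  finally show ?thesis by (simp add: frobenius_quotient_def)
qed

lemma frobenius_quotient_shift:
  assumes r: "young_rows k r" and i: "i < k"
    and t: "real (beta k (r(i := v)) i) = real (beta k r i) + t"
  shows "frobenius_quotient k (r(i := v)) * fact (beta k (r(i := v)) i) =
    frobenius_quotient k r * fact (beta k r i) * beta_weight t k r i"
proof -
  define F :: real where "F = (\<Prod>j\<in>{..<k} - {i}. fact (beta k r j))"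
  have fact_split: "(\<Prod>j<k. fact (beta k (r(i := u)) j)) = fact (beta k (r(i := u)) i) * F" for u
    unfolding F_def by (subst prod.remove[of _ i]) (use i in \<open>auto simp: beta_def\<close>)
  have "(\<lambda>j. real (beta k (r(i := v)) j)) = (\<lambda>j. real (beta k r j))(i := real (beta k r i) + t)"
    using t by (auto simp: beta_def fun_eq_iff)
  then have "vandermonde k (\<lambda>j. real (beta k (r(i := v)) j)) =
      vandermonde k (\<lambda>j. real (beta k r j)) * beta_weight t k r i"
    using vandermonde_shift[OF inj_on_beta[OF r] i] by (simp add: beta_weight_def)
  then show ?thesis
    unfolding frobenius_quotient_def using fact_split[of v] fact_split[of "r i"] by simp
qed

lemma frobenius_quotient_remove:
  assumes r: "young_rows k r" and i: "i < k" "r i > 0"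
  shows "frobenius_quotient k (r(i := r i - 1)) =
    frobenius_quotient k r * (real (beta k r i) * beta_weight (- 1) k r i)"
proof -
  have "beta k r i = Suc (beta k (r(i := r i - 1)) i)" using i(2) by (simp add: beta_def)
  then show ?thesis
    using frobenius_quotient_shift[OF r i(1), of "r i - 1" "- 1"] by (simp add: mult_ac)
qed

lemma frobenius_quotient_add:
  assumes r: "young_rows k r" and i: "i < k"
  shows "frobenius_quotient k (r(i := Suc (r i))) =
    frobenius_quotient k r * (beta_weight 1 k r i / (real (beta k r i) + 1))"
proof -
  have beta: "beta k (r(i := Suc (r i))) i = Suc (beta k r i)" by (simp add: beta_def)
  have "fact (beta k r i) * (frobenius_quotient k (r(i := Suc (r i))) * (real (beta k r i) + 1)) =
      fact (beta k r i) * (frobenius_quotient k r * beta_weight 1 k r i)"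
    using frobenius_quotient_shift[OF r i, of "Suc (r i)" 1] beta by (simp add: algebra_simps)
  then have "frobenius_quotient k (r(i := Suc (r i))) * (real (beta k r i) + 1) =
      frobenius_quotient k r * beta_weight 1 k r i"
    by simp
  moreover have "real (beta k r i) + 1 \<noteq> 0" by simp
  ultimately show ?thesis by (simp add: eq_divide_eq)
qed

lemma beta_weight_not_removable:
  assumes r: "young_rows k r" and i: "i < k" "i \<notin> removable r"
  shows "real (beta k r i) * beta_weight (- 1) k r i = 0"
proof (cases "Suc i < k")
  case True
  have "r (Suc i) = r i" using i(2) young_rows_le[OF r, of i "Suc i"] by (simp add: removable_def)
  then have "beta_weight (- 1) k r i = 0"
    unfolding beta_weight_def using True
    by (intro shift_weight_eq_0[of _ "Suc i"]) (auto simp: beta_def)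
  then show ?thesis by simp
next
  case False
  then show ?thesis using i young_rows_zero[OF r, of "Suc i"] by (simp add: removable_def beta_def)
qed

lemma beta_weight_not_addable:
  assumes r: "young_rows k r" and i: "i < k" "i \<notin> addable r"
  shows "beta_weight 1 k r i = 0"
proof -
  have "i > 0" "r i = r (i - 1)"
    using i(2) young_rows_le[OF r, of "i - 1" i] by (auto simp: addable_def)
  then show ?thesis
    unfolding beta_weight_def using i(1)
    by (intro shift_weight_eq_0[of _ "i - 1"]) (auto simp: beta_def of_nat_diff)
qed

lemma sum_removable_beta_weight:
  assumes r: "young_rows k r"
  shows "(\<Sum>i\<in>removable r. real (beta k r i) * beta_weight (- 1) k r i) = real (card (diagram r))"
proof -
  have "(\<Sum>i\<in>removable r. real (beta k r i) * beta_weight (- 1) k r i) =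
      (\<Sum>i<k. real (beta k r i) * beta_weight (- 1) k r i)"
    using removable_less[OF r] beta_weight_not_removable[OF r] by (intro sum.mono_neutral_left) auto
  also have "\<dots> = (\<Sum>i<k. real (beta k r i)) - real k * (real k - 1) / 2"
    using sum_mult_shift_weight[OF _ inj_on_beta[OF r], of "- 1"] by (simp add: beta_weight_def)
  also have "(\<Sum>i<k. real (beta k r i)) = real (card (diagram r)) + real (\<Sum>i<k. k - 1 - i)"
    by (simp only: beta_def sum.distrib card_diagram[OF r] of_nat_add of_nat_sum)
  also have "(\<Sum>i<k. k - 1 - i) = (\<Sum>i<k. i)"
    using sum.nat_diff_reindex[of "\<lambda>i. i" k] by simp
  also have "real (\<Sum>i<k. i) = real k * (real k - 1) / 2"
    by (induction k) (auto simp: field_simps)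
  finally show ?thesis by simp
qed

theorem frobenius_formula:
  assumes "young_rows k r"
  shows "real (card (Syt (diagram r))) = fact (card (diagram r)) * frobenius_quotient k r"
  using assms
proof (induction "card (diagram r)" arbitrary: r)
  case 0
  then have "diagram r = {}" using young_shape_finite[OF young_shape_diagram] by simp
  then have "r = (\<lambda>_. 0)" by (auto simp: diagram_def)
  moreover have "Syt {} = {\<lambda>_. 0}" by (auto simp: Syt_def bij_betw_def fun_eq_iff)
  ultimately show ?case using \<open>diagram r = {}\<close> by (simp add: frobenius_quotient_empty)
next
  case (Suc n)
  note r = Suc.prems
  have finite: "finite (diagram r)" by (rule young_shape_finite[OF young_shape_diagram[OF r]])
  have step: "real (card (Syt (diagram r - {(i, r i - 1)}))) =
      fact n * frobenius_quotient k r * (real (beta k r i) * beta_weight (- 1) k r i)"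
    if i: "i \<in> removable r" for i
  proof -
    have "r i > 0" using i by (auto simp: removable_def)
    then have "card (diagram r - {(i, r i - 1)}) = n"
      using Suc.hyps(2) finite by simp
    then show ?thesis
      using Suc.hyps(1)[of "r(i := r i - 1)"] young_rows_remove[OF r i]
        frobenius_quotient_remove[OF r removable_less[OF r i] \<open>r i > 0\<close>]
      by (simp only: diagram_remove mult_ac)
  qed
  have "real (card (Syt (diagram r))) =
      (\<Sum>i\<in>removable r. real (card (Syt (diagram r - {(i, r i - 1)}))))"
    using Suc.hyps(2) unfolding of_nat_sum[symmetric] corners_diagram[OF r, symmetric]
    by (subst card_Syt_branch[OF young_shape_diagram[OF r]])
      (auto simp: corners_diagram[OF r] sum.reindex inj_on_def)
  also have "\<dots> = fact n * frobenius_quotient k r *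
      (\<Sum>i\<in>removable r. real (beta k r i) * beta_weight (- 1) k r i)"
    unfolding sum_distrib_left by (rule sum.cong[OF refl step])
  also have "\<dots> = fact n * frobenius_quotient k r * real (Suc n)"
    by (simp only: sum_removable_beta_weight[OF r] Suc.hyps(2))
  finally show ?case unfolding Suc.hyps(2)[symmetric] by (simp add: mult_ac)
qed

lemma card_Syt_add:
  assumes r: "young_rows k r" and i: "i \<in> addable r" "i < k"
  shows "real (card (Syt (diagram (r(i := Suc (r i)))))) =
    fact (Suc (card (diagram r))) * frobenius_quotient k r *
      (beta_weight 1 k r i / (real (beta k r i) + 1))"
proof -
  have "card (diagram (r(i := Suc (r i)))) = Suc (card (diagram r))"
    using young_shape_finite[OF young_shape_diagram[OF r]] by (simp add: diagram_add)
  then show ?thesis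
    using frobenius_formula[OF young_rows_add[OF r i]] frobenius_quotient_add[OF r i(2)] by simp
qed

lemma beta_removable_neq_Suc:
  assumes r: "young_rows k r" and d: "d \<in> removable r" and i: "i < k"
  shows "beta k r d \<noteq> Suc (beta k r i)"
proof
  assume eq: "beta k r d = Suc (beta k r i)"
  then have "d \<noteq> i" "\<not> i < d" using beta_less[OF r, of i d] removable_less[OF r d] by auto
  then have "d < i" by simp
  then show False
    using eq young_rows_le[OF r, of "Suc d" i] d i by (auto simp: beta_def removable_def)
qed

text \<open>With one empty row included, both \<open>-1\<close> and \<open>b d - 1\<close> are one less than a beta number without
  being beta numbers.\<close>

theorem kerov_equation:
  assumes "young_rows k r" and d: "d \<in> removable r"
  shows "(\<Sum>i\<in>addable r. real (card (Syt (diagram (r(i := Suc (r i)))))) /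
    ((real (r i) - real i) - (real (r d) - 1 - real d))) = 0"
proof -
  let ?k = "Suc k"
  define b where "b i = real (beta ?k r i)" for i
  define W where "W = beta_weight 1 ?k r"
  define K where "K = fact (Suc (card (diagram r))) * frobenius_quotient ?k r"
  have r: "young_rows ?k r" using assms(1) by (simp add: young_rows_def)
  have d_less: "d < k" by (rule removable_less[OF assms])
  have addable_less: "i < ?k" if "i \<in> addable r" for i
    using addable_le[OF assms(1) that] by simp
  have "(\<Sum>i\<in>addable r. real (card (Syt (diagram (r(i := Suc (r i)))))) /
        ((real (r i) - real i) - (real (r d) - 1 - real d))) =
      (\<Sum>i\<in>addable r. K * (W i / ((b i - (- 1)) * (b i - (b d - 1)))))"
  proof (rule sum.cong[OF refl])
    fix i assume i: "i \<in> addable r"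
    have "(real (r i) - real i) - (real (r d) - 1 - real d) = b i - (b d - 1)"
      using d_less addable_less[OF i] by (simp add: b_def beta_def of_nat_diff)
    then show "real (card (Syt (diagram (r(i := Suc (r i)))))) /
        ((real (r i) - real i) - (real (r d) - 1 - real d)) =
        K * (W i / ((b i - (- 1)) * (b i - (b d - 1))))"
      using card_Syt_add[OF r i addable_less[OF i]] by (simp add: K_def W_def b_def)
  qed
  also have "\<dots> = K * (\<Sum>i<?k. W i / ((b i - (- 1)) * (b i - (b d - 1))))"
    unfolding sum_distrib_left using addable_less beta_weight_not_addable[OF r]
    by (intro sum.mono_neutral_left) (auto simp: W_def)
  also have "(\<Sum>i<?k. W i / ((b i - (- 1)) * (b i - (b d - 1)))) = 0"
    unfolding W_def beta_weight_def b_def[symmetric]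
  proof (rule sum_shift_weight_divide_two)
    show "inj_on b {..<?k}" unfolding b_def by (rule inj_on_beta[OF r])
    have "b k = 0" using young_rows_zero[OF assms(1), of k] by (simp add: b_def beta_def)
    then show "- 1 + 1 \<in> b ` {..<?k}" by (auto intro!: image_eqI[of _ _ k])
    show "b d - 1 + 1 \<in> b ` {..<?k}" using d_less by simp
    show "- 1 \<notin> b ` {..<?k}" by (auto simp: b_def)
    show "b d - 1 \<notin> b ` {..<?k}"
      using beta_removable_neq_Suc[OF r d] by (force simp: b_def)
    show "- 1 \<noteq> b d - 1" using d by (auto simp: b_def beta_def removable_def)
  qed simp_all
  finally show ?thesis by (simp only: mult_zero_right)
qed

section \<open>Sums of simple poles of constant modulus\<close>

definition pole_sum :: "('a::field \<Rightarrow> 'a) \<Rightarrow> 'a set \<Rightarrow> 'a \<Rightarrow> 'a" where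
  "pole_sum w M z = (\<Sum>p\<in>M. w p / (p - z))"

definition isoclinic_poles :: "('a::field \<Rightarrow> 'a) \<Rightarrow> 'a set \<Rightarrow> 'a set \<Rightarrow> bool" where
  "isoclinic_poles w P Z \<longleftrightarrow> (\<exists>M. M \<noteq> {} \<and> M \<subset> P \<and> (\<exists>\<alpha>. \<forall>z\<in>Z. (pole_sum w M z)\<^sup>2 = \<alpha>))"

lemma pole_sum_strict_mono:
  fixes w :: "'a::linordered_field \<Rightarrow> 'a"
  assumes "finite M" "M \<noteq> {}" "\<And>p. p \<in> M \<Longrightarrow> w p > 0" "u < v" "M \<inter> {u..v} = {}"
  shows "pole_sum w M u < pole_sum w M v"
  unfolding pole_sum_def
proof (rule sum_strict_mono[OF assms(1,2)])
  fix p assume p: "p \<in> M"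
  then have "p < u \<or> v < p" using assms(5) by fastforce
  then have nonzero: "p - u \<noteq> 0" "p - v \<noteq> 0" using assms(4) by auto
  have "(p - u) * (p - v) > 0"
    using \<open>p < u \<or> v < p\<close> assms(4) by (auto intro: mult_pos_pos mult_neg_neg)
  then have "w p * (v - u) / ((p - u) * (p - v)) > 0" using assms(3)[OF p] assms(4) by simp
  moreover have "w p / (p - v) - w p / (p - u) = w p * (v - u) / ((p - u) * (p - v))"
    using nonzero by (simp add: divide_simps) (simp add: algebra_simps)
  ultimately show "w p / (p - u) < w p / (p - v)" by linarith
qed

lemma isoclinic_poles_image:
  assumes inj: "inj_on g I"
  shows "isoclinic_poles w (g ` I) Z \<longleftrightarrow>
    (\<exists>L. L \<noteq> {} \<and> L \<subset> I \<and> (\<exists>\<alpha>. \<forall>z\<in>Z. (pole_sum w (g ` L) z)\<^sup>2 = \<alpha>))"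
  unfolding isoclinic_poles_def
proof
  assume "\<exists>M. M \<noteq> {} \<and> M \<subset> g ` I \<and> (\<exists>\<alpha>. \<forall>z\<in>Z. (pole_sum w M z)\<^sup>2 = \<alpha>)"
  then obtain M where M: "M \<noteq> {}" "M \<subset> g ` I" "\<exists>\<alpha>. \<forall>z\<in>Z. (pole_sum w M z)\<^sup>2 = \<alpha>" by blast
  then obtain L where "L \<subseteq> I" "M = g ` L" by (meson psubset_imp_subset subset_imageE)
  then show "\<exists>L. L \<noteq> {} \<and> L \<subset> I \<and> (\<exists>\<alpha>. \<forall>z\<in>Z. (pole_sum w (g ` L) z)\<^sup>2 = \<alpha>)"
    using M by blast
next
  assume "\<exists>L. L \<noteq> {} \<and> L \<subset> I \<and> (\<exists>\<alpha>. \<forall>z\<in>Z. (pole_sum w (g ` L) z)\<^sup>2 = \<alpha>)"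
  then show "\<exists>M. M \<noteq> {} \<and> M \<subset> g ` I \<and> (\<exists>\<alpha>. \<forall>z\<in>Z. (pole_sum w M z)\<^sup>2 = \<alpha>)"
    using image_strict_mono[OF inj] by (metis image_is_empty)
qed

locale symmetric_poles =
  fixes X x Y y :: "'a::linordered_field" and w :: "'a \<Rightarrow> 'a" and P Z :: "'a set"
  assumes interlacing: "0 < y" "y < x" "x < Y" "Y < X"
    and P_def: "P = {X, x, 0, -x, -X}" and Z_def: "Z = {Y, y, -y, -Y}"
    and w_pos: "\<And>p. p \<in> P \<Longrightarrow> w p > 0"
    and total_zero: "\<And>z. z \<in> Z \<Longrightarrow> pole_sum w P z = 0"
begin

lemma pole_sum_P:
  "pole_sum w P z = w X / (X - z) + w x / (x - z) + w 0 / (0 - z) +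
    w (-x) / (-x - z) + w (-X) / (-X - z)"
  using interlacing by (simp add: pole_sum_def P_def)

lemma pole_sum_complement:
  assumes "M \<subseteq> P" "z \<in> Z"
  shows "pole_sum w (P - M) z = - pole_sum w M z"
  using total_zero[OF assms(2)] sum_diff[of P M "\<lambda>p. w p / (p - z)"] assms(1)
  by (simp add: pole_sum_def P_def)

text \<open>The even part of the total sum is \<open>\<Sum> 2 p (w p - w (-p)) / (p\<^sup>2 - z\<^sup>2)\<close> over \<open>p \<in> {X, x}\<close>.\<close>

lemma w_inner_symmetric: "w (-x) = w x"
proof -
  define A B where "A = X * (w X - w (-X))" and "B = x * (w x - w (-x))"
  have even_part: "A * (x\<^sup>2 - z\<^sup>2) + B * (X\<^sup>2 - z\<^sup>2) = 0" if z: "z \<in> {y, Y}" for z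
  proof -
    have nonzero: "X\<^sup>2 - z\<^sup>2 \<noteq> 0" "x\<^sup>2 - z\<^sup>2 \<noteq> 0"
      using z interlacing by (auto simp: power2_eq_iff)
    have pair: "w p / (p - z) + w (-p) / (-p - z) + (w p / (p - -z) + w (-p) / (-p - -z)) =
        2 * (p * (w p - w (-p))) / (p\<^sup>2 - z\<^sup>2)" if "p\<^sup>2 - z\<^sup>2 \<noteq> 0" for p
    proof -
      have "w (-p) / (-p - z) = - (w (-p) / (p + z))" "w (-p) / (-p - -z) = - (w (-p) / (p - z))"
        by (simp_all add: minus_divide_right)
      moreover have "p - z \<noteq> 0" "p + z \<noteq> 0" using that by (auto simp: power2_eq_iff)
      ultimately show ?thesis
        by (simp add: square_diff_square_factored power2_eq_square divide_simps)
          (simp add: algebra_simps)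
    qed
    have "0 = pole_sum w P z + pole_sum w P (-z)"
      using z total_zero by (auto simp: Z_def)
    also have "\<dots> = 2 * A / (X\<^sup>2 - z\<^sup>2) + 2 * B / (x\<^sup>2 - z\<^sup>2)"
      unfolding pole_sum_P A_def B_def pair[OF nonzero(1), symmetric] pair[OF nonzero(2), symmetric]
      by simp
    also have "\<dots> = 2 * (A * (x\<^sup>2 - z\<^sup>2) + B * (X\<^sup>2 - z\<^sup>2)) / ((X\<^sup>2 - z\<^sup>2) * (x\<^sup>2 - z\<^sup>2))"
      using nonzero by (simp add: add_frac_eq algebra_simps)
    finally show ?thesis using nonzero by simp
  qed
  have "(A + B) * (Y\<^sup>2 - y\<^sup>2) = 0"
    using even_part[of y] even_part[of Y] by (simp add: algebra_simps)
  then have "A = - B" using interlacing by (simp add: power2_eq_iff)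
  then have "B * (X\<^sup>2 - x\<^sup>2) = 0" using even_part[of y] by (simp add: algebra_simps)
  then have "B = 0" using interlacing by (simp add: power2_eq_iff)
  then show ?thesis using interlacing by (simp add: B_def)
qed

lemma inner_pair_iff: "(\<exists>\<alpha>. \<forall>z\<in>Z. (pole_sum w {x, -x} z)\<^sup>2 = \<alpha>) \<longleftrightarrow> x\<^sup>2 = y * Y"
proof -
  define g where "g z = z / (x\<^sup>2 - z\<^sup>2)" for z
  have ne: "x - z \<noteq> 0" "x + z \<noteq> 0" if "z \<in> Z" for z
    using that interlacing by (auto simp: Z_def)
  have square: "(pole_sum w {x, -x} z)\<^sup>2 = (2 * w x)\<^sup>2 * (g z)\<^sup>2" if "z \<in> Z" for z
  proof -
    have "w x / (-x - z) = - (w x / (x + z))" by (simp add: minus_divide_right)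
    then have "pole_sum w {x, -x} z = w x / (x - z) - w x / (x + z)"
      using interlacing by (simp add: pole_sum_def w_inner_symmetric)
    also have "\<dots> = 2 * w x * g z"
      using ne[OF that]
      by (simp add: g_def square_diff_square_factored power2_eq_square divide_simps)
        (simp add: algebra_simps)
    finally show ?thesis by (simp add: power_mult_distrib)
  qed
  have "w x > 0" by (rule w_pos) (simp add: P_def)
  then have "(\<exists>\<alpha>. \<forall>z\<in>Z. (pole_sum w {x, -x} z)\<^sup>2 = \<alpha>) \<longleftrightarrow> (g y)\<^sup>2 = (g Y)\<^sup>2"
    using square by (auto simp: Z_def g_def)
  also have "\<dots> \<longleftrightarrow> g y = - g Y"
  proof -
    have "y\<^sup>2 < x\<^sup>2" "x\<^sup>2 < Y\<^sup>2" using interlacing by (auto intro: power_strict_mono)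
    then have "g y > 0" "g Y < 0"
      unfolding g_def using interlacing by (auto intro: divide_pos_neg)
    then show ?thesis by (auto simp: power2_eq_iff)
  qed
  also have "\<dots> \<longleftrightarrow> y * (x\<^sup>2 - Y\<^sup>2) = (- Y) * (x\<^sup>2 - y\<^sup>2)"
  proof -
    have "x\<^sup>2 - y\<^sup>2 \<noteq> 0" "x\<^sup>2 - Y\<^sup>2 \<noteq> 0"
      using interlacing by (auto simp: power2_eq_iff)
    then show ?thesis unfolding g_def minus_divide_left by (rule frac_eq_eq)
  qed
  also have "\<dots> \<longleftrightarrow> (Y + y) * (x\<^sup>2 - y * Y) = 0"
    by (simp add: algebra_simps power2_eq_square)
  also have "\<dots> \<longleftrightarrow> x\<^sup>2 = y * Y" using interlacing by auto
  finally show ?thesis .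
qed

text \<open>A sum of poles increases between its poles, so its values at \<open>\<plusminus>y\<close> are opposite unless \<open>0\<close> is
  a pole, and a missing pole \<open>x\<close> or \<open>-x\<close> makes the modulus at \<open>Y\<close> or \<open>-Y\<close> too large. The outer
  poles are excluded by passing to the complement.\<close>

context
  fixes M :: "'a set" and \<alpha> :: 'a
  assumes M: "M \<subseteq> P" "M \<noteq> {}" "0 \<notin> M"
    and modulus: "\<And>z. z \<in> Z \<Longrightarrow> (pole_sum w M z)\<^sup>2 = \<alpha>"
begin

lemma pole_sum_less:
  assumes "u < v" "M \<inter> {u..v} = {}"
  shows "pole_sum w M u < pole_sum w M v"
  by (rule pole_sum_strict_mono) (use assms M w_pos finite_subset[OF M(1)] in \<open>auto simp: P_def\<close>)

lemma pole_sum_opposite: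
  shows "pole_sum w M (-y) = - pole_sum w M y" and "pole_sum w M y > 0"
proof -
  have "pole_sum w M (-y) < pole_sum w M y"
    by (rule pole_sum_less) (use M interlacing in \<open>auto simp: P_def\<close>)
  moreover have "(pole_sum w M (-y))\<^sup>2 = (pole_sum w M y)\<^sup>2"
    using modulus by (simp add: Z_def)
  ultimately show "pole_sum w M (-y) = - pole_sum w M y" "pole_sum w M y > 0"
    by (auto simp: power2_eq_iff)
qed

lemma abs_pole_sum: "z \<in> Z \<Longrightarrow> \<bar>pole_sum w M z\<bar> = pole_sum w M y"
  using modulus[of z] modulus[of y] pole_sum_opposite(2)
    power2_eq_iff[of "pole_sum w M z" "pole_sum w M y"] by (auto simp: Z_def)

lemma inner_poles_mem: "x \<in> M" "-x \<in> M"
proof -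
  show "x \<in> M"
  proof (rule ccontr)
    assume "x \<notin> M"
    then have "pole_sum w M y < pole_sum w M Y"
      by (intro pole_sum_less) (use M interlacing in \<open>auto simp: P_def\<close>)
    then show False using abs_pole_sum[of Y] pole_sum_opposite by (simp add: Z_def)
  qed
  show "-x \<in> M"
  proof (rule ccontr)
    assume "-x \<notin> M"
    then have "pole_sum w M (-Y) < pole_sum w M (-y)"
      by (intro pole_sum_less) (use M interlacing in \<open>auto simp: P_def\<close>)
    then show False using abs_pole_sum[of "-Y"] pole_sum_opposite by (simp add: Z_def)
  qed
qed

lemma outer_poles_not_mem: "M \<inter> {X, -X} = {}"
proof -
  define N where "N = {X, -X} - M"
  have "P - M = insert 0 N" "0 \<notin> N"
    using M inner_poles_mem interlacing by (auto simp: P_def N_def)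
  then have N_sum: "pole_sum w N z = w 0 / z - pole_sum w M z" if "z \<in> Z" for z
    using pole_sum_complement[OF M(1) that] by (simp add: N_def pole_sum_def)
  then have odd: "pole_sum w N y + pole_sum w N (-y) = 0"
    by (simp add: Z_def pole_sum_opposite(1))
  have w: "w X > 0" "w (-X) > 0" "w 0 > 0" by (rule w_pos; simp add: P_def)+
  have recip: "1 / (X - y) + 1 / (X + y) > 0" using interlacing by (simp add: add_pos_pos)
  consider (none) "N = {}" | (right) "N = {X}" | (left) "N = {-X}" | (both) "N = {X, -X}"
    by (auto simp: N_def)
  then show ?thesis
  proof cases
    case none
    then have "w 0 / Y = pole_sum w M Y" "w 0 / y = pole_sum w M y"
      using N_sum[of Y] N_sum[of y] by (simp_all add: pole_sum_def Z_def)
    then have "w 0 / Y = w 0 / y"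
      using abs_pole_sum[of Y] w(3) interlacing
      by (simp add: Z_def flip: \<open>w 0 / Y = pole_sum w M Y\<close>)
    then show ?thesis using interlacing w(3) by (simp add: field_simps)
  next
    case right
    then have "pole_sum w N y + pole_sum w N (-y) = w X * (1 / (X - y) + 1 / (X + y))"
      by (simp add: pole_sum_def distrib_left)
    then show ?thesis using odd mult_pos_pos[OF w(1) recip] by linarith
  next
    case left
    have "w (-X) / (-X - y) = - (w (-X) / (X + y))" "w (-X) / (-X + y) = - (w (-X) / (X - y))"
      by (simp_all add: minus_divide_right)
    then have "pole_sum w N y + pole_sum w N (-y) = - (w (-X) * (1 / (X - y) + 1 / (X + y)))"
      using left by (simp add: pole_sum_def distrib_left)
    then show ?thesis using odd mult_pos_pos[OF w(2) recip] by linarith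
  qed (auto simp: N_def)
qed

lemma only_inner_pair: "M = {x, -x}"
  using M inner_poles_mem outer_poles_not_mem by (auto simp: P_def)

end

theorem isoclinic_poles_iff: "isoclinic_poles w P Z \<longleftrightarrow> x\<^sup>2 = y * Y"
proof
  assume "isoclinic_poles w P Z"
  then obtain M \<alpha> where M: "M \<noteq> {}" "M \<subset> P" and modulus: "\<forall>z\<in>Z. (pole_sum w M z)\<^sup>2 = \<alpha>"
    unfolding isoclinic_poles_def by blast
  define N where "N = (if 0 \<in> M then P - M else M)"
  have "\<forall>z\<in>Z. (pole_sum w N z)\<^sup>2 = \<alpha>"
    using modulus pole_sum_complement[OF psubset_imp_subset[OF M(2)]] by (simp add: N_def)
  moreover have "N \<subseteq> P" "N \<noteq> {}" "0 \<notin> N" using M by (auto simp: N_def)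
  ultimately have "\<forall>z\<in>Z. (pole_sum w {x, -x} z)\<^sup>2 = \<alpha>" using only_inner_pair by metis
  then show "x\<^sup>2 = y * Y" using inner_pair_iff by blast
next
  assume "x\<^sup>2 = y * Y"
  moreover have "0 \<in> P - {x, -x}" "{x, -x} \<subseteq> P" using interlacing by (auto simp: P_def)
  ultimately show "isoclinic_poles w P Z"
    using inner_pair_iff unfolding isoclinic_poles_def by (intro exI[of _ "{x, -x}"]) blast
qed

end

section \<open>The isoclinic criterion\<close>

context integer_partition
begin

definition added_content :: "nat list \<Rightarrow> real" where
  "added_content nu = real_of_int (box_content (added_box lam nu))"

definition addable_contents :: "real set" where
  "addable_contents = added_content ` up lam"

definition corner_contents :: "real set" where
  "corner_contents = (\<lambda>q. real_of_int (box_content q)) ` corners (boxes lam)"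

definition dim_at :: "real \<Rightarrow> real" where
  "dim_at c = real (dim (inv_into (up lam) added_content c))"

lemma added_content_add_box:
  "i \<in> addable (row lam) \<Longrightarrow> added_content (add_box lam i) = real (row lam i) - real i"
  by (simp add: added_content_def added_box_add_box box_content_def)

lemma addable_contents_eq: "addable_contents = (\<lambda>i. real (row lam i) - real i) ` addable (row lam)"
  by (simp add: addable_contents_def up_eq_add_box image_image added_content_add_box
      cong: image_cong)

lemma corner_contents_eq:
  "corner_contents = (\<lambda>i. real (row lam i) - 1 - real i) ` removable (row lam)"
  unfolding corner_contents_def boxes_eq_diagram corners_diagram[OF rows] image_image
  by (intro image_cong refl) (auto simp: box_content_def removable_def of_nat_diff)

lemma inj_on_added_content: "inj_on added_content (up lam)"
proof -
  have "inj_on (\<lambda>i. real (row lam i) - real i) (addable (row lam))"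
  proof (rule linorder_inj_onI)
    fix i j :: nat assume "i < j"
    then have "row lam j \<le> row lam i" using young_rows_le[OF rows] by simp
    then show "real (row lam i) - real i \<noteq> real (row lam j) - real j" using \<open>i < j\<close> by linarith
  qed auto
  then have "inj_on (added_content \<circ> add_box lam) (addable (row lam))"
    by (simp add: inj_on_def added_content_add_box)
  then show ?thesis unfolding up_eq_add_box by (rule inj_on_imageI)
qed

lemma dim_at_added_content: "nu \<in> up lam \<Longrightarrow> dim_at (added_content nu) = real (dim nu)"
  by (simp add: dim_at_def inv_into_f_f[OF inj_on_added_content])

lemma pole_sum_added_content:
  assumes "L \<subseteq> up lam"
  shows "pole_sum dim_at (added_content ` L) z = (\<Sum>nu\<in>L. real (dim nu) / (added_content nu - z))"
  unfolding pole_sum_def sum.reindex[OF inj_on_subset[OF inj_on_added_content assms]]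
  using assms by (intro sum.cong) (auto simp: dim_at_added_content)

lemma dim_at_pos:
  assumes "c \<in> addable_contents"
  shows "dim_at c > 0"
proof -
  obtain nu where "nu \<in> up lam" "c = added_content nu"
    using assms by (auto simp: addable_contents_def)
  then show ?thesis
    using integer_partition.dim_pos[OF integer_partition_up] by (simp add: dim_at_added_content)
qed

lemma pole_sum_dim_at_eq_0:
  assumes "z \<in> corner_contents"
  shows "pole_sum dim_at addable_contents z = 0"
proof -
  obtain d where d: "d \<in> removable (row lam)" "z = real (row lam d) - 1 - real d"
    using assms by (auto simp: corner_contents_eq)
  have "pole_sum dim_at addable_contents z = (\<Sum>nu\<in>up lam. real (dim nu) / (added_content nu - z))"
    unfolding addable_contents_def by (rule pole_sum_added_content[OF order_refl])
  also have "\<dots> =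
      (\<Sum>i\<in>addable (row lam). real (dim (add_box lam i)) / (added_content (add_box lam i) - z))"
    by (simp only: up_eq_add_box sum.reindex[OF inj_on_add_box] comp_def)
  also have "\<dots> = (\<Sum>i\<in>addable (row lam).
      real (card (Syt (diagram ((row lam)(i := Suc (row lam i)))))) /
      ((real (row lam i) - real i) - (real (row lam d) - 1 - real d)))"
  proof (rule sum.cong[OF refl])
    fix i assume i: "i \<in> addable (row lam)"
    interpret nu: integer_partition "add_box lam i"
      using i up_eq_add_box by (intro integer_partition_up) blast
    have "dim (add_box lam i) = card (Syt (diagram ((row lam)(i := Suc (row lam i)))))"
      by (simp add: dim_def nu.Tab_eq_Syt boxes_eq_diagram row_add_box addable_le_length[OF i])
    then show "real (dim (add_box lam i)) / (added_content (add_box lam i) - z) =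
        real (card (Syt (diagram ((row lam)(i := Suc (row lam i)))))) /
          ((real (row lam i) - real i) - (real (row lam d) - 1 - real d))"
      by (simp only: added_content_add_box[OF i] d(2))
  qed
  also have "\<dots> = 0" by (rule kerov_equation[OF rows d(1)])
  finally show ?thesis .
qed

lemma compression_eigenvalue_eq_pole_sum:
  assumes "L \<subseteq> up lam"
  shows "compression_eigenvalue L R =
    pole_sum dim_at (added_content ` L) (real_of_int (content_at lam R (sum_list lam))) /
      real (dim_sum L)"
  unfolding pole_sum_added_content[OF assms] compression_eigenvalue_def branching_eigenvalue_def
    sum_divide_distrib
  by (simp add: added_content_def mult.commute)

lemma eigenvalues_constant_iff:
  assumes L: "L \<noteq> {}" "L \<subseteq> up lam" and "sum_list lam \<ge> 1"
  shows "(\<exists>\<alpha>. \<forall>R\<in>Tab lam. (compression_eigenvalue L R)\<^sup>2 = \<alpha>) \<longleftrightarrow>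
    (\<exists>\<alpha>. \<forall>z\<in>corner_contents. (pole_sum dim_at (added_content ` L) z)\<^sup>2 = \<alpha>)"
proof -
  let ?D = "(real (dim_sum L))\<^sup>2" and ?f = "\<lambda>z. (pole_sum dim_at (added_content ` L) z)\<^sup>2"
  have D: "?D > 0" using dim_sum_pos[OF L] by simp
  have "corner_contents = (\<lambda>R. real_of_int (content_at lam R (sum_list lam))) ` Tab lam"
    using arg_cong[OF last_contents[OF assms(3)], of "image real_of_int"]
    by (simp add: corner_contents_def image_image)
  then have "(\<forall>R\<in>Tab lam. (compression_eigenvalue L R)\<^sup>2 = \<alpha>) \<longleftrightarrow> (\<forall>z\<in>corner_contents. ?f z / ?D = \<alpha>)"
    for \<alpha>
    by (simp add: compression_eigenvalue_eq_pole_sum[OF L(2)] power_divide)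
  moreover have "(\<exists>\<alpha>. \<forall>z\<in>corner_contents. ?f z / ?D = \<alpha>) \<longleftrightarrow> (\<exists>\<alpha>. \<forall>z\<in>corner_contents. ?f z = \<alpha>)"
    using D by (metis div_by_0 eq_divide_eq less_irrefl)
  ultimately show ?thesis by simp
qed

theorem isoclinic_partition_iff_poles:
  assumes "sum_list lam \<ge> 1"
  shows "isoclinic_partition lam \<longleftrightarrow> isoclinic_poles dim_at addable_contents corner_contents"
proof -
  let ?n = "sum_list lam + 1"
  define transversal where "transversal t \<longleftrightarrow> (\<forall>k\<in>{1..?n}. t k permutes {1..?n} \<and> t k ?n = k)" for t
  have "transversal (\<lambda>k. Transposition.transpose k ?n)"
    by (auto simp: transversal_def intro!: permutes_swap_id)
  then have "(\<forall>t. transversal t \<longrightarrow>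
        equi_isoclinic {1..?n} (Sigma L Tab) (\<lambda>k. young_rep_sum L (t k) ` W_space L lam)) \<longleftrightarrow>
      (\<exists>\<alpha>. \<forall>z\<in>corner_contents. (pole_sum dim_at (added_content ` L) z)\<^sup>2 = \<alpha>)"
    if "L \<noteq> {}" "L \<subset> up lam" for L
    using equi_isoclinic_iff_eigenvalues[OF that(1) psubset_imp_subset[OF that(2)] assms]
      eigenvalues_constant_iff[OF that(1) psubset_imp_subset[OF that(2)] assms]
    unfolding transversal_def[symmetric] by metis
  then show ?thesis
    unfolding isoclinic_partition_def Let_def addable_contents_def
      isoclinic_poles_image[OF inj_on_added_content]
    using partition unfolding transversal_def by (simp cong: conj_cong)
qed

end

section \<open>The four-block partition\<close>

definition block_rows :: "nat \<Rightarrow> nat \<Rightarrow> nat \<Rightarrow> nat \<Rightarrow> nat \<Rightarrow> nat" where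
  "block_rows a b c e i = (if i < a then a + b + c + e else if i < a + b then a + b + c
     else if i < a + b + c then a + b else if i < a + b + c + e then a else 0)"

lemma row_blocks:
  "row (replicate a (a + b + c + e) @ replicate b (a + b + c) @ replicate c (a + b) @ replicate e a) =
    block_rows a b c e"
  by (auto simp: row_def block_rows_def nth_append fun_eq_iff)

lemma addable_block_rows:
  fixes a b c e :: nat
  assumes "a > 0" "b > 0" "c > 0" "e > 0"
  defines "r \<equiv> block_rows a b c e"
  shows "(\<lambda>i. real (r i) - real i) ` addable r =
    {real (a + b + c + e), real (b + c), 0, - real (b + c), - real (a + b + c + e)}"
proof -
  have "addable r = {0, a, a + b, a + b + c, a + b + c + e}"
    unfolding addable_def r_def block_rows_def using assms(1-4) by (auto split: if_splits)
  then show ?thesis unfolding r_def block_rows_def using assms(1-4) by (simp add: image_insert)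
qed

lemma removable_block_rows:
  fixes a b c e :: nat
  assumes "a > 0" "b > 0" "c > 0" "e > 0"
  defines "r \<equiv> block_rows a b c e"
  shows "(\<lambda>i. real (r i) - 1 - real i) ` removable r =
    {real (b + c + e), real c, - real c, - real (b + c + e)}"
proof -
  have "removable r = {a - 1, a + b - 1, a + b + c - 1, a + b + c + e - 1}"
    unfolding removable_def r_def block_rows_def using assms(1-4) by (auto split: if_splits)
  moreover have "real (r (a - 1)) - 1 - real (a - 1) = real (b + c + e)"
    "real (r (a + b - 1)) - 1 - real (a + b - 1) = real c"
    "real (r (a + b + c - 1)) - 1 - real (a + b + c - 1) = - real c"
    "real (r (a + b + c + e - 1)) - 1 - real (a + b + c + e - 1) = - real (b + c + e)"
    unfolding r_def block_rows_def using assms(1-4) by (auto simp: of_nat_diff)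
  ultimately show ?thesis by (simp only: image_insert image_empty)
qed

theorem theorem6p13:
  fixes a b c e :: nat and \<mu> :: "nat list"
  assumes "a > 0" and "b > 0" and "c > 0" and "e > 0"
    and "\<mu> = replicate a (a + b + c + e) @ replicate b (a + b + c) @
             replicate c (a + b) @ replicate e a"
  shows "isoclinic_partition \<mu> \<longleftrightarrow> real e = (real b)\<^sup>2 / real c + real b"
proof -
  have "partition_of \<mu> (sum_list \<mu>)" and nonempty: "sum_list \<mu> \<ge> 1"
    using partition_of_block_partition[OF assms(1-4)] assms(1,5)
    by (auto simp: partition_of_def Suc_le_eq)
  then interpret integer_partition \<mu> by unfold_locales
  note row = row_blocks[of a b c e, folded assms(5)]
  interpret symmetric_poles "real (a + b + c + e)" "real (b + c)" "real (b + c + e)" "real c"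
    dim_at addable_contents corner_contents
  proof
    show "addable_contents =
      {real (a + b + c + e), real (b + c), 0, - real (b + c), - real (a + b + c + e)}"
      unfolding addable_contents_eq row by (rule addable_block_rows[OF assms(1-4)])
    show "corner_contents = {real (b + c + e), real c, - real c, - real (b + c + e)}"
      unfolding corner_contents_eq row by (rule removable_block_rows[OF assms(1-4)])
  qed (use assms(1-4) dim_at_pos pole_sum_dim_at_eq_0 in auto)
  have "isoclinic_partition \<mu> \<longleftrightarrow> (real (b + c))\<^sup>2 = real c * real (b + c + e)"
    unfolding isoclinic_partition_iff_poles[OF nonempty] by (rule isoclinic_poles_iff)
  also have "\<dots> \<longleftrightarrow> real e = (real b)\<^sup>2 / real c + real b"
    using assms(3) by (auto simp: field_simps power2_eq_square)
  finally show ?thesis .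
qed

end
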